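(* Let $\mathcal{X}_j$, $j=1,\dots,n$, be $n$ hypersurfaces in $\mathbf{C}^n$ defined by polynomial equations $F_j(\zeta)=0$, and let $\Delta_j$ be the Newton polyhedron of $F_j$ (considered as a Laurent polynomial). Suppose there exist convex polyhedra $\delta_1,\dots,\delta_n\subset\mathbf{R}^n$ with vertices in $\mathbf{Q}^n$ such that $\delta_j\subset\Delta_j$ for all $j$, $\dim(\delta_1+\cdots+\delta_n)=n$, and, for some constants $c>0$, $R>0$, $$\sum_{j=1}^n\frac{|F_j(e^{\zeta_1},\dots,e^{\zeta_n})|}{e^{H_{\delta_j}(\mathrm{Re}\,\zeta)}}\ge c\qquad\text{for all }\zeta\in\mathbf{C}^n\text{ with }\|\mathrm{Re}\,\zeta\|\ge R .$$ Suppose also that all common zeroes of $F_1,\dots,F_n$ in $(\mathbf{C}^* )^n$ are simple, and let $\mathcal{Z}=(\mathbf{C}^* )^n\cap\{F_1=\cdots=F_n=0\}$. Then any hypersurface $\mathcal{Y}=\{Q=0\}$ in $\mathbf{C}^n$, where $Q$ is a polynomial whose Newton polyhedron lies in the interior of $\delta_1+\cdots+\delta_n$, which contains all points of $\mathcal{Z}$ except possibly one, contains all points of $\mathcal{Z}$.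
   Context: The Newton polyhedron of a (Laurent) polynomial is the closed convex hull in $\mathbf{R}^n$ of the set of exponents of its monomials with nonzero coefficient. Polyhedra are compact and sums are Minkowski sums. $H_\delta(x)=\sup_{\xi\in\delta}\langle x,\xi\rangle$ for $x\in\mathbf{R}^n$. A common zero $\alpha$ of $F_1,\dots,F_n$ is simple if the Jacobian determinant $\det(\partial F_j/\partial X_k)$ does not vanish at $\alpha$. *)

theory Defs
  imports "HOL-Analysis.Analysis" "HOL-Library.Poly_Mapping"
begin

text \<open>
  Complex polynomials in the variables \<open>X\<^sub>i\<close>, \<open>i :: 'n\<close>: finitely supported families of
  coefficients, indexed by exponents \<open>'n \<Rightarrow>\<^sub>0 nat\<close>. The number of variables is \<open>CARD('n)\<close>.
\<close>
type_synonym 'n cpoly = "('n \<Rightarrow>\<^sub>0 nat) \<Rightarrow>\<^sub>0 complex"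

definition cpoly_eval :: "'n::finite cpoly \<Rightarrow> complex ^ 'n \<Rightarrow> complex" where
  "cpoly_eval p z =
     (\<Sum>m\<in>Poly_Mapping.keys p. Poly_Mapping.lookup p m * (\<Prod>i\<in>UNIV. (z $ i) ^ Poly_Mapping.lookup m i))"

definition hypersurface :: "'n::finite cpoly \<Rightarrow> (complex ^ 'n) set" where
  "hypersurface p = {z. cpoly_eval p z = 0}"

definition exponent_vector :: "('n::finite \<Rightarrow>\<^sub>0 nat) \<Rightarrow> real ^ 'n" where
  "exponent_vector m = (\<chi> i. real (Poly_Mapping.lookup m i))"

definition newton_polyhedron :: "'n::finite cpoly \<Rightarrow> (real ^ 'n) set" where
  "newton_polyhedron p = closure (convex hull (exponent_vector ` Poly_Mapping.keys p))"

text \<open>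
  The supremum is taken in the reals, so the value is meaningful only for nonempty bounded sets.
\<close>
definition support_function :: "(real ^ 'n::finite) set \<Rightarrow> real ^ 'n \<Rightarrow> real" where
  "support_function \<delta> x = (SUP \<xi>\<in>\<delta>. x \<bullet> \<xi>)"

definition rational_polytope :: "(real ^ 'n::finite) set \<Rightarrow> bool" where
  "rational_polytope \<delta> \<longleftrightarrow> polytope \<delta> \<and> (\<forall>v. v extreme_point_of \<delta> \<longrightarrow> (\<forall>i. v $ i \<in> \<rat>))"

definition Re_vec :: "complex ^ 'n::finite \<Rightarrow> real ^ 'n" where
  "Re_vec z = (\<chi> i. Re (z $ i))"

definition exp_vec :: "complex ^ 'n::finite \<Rightarrow> complex ^ 'n" where
  "exp_vec z = (\<chi> i. exp (z $ i))"

definition torus :: "(complex ^ 'n::finite) set" where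
  "torus = {z. \<forall>i. z $ i \<noteq> 0}"

definition partial_deriv :: "'n::finite \<Rightarrow> (complex ^ 'n \<Rightarrow> complex) \<Rightarrow> complex ^ 'n \<Rightarrow> complex" where
  "partial_deriv k f z = deriv (\<lambda>t. f (\<chi> i. if i = k then t else z $ i)) (z $ k)"

definition jacobian_det :: "('n::finite \<Rightarrow> 'n cpoly) \<Rightarrow> complex ^ 'n \<Rightarrow> complex" where
  "jacobian_det F z = det (\<chi> j k. partial_deriv k (cpoly_eval (F j)) z)"

definition torus_zeros :: "('n::finite \<Rightarrow> 'n cpoly) \<Rightarrow> (complex ^ 'n) set" where
  "torus_zeros F = torus \<inter> (\<Inter>j. hypersurface (F j))"

end

theory Submission
  imports Defs "HOL-Complex_Analysis.Complex_Analysis"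
begin

text \<open>
  It suffices that the global residue \<open>\<tau> = \<Sum> Q(z) / (z\<^sub>1 \<cdots> z\<^sub>n J(z))\<close>, summed over the zeros of
  \<open>F\<close> in the torus, vanishes: only one summand can be nonzero.

  After pulling back by \<open>z \<mapsto> z\<^sup>N\<close> the vertices of the \<open>\<delta>\<^sub>j\<close> are integral. Perturb \<open>F\<^sub>j\<close> to
  \<open>F\<^sub>j - s \<Sum>\<^sub>\<nu> w\<^sub>\<nu>\<^sub>j P\<^sub>\<nu>\<^sub>j\<close>, where \<open>P\<^sub>\<nu>\<^sub>j\<close> are the monomials at the vertices of \<open>\<delta>\<^sub>j\<close>. By the growth
  hypothesis no zero escapes to infinity for small \<open>s\<close>; by a dimension count (algebraic dependence)
  zeros escape or degenerate, for almost every direction \<open>w\<close>, only at finitely many \<open>s\<close>, and their number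
  is bounded. So the perturbed residue \<open>\<phi>\<^sub>w(s)\<close> is holomorphic off a finite set not containing \<open>0\<close>, and
  \<open>\<phi>\<^sub>w(0) = \<tau>\<close>. By Cauchy-Schwarz \<open>|\<phi>\<^sub>w(s)|\<^sup>2\<close> is at most a constant times
  \<open>\<Sum> |Q / (z\<^sub>1 \<cdots> z\<^sub>n J)|\<^sup>2\<close>, and averaging this over \<open>w\<close> in the polydisc gives at most
  \<open>|s|\<^sup>-\<^sup>2\<^sup>n\<close> times the integral over the torus of \<open>|Q / (z\<^sub>1 \<cdots> z\<^sub>n)|\<^sup>2\<close> divided by the squared moduli of
  the dominating monomials. That integral is finite because the Newton polyhedron of \<open>Q\<close> lies in the
  interior of \<open>\<delta>\<^sub>1 + \<dots> + \<delta>\<^sub>n\<close>. Hence almost every \<open>\<phi>\<^sub>w\<close> is locally square integrable, thus entire, and the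
  mean value property on the shells \<open>R \<le> |s| \<le> 2R\<close> yields \<open>|\<tau>|\<^sup>2 = O(R\<^sup>-\<^sup>2\<^sup>n)\<close>, so \<open>\<tau> = 0\<close>.
\<close>

text \<open>All analysis takes place in the scalar parameter \<open>s\<close>; no cycle in several
  variables is integrated over. Squares are the right size because a complex linear map with
  determinant J multiplies real volume by |J|^2: when directions w are parametrised by the zeros z
  they produce, |q / J|^2 at the zeros becomes |q|^2 integrated against volume. Averaging over w
  thus cancels the Jacobians, for which no lower bound is available. The same exponent makes
  isolated singularities in \<open>s\<close> removable, so escaping or colliding zeros at the
  finitely many bad \<open>s\<close> need no separate study. All tuples of vertices enter the
  perturbation at once, since the dominating tuple depends on the direction in which z goes to
  infinity in the torus; at a given z only the dominating one has to be random. The factor |s|^(-2n)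
  is the price of rescaling n complex coordinates by \<open>s\<close>. Integral vertices make the
  vertex monomials single-valued; the power map used for this is unramified on the torus, so it
  keeps zeros simple and gives all preimages of a zero the same residue.\<close>

no_notation fps_nth (infixl "$" 75)

section \<open>Linear images of Lebesgue measure\<close>

lemma nn_integral_lborel_add:
  fixes f :: "'a::euclidean_space \<Rightarrow> ennreal"
  assumes [measurable]: "f \<in> borel_measurable borel"
  shows "(\<integral>\<^sup>+x. f (a + x) \<partial>lborel) = (\<integral>\<^sup>+x. f x \<partial>lborel)"
proof -
  have "(\<integral>\<^sup>+x. f x \<partial>lborel) = (\<integral>\<^sup>+x. f x \<partial>(distr lborel borel ((+) a)))"
    by (simp add: lborel_distr_plus)
  also have "\<dots> = (\<integral>\<^sup>+x. f (a + x) \<partial>lborel)"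
    by (subst nn_integral_distr) auto
  finally show ?thesis by simp
qed

lemma nn_integral_lborel_reflect:
  fixes f :: "'a::euclidean_space \<Rightarrow> ennreal"
  assumes [measurable]: "f \<in> borel_measurable borel"
  shows "(\<integral>\<^sup>+x. f (a - x) \<partial>lborel) = (\<integral>\<^sup>+x. f x \<partial>lborel)"
proof -
  have "(\<integral>\<^sup>+x. f x \<partial>lborel) =
      (\<integral>\<^sup>+x. f x \<partial>(density (distr lborel borel (\<lambda>x. a + (-1) *\<^sub>R x)) (\<lambda>_. ennreal (\<bar>-1\<bar>^DIM('a)))))"
    using lborel_affine[of "-1" a] by (rule arg_cong) simp
  also have "\<dots> = (\<integral>\<^sup>+x. f (a - x) \<partial>lborel)"
    by (simp add: density_1 nn_integral_distr)
  finally show ?thesis by simp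
qed

text \<open>
  Uniqueness of Haar measure, by the classical double integral of
  \<open>indicator A (T x) * indicator B (y + T x)\<close>.
\<close>
lemma linear_vimage_scale:
  fixes T :: "'a::euclidean_space \<Rightarrow> 'a"
  assumes T: "linear T" "bij T"
  obtains k :: real where "k > 0"
    "\<And>S. S \<in> sets borel \<Longrightarrow> emeasure lborel (T -` S) = ennreal k * emeasure lborel S"
proof -
  have cT: "continuous_on UNIV T"
    using T(1) by (simp add: linear_continuous_on linear_conv_bounded_linear)
  have mT [measurable]: "T \<in> borel_measurable borel"
    using cT by (rule borel_measurable_continuous_onI)
  define T' where "T' = inv T"
  have T': "T (T' x) = x" "T' (T x) = x" for x
    using T(2) by (simp_all add: T'_def bij_is_surj surj_f_inv_f bij_is_inj)
  have linT': "linear T'"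
    unfolding T'_def using T
    by (metis bij_is_inj bij_is_surj inj_linear_imp_inv_linear)
  define B :: "'a set" where "B = ball 0 1"
  have eqAB: "emeasure lborel (T -` A) * emeasure lborel B = emeasure lborel (T -` B) * emeasure lborel A"
    if [measurable]: "A \<in> sets borel" for A
  proof -
    have [measurable]: "B \<in> sets borel" by (simp add: B_def)
    have vA [measurable]: "T -` A \<in> sets borel" using measurable_sets[OF mT that] by simp
    have vB [measurable]: "T -` B \<in> sets borel" using measurable_sets[OF mT, of B] by simp
    have "emeasure lborel (T -` A) * emeasure lborel B
        = (\<integral>\<^sup>+x. indicator A (T x) * (\<integral>\<^sup>+y. indicator B y \<partial>lborel) \<partial>lborel)"
      using vA by (subst nn_integral_multc) (auto simp: indicator_vimage[symmetric] nn_integral_indicator)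
    also have "\<dots> = (\<integral>\<^sup>+x. indicator A (T x) * (\<integral>\<^sup>+y. indicator B (T x + y) \<partial>lborel) \<partial>lborel)"
      by (subst nn_integral_lborel_add) auto
    also have "\<dots> = (\<integral>\<^sup>+x. (\<integral>\<^sup>+y. indicator A (T x) * indicator B (T x + y) \<partial>lborel) \<partial>lborel)"
      by (subst nn_integral_cmult) auto
    also have "\<dots> = (\<integral>\<^sup>+y. (\<integral>\<^sup>+x. indicator A (T x) * indicator B (T x + y) \<partial>lborel) \<partial>lborel)"
      by (rule lborel_pair.Fubini'[symmetric]) simp
    \<comment> \<open>Translation by \<open>T' y\<close> moves the shift \<open>y\<close> from
      \<open>B\<close> to \<open>A\<close>; after the exchange of integrals the inner integral is
      the measure of \<open>A\<close>, by reflection invariance.\<close>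
    also have "\<dots> = (\<integral>\<^sup>+y. (\<integral>\<^sup>+x. indicator A (T x - y) * indicator B (T x) \<partial>lborel) \<partial>lborel)"
    proof (rule nn_integral_cong)
      fix y :: 'a
      have "(\<integral>\<^sup>+x. indicator A (T x - y) * indicator B (T x) \<partial>lborel)
          = (\<integral>\<^sup>+x. indicator A (T (T' y + x) - y) * indicator B (T (T' y + x)) \<partial>lborel)"
        by (rule nn_integral_lborel_add[symmetric]) simp
      also have "\<dots> = (\<integral>\<^sup>+x. indicator A (T x) * indicator B (T x + y) \<partial>lborel)"
        by (simp add: linear_add[OF T(1)] T' add.commute)
      finally show "(\<integral>\<^sup>+x. indicator A (T x) * indicator B (T x + y) \<partial>lborel)
        = (\<integral>\<^sup>+x. indicator A (T x - y) * indicator B (T x) \<partial>lborel)" by simp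
    qed
    also have "\<dots> = (\<integral>\<^sup>+x. (\<integral>\<^sup>+y. indicator A (T x - y) * indicator B (T x) \<partial>lborel) \<partial>lborel)"
      by (rule lborel_pair.Fubini') simp
    also have "\<dots> = (\<integral>\<^sup>+x. indicator B (T x) * (\<integral>\<^sup>+y. indicator A (T x - y) \<partial>lborel) \<partial>lborel)"
      by (subst nn_integral_multc) (auto simp: mult.commute)
    also have "\<dots> = (\<integral>\<^sup>+x. indicator B (T x) * (\<integral>\<^sup>+y. indicator A y \<partial>lborel) \<partial>lborel)"
      by (subst nn_integral_lborel_reflect) auto
    also have "\<dots> = emeasure lborel (T -` B) * emeasure lborel A"
      using vB by (subst nn_integral_multc) (auto simp: indicator_vimage[symmetric] nn_integral_indicator)
    finally show ?thesis .
  qed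
  have img: "T -` B = T' ` B"
    using T' by (metis bij_vimage_eq_inv_image T'_def T(2))
  have "bounded (T' ` B)"
    unfolding B_def using linT' by (intro bounded_linear_image) (auto simp: linear_conv_bounded_linear)
  then have fin: "emeasure lborel (T -` B) < \<infinity>"
    unfolding img by (rule emeasure_bounded_finite)
  have "open (T -` B)"
    unfolding B_def using cT by (simp add: open_vimage)
  moreover have "0 \<in> T -` B" using T(1) by (simp add: B_def linear_0)
  ultimately obtain e where e: "e > 0" "ball 0 e \<subseteq> T -` B"
    by (meson open_contains_ball)
  have ballpos: "emeasure lborel (ball (0::'a) r) > 0" if "r > 0" for r
    using that content_ball_pos[of r "0::'a"]
    by (metis emeasure_eq_ennreal_measure emeasure_lborel_ball_finite ennreal_less_zero_iff less_irrefl top.not_eq_extremum infinity_ennreal_def)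
  have pos: "emeasure lborel (T -` B) > 0"
    using ballpos[OF e(1)] e(2) emeasure_mono[OF e(2), of lborel] \<open>open (T -` B)\<close> by (auto simp: less_le_trans)
  have Bfin: "emeasure lborel B < \<infinity>" and Bpos: "emeasure lborel B > 0"
    unfolding B_def using emeasure_lborel_ball_finite ballpos by auto
  obtain b where b: "emeasure lborel B = ennreal b" "b > 0"
    using Bfin Bpos by (cases "emeasure lborel B") auto
  obtain t where t: "emeasure lborel (T -` B) = ennreal t" "t > 0"
    using fin pos by (cases "emeasure lborel (T -` B)") auto
  show ?thesis
  proof (rule that[of "t / b"])
    show "t / b > 0" using b t by simp
    fix S :: "'a set" assume S: "S \<in> sets borel"
    have "emeasure lborel (T -` S) = (emeasure lborel (T -` S) * ennreal b) / ennreal b"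
      using b(2) by (simp add: ennreal_mult_divide_eq)
    also have "\<dots> = (ennreal t * emeasure lborel S) / ennreal b"
      using eqAB[OF S] by (simp add: b t)
    also have "\<dots> = ennreal (t / b) * emeasure lborel S"
      using b t by (simp add: divide_ennreal[symmetric] ennreal_divide_times mult.commute ennreal_times_divide)
    finally show "emeasure lborel (T -` S) = ennreal (t / b) * emeasure lborel S" .
  qed
qed

section \<open>Volume scaling of complex matrices through elementary factors\<close>

definition scales_by :: "complex^'n::finite^'n \<Rightarrow> real \<Rightarrow> bool" where
  "scales_by A k \<longleftrightarrow> k > 0 \<and>
     (\<forall>S\<in>sets borel. emeasure lborel ((*v) A -` S) = ennreal k * emeasure lborel S)"

lemma linear_complex_matrix: "linear ((*v) (A :: complex^'n::finite^'n))"
  by (rule linearI) (simp_all add: matrix_vector_mult_def vec_eq_iff scaleR_sum_right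
      distrib_left sum.distrib)

lemma measurable_complex_matrix [measurable]:
  "(*v) (A :: complex^'n::finite^'n) \<in> borel_measurable borel"
  using linear_complex_matrix[of A]
  by (intro borel_measurable_continuous_onI) (simp add: linear_continuous_on linear_conv_bounded_linear)

lemma bij_complex_matrix:
  assumes "det (A :: complex^'n::finite^'n) \<noteq> 0"
  shows "bij ((*v) A)"
proof -
  obtain B where "A ** B = mat 1" "B ** A = mat 1"
    using assms by (metis invertible_def invertible_det_nz)
  then show ?thesis
    by (intro o_bij[of "(*v) B"]) (auto simp: fun_eq_iff matrix_vector_mul_assoc)
qed

lemma scales_by_exists:
  assumes "det (A :: complex^'n::finite^'n) \<noteq> 0"
  obtains k where "scales_by A k"
  using linear_vimage_scale[OF linear_complex_matrix bij_complex_matrix[OF assms]]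
  unfolding scales_by_def by metis

lemma ball_emeasure: obtains b where "b > 0" "emeasure lborel (ball (0::'a::euclidean_space) 1) = ennreal b"
  using content_ball_pos[of 1 "0::'a"]
  by (metis emeasure_eq_ennreal_measure emeasure_lborel_ball_finite less_irrefl infinity_ennreal_def zero_less_one)

text \<open>A ball has positive finite volume, so the factor is determined by the matrix. Together
  with \<open>scales_by_mult\<close> this lets identities between matrices determine unknown
  factors.\<close>

lemma scales_by_unique:
  assumes "scales_by A k" "scales_by A l"
  shows "k = l"
proof -
  obtain b where b: "b > 0" "emeasure lborel (ball (0::complex^'a) 1) = ennreal b"
    by (rule ball_emeasure)
  have "ennreal k * ennreal b = ennreal l * ennreal b"
    using assms b unfolding scales_by_def by (metis borel_open open_ball)
  then have "ennreal (k * b) = ennreal (l * b)"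
    using assms b by (simp add: scales_by_def ennreal_mult)
  then show ?thesis
    using assms b by (simp add: scales_by_def)
qed

lemma scales_by_mult:
  assumes "scales_by A k" "scales_by B l"
  shows "scales_by (A ** B) (k * l)"
  unfolding scales_by_def
proof (intro conjI ballI)
  show "0 < k * l" using assms by (simp add: scales_by_def)
  fix S :: "(complex^'a) set" assume S: "S \<in> sets borel"
  have "(*v) A -` S \<in> sets borel" using measurable_sets[OF measurable_complex_matrix S] by simp
  moreover have "(*v) (A ** B) -` S = (*v) B -` ((*v) A -` S)"
    by (auto simp: matrix_vector_mul_assoc)
  ultimately show "emeasure lborel ((*v) (A ** B) -` S) = ennreal (k * l) * emeasure lborel S"
    using assms S unfolding scales_by_def by (simp add: ennreal_mult mult_ac)
qed

text \<open>The unit ball is its own preimage, which forces the factor 1.\<close>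

lemma scales_by_isometry:
  assumes "det A \<noteq> 0" "\<And>x. norm (A *v x) = norm x"
  shows "scales_by A 1"
proof -
  obtain k where k: "scales_by A k" using scales_by_exists[OF assms(1)] .
  obtain b where b: "b > 0" "emeasure lborel (ball (0::complex^'a) 1) = ennreal b"
    by (rule ball_emeasure)
  have "(*v) A -` ball 0 1 = ball 0 1" using assms(2) by auto
  then have "ennreal b = ennreal k * ennreal b"
    using k b unfolding scales_by_def by (metis borel_open open_ball)
  then have "ennreal b = ennreal (k * b)"
    using k b by (simp add: scales_by_def ennreal_mult)
  then have "k = 1"
    using k b by (simp add: scales_by_def)
  then show ?thesis using k by simp
qed

text \<open>The elementary matrix that clears column \<open>c\<close> in Gaussian elimination;
  elimination writes every invertible matrix as a product of such factors.\<close>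

definition colmat :: "'n \<Rightarrow> complex^'n::finite \<Rightarrow> complex^'n^'n" where
  "colmat c v = (\<chi> i j. if j = c then v $ i else of_bool (i = j))"

lemma colmat_mult: "(colmat c v *v x) $ i = (if i = c then v $ c * x $ c else x $ i + v $ i * x $ c)"
proof -
  have "(colmat c v *v x) $ i = v $ i * x $ c + (\<Sum>j\<in>UNIV - {c}. of_bool (i = j) * x $ j)"
    by (simp add: colmat_def matrix_vector_mult_def sum.remove[of UNIV c])
  also have "(\<Sum>j\<in>UNIV - {c}. of_bool (i = j) * x $ j) = (\<Sum>j\<in>UNIV - {c}. if j = i then x $ j else 0)"
    by (rule sum.cong) auto
  also have "\<dots> = (if i = c then 0 else x $ i)"
    by (subst sum.delta) auto
  finally show ?thesis by auto
qed

lemma det_colmat: "det (colmat c v) = v $ c"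
proof -
  have "colmat c v = (\<chi> i j. if j = c then (mat 1 *v v) $ i else mat 1 $ i $ j)"
    unfolding colmat_def matrix_vector_mul_lid by (simp add: vec_eq_iff mat_def of_bool_def)
  then have "det (colmat c v) = v $ c * det (mat 1 :: complex^'a^'a)"
    by (simp only: cramer_lemma)
  then show ?thesis by simp
qed

text \<open>Conjugation by the diagonal matrix \<open>D\<close>, which doubles all coordinates
  except \<open>c\<close>, turns the shear into its square. Hence the factor satisfies k = k^2, and
  no integral has to be computed.\<close>

lemma scales_by_shear:
  assumes "v $ c = 1"
  shows "scales_by (colmat c v) 1"
proof -
  define D :: "complex^'a^'a" where "D = (\<chi> i j. if i = j then (if i = c then 1 else 2) else 0)"
  have Dm: "(D *v x) $ i = (if i = c then 1 else 2) * x $ i" for x i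
    by (simp add: D_def matrix_vector_mult_def if_distrib[of "\<lambda>t. t * y" for y] sum.delta' cong: if_cong)
  have "det D = (\<Prod>i\<in>UNIV. D $ i $ i)"
    by (rule det_diagonal) (simp add: D_def)
  then have "det D \<noteq> 0" by (simp add: D_def)
  then obtain d where d: "scales_by D d" by (rule scales_by_exists)
  have "det (colmat c v) \<noteq> 0" using assms by (simp add: det_colmat)
  then obtain k where k: "scales_by (colmat c v) k" by (rule scales_by_exists)
  have eq: "D ** colmat c v = colmat c v ** (colmat c v ** D)"
    unfolding matrix_eq
    by (simp add: matrix_vector_mul_assoc[symmetric] vec_eq_iff Dm colmat_mult assms algebra_simps)
  have "d * k = k * (k * d)"
    using scales_by_unique[OF scales_by_mult[OF d k]] scales_by_mult[OF k scales_by_mult[OF k d]]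
    by (simp add: eq)
  then have "k = 1" using d k by (simp add: scales_by_def)
  then show ?thesis using k by simp
qed

text \<open>One complex coordinate spans two real basis vectors and both are stretched by
  \<open>r\<close>, so the volume of a preimage shrinks by r^2.\<close>

lemma scales_by_real_dilation:
  assumes "r > 0"
  shows "scales_by (colmat c (axis c (complex_of_real r))) (1 / r\<^sup>2)"
proof -
  define X :: "(complex^'a) set" where "X = {axis c 1, axis c \<i>}"
  have X: "X \<subseteq> Basis" by (auto simp: X_def Basis_vec_def Basis_complex_def)
  have ne: "axis c 1 \<noteq> (axis c \<i> :: complex^'a)" by (simp add: axis_eq_axis)
  define f :: "complex^'a \<Rightarrow> real" where "f b = (if b \<in> X then r else 1)" for b
  define T :: "complex^'a \<Rightarrow> complex^'a" where "T x = 0 + (\<Sum>b\<in>Basis. (f b * (x \<bullet> b)) *\<^sub>R b)" for x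
  have Teq: "T x = colmat c (axis c (complex_of_real r)) *v x" for x
  proof -
    have "T x = (\<Sum>b\<in>Basis. (x \<bullet> b) *\<^sub>R b + (if b \<in> X then ((r - 1) * (x \<bullet> b)) *\<^sub>R b else 0))"
      unfolding T_def by (simp, rule sum.cong) (auto simp: f_def algebra_simps)
    also have "\<dots> = x + (\<Sum>b\<in>X. ((r - 1) * (x \<bullet> b)) *\<^sub>R b)"
      using X by (simp add: sum.distrib euclidean_representation sum.inter_restrict[symmetric] Int_absorb1)
    also have "\<dots> = x + axis c ((r - 1) *\<^sub>R (x $ c))"
    proof -
      have "axis c ((r - 1) *\<^sub>R (x $ c)) =
          ((r - 1) * Re (x $ c)) *\<^sub>R axis c 1 + ((r - 1) * Im (x $ c)) *\<^sub>R axis c \<i>"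
        by (simp add: vec_eq_iff axis_def complex_eq_iff)
      then show ?thesis
        using ne by (simp add: X_def inner_axis inner_complex_def)
    qed
    finally show ?thesis
      by (simp add: vec_eq_iff colmat_mult axis_def algebra_simps scaleR_conv_of_real)
  qed
  have pr: "(\<Prod>b\<in>Basis. \<bar>f b\<bar>) = r\<^sup>2"
  proof -
    have "(\<Prod>b\<in>Basis. \<bar>f b\<bar>) = (\<Prod>b\<in>Basis. if b \<in> X then r else 1)"
      using assms by (intro prod.cong) (auto simp: f_def)
    also have "\<dots> = (\<Prod>b\<in>X. r)"
      using X by (simp add: prod.inter_restrict[symmetric] Int_absorb1)
    also have "\<dots> = r\<^sup>2" using ne by (simp add: X_def power2_eq_square)
    finally show ?thesis .
  qed
  have lb: "lborel = density (distr lborel borel T) (\<lambda>_. ennreal (r\<^sup>2))"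
    unfolding pr[symmetric] T_def
    by (rule lborel_affine_euclidean) (use assms in \<open>auto simp: f_def\<close>)
  have TT: "T = (*v) (colmat c (axis c (complex_of_real r)))" using Teq by (rule ext)
  have mT [measurable]: "T \<in> borel_measurable borel"
    unfolding TT by measurable
  show ?thesis
    unfolding scales_by_def
  proof (intro conjI ballI)
    fix S :: "(complex^'a) set" assume S [measurable]: "S \<in> sets borel"
    have "emeasure lborel S = emeasure (density (distr lborel borel T) (\<lambda>_. ennreal (r\<^sup>2))) S"
      using lb by simp
    also have "\<dots> = ennreal (r\<^sup>2) * emeasure lborel (T -` S)"
      by (subst emeasure_density) (auto simp: nn_integral_cmult_indicator emeasure_distr)
    finally have "ennreal (1 / r\<^sup>2) * emeasure lborel S = (ennreal (1 / r\<^sup>2) * ennreal (r\<^sup>2)) * emeasure lborel (T -` S)"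
      by (simp add: mult.assoc)
    also have "ennreal (1 / r\<^sup>2) * ennreal (r\<^sup>2) = 1"
      using assms by (subst ennreal_mult[symmetric]) auto
    finally show "emeasure lborel ((*v) (colmat c (axis c (complex_of_real r))) -` S)
        = ennreal (1 / r\<^sup>2) * emeasure lborel S"
      using TT by simp
  qed (use assms in auto)
qed

text \<open>Polar decomposition of the pivot: a shear, a real dilation by
  \<open>norm (v $ c)\<close>, and the rotation of one coordinate by a unimodular number.\<close>

lemma scales_by_colmat:
  assumes "v $ c \<noteq> 0"
  shows "scales_by (colmat c v) (1 / (norm (v $ c))\<^sup>2)"
proof -
  define r where "r = norm (v $ c)"
  define w where "w = v $ c / complex_of_real r"
  have r: "r > 0" using assms by (simp add: r_def)
  have w: "norm w = 1" using r by (simp add: w_def r_def norm_divide)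
  have 1: "scales_by (colmat c (\<chi> i. if i = c then 1 else v $ i / v $ c)) 1"
    by (rule scales_by_shear) simp
  have 2: "scales_by (colmat c (axis c w)) 1"
  proof (rule scales_by_isometry)
    show "det (colmat c (axis c w)) \<noteq> 0" using w by (auto simp: det_colmat axis_def)
    have "norm ((colmat c (axis c w) *v x) $ i) = norm (x $ i)" for x i
      using w by (simp add: colmat_mult axis_def norm_mult)
    then show "norm (colmat c (axis c w) *v x) = norm x" for x
      by (simp add: norm_vec_def)
  qed
  have eq: "colmat c v = colmat c (\<chi> i. if i = c then 1 else v $ i / v $ c) **
        (colmat c (axis c (complex_of_real r)) ** colmat c (axis c w))"
    unfolding matrix_eq using assms r
    by (simp add: matrix_vector_mul_assoc[symmetric] vec_eq_iff colmat_mult axis_def w_def)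
  show ?thesis
    using scales_by_mult[OF 1 scales_by_mult[OF scales_by_real_dilation[OF r] 2]]
    by (simp add: eq r_def)
qed

text \<open>Gaussian elimination, one column at a time.\<close>
lemma scales_by_det_aux:
  assumes "finite S" "det A \<noteq> 0" "\<And>c i. c \<notin> S \<Longrightarrow> A $ i $ c = of_bool (i = c)"
  shows "scales_by A (1 / (norm (det A))\<^sup>2)"
  using assms
proof (induction S arbitrary: A rule: finite_induct)
  case empty
  then have "A = mat 1" by (simp add: vec_eq_iff mat_def)
  then show ?case using scales_by_isometry[of "mat 1"] by simp
next
  case (insert c S)
  \<comment> \<open>Splitting off the elementary matrix of column \<open>c\<close> turns that column
    into a unit vector and preserves the unit columns outside \<open>insert c S\<close>, so the
    induction hypothesis applies to the other factor.\<close>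
  have pivot: "scales_by A (1 / (norm (det A))\<^sup>2)"
    if dA: "det A \<noteq> 0" and st: "\<And>c' i. c' \<notin> insert c S \<Longrightarrow> A $ i $ c' = of_bool (i = c')"
      and nz: "A $ c $ c \<noteq> 0" for A
  proof -
    define C where "C = colmat c (column c A)"
    define A' where "A' = (\<chi> i j. if j = c then of_bool (i = c) else
        if i = c then A $ c $ j / A $ c $ c else A $ i $ j - A $ i $ c * A $ c $ j / A $ c $ c)"
    have CA: "A = C ** A'"
    proof -
      have "(C ** A') $ i $ j = (C *v column j A') $ i" for i j
        by (simp add: matrix_matrix_mult_def matrix_vector_mult_def column_def)
      then show ?thesis
        using nz by (auto simp: vec_eq_iff C_def colmat_mult column_def A'_def)
    qed
    have dC: "det C = A $ c $ c" by (simp add: C_def det_colmat column_def)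
    have dd: "det A = det C * det A'" unfolding CA by (rule det_mul)
    have "scales_by A' (1 / (norm (det A'))\<^sup>2)"
    proof (rule insert.IH)
      show "det A' \<noteq> 0" using dA dd by auto
      fix c' i assume c': "c' \<notin> S"
      show "A' $ i $ c' = of_bool (i = c')"
      proof (cases "c' = c")
        case True then show ?thesis by (simp add: A'_def)
      next
        case False
        with c' have n: "c' \<notin> insert c S" by simp
        have "A $ i $ c' = of_bool (i = c')" "A $ c $ c' = 0"
          using st[OF n] False by auto
        then show ?thesis using False by (auto simp: A'_def)
      qed
    qed
    moreover have "scales_by C (1 / (norm (det C))\<^sup>2)"
      unfolding dC unfolding C_def using scales_by_colmat[of "column c A" c] nz by (simp add: column_def)
    ultimately have "scales_by (C ** A') (1 / (norm (det C))\<^sup>2 * (1 / (norm (det A'))\<^sup>2))"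
      by (intro scales_by_mult)
    then show ?thesis
      using dd CA by (simp add: norm_mult power_mult_distrib)
  qed
  show ?case
  proof (cases "A $ c $ c = 0")
    case False
    then show ?thesis using pivot insert.prems by blast
  next
    case True
    have "\<exists>r\<in>S. A $ r $ c \<noteq> 0"
    proof (rule ccontr)
      assume no: "\<not> (\<exists>r\<in>S. A $ r $ c \<noteq> 0)"
      \<comment> \<open>Without an entry to pivot on in the rows \<open>S\<close>, this
        \<open>x\<close> would be a nonzero kernel vector: the unit columns outside
        \<open>insert c S\<close> cancel the remaining entries of column \<open>c\<close>.\<close>
      define x where "x = (\<chi> j. if j = c then 1 else if j \<in> S then 0 else - A $ j $ c)"
      have "(A *v x) $ i = 0" for i
      proof -
        have "(A *v x) $ i = A $ i $ c + (\<Sum>j\<in>UNIV - {c}. A $ i $ j * x $ j)"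
          by (simp add: matrix_vector_mult_def sum.remove[of UNIV c] x_def)
        also have "(\<Sum>j\<in>UNIV - {c}. A $ i $ j * x $ j) = (\<Sum>j\<in>UNIV - {c}. if j = i then x $ j else 0)"
        proof (rule sum.cong)
          fix j assume j: "j \<in> UNIV - {c}"
          show "A $ i $ j * x $ j = (if j = i then x $ j else 0)"
            using j insert.prems(2)[of j i] by (cases "j \<in> S") (auto simp: x_def)
        qed simp
        also have "\<dots> = (if i = c then 0 else x $ i)" by (subst sum.delta) auto
        finally show ?thesis using True no by (auto simp: x_def)
      qed
      then have "A *v x = A *v 0" by (simp add: vec_eq_iff)
      then have "x = 0" using bij_complex_matrix[OF insert.prems(1)] by (meson bij_is_inj injD)
      moreover have "x $ c = 1" by (simp add: x_def)
      ultimately show False by simp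
    qed
    then obtain r where r: "r \<in> S" "A $ r $ c \<noteq> 0" by blast
    have rc: "r \<noteq> c" using r insert.hyps by auto
    \<comment> \<open>A zero pivot is repaired by adding row \<open>r\<close> to row
      \<open>c\<close>; this matrix and its inverse \<open>E'\<close> both have determinant
      1.\<close>
    define E where "E = colmat r (axis r 1 + axis c 1)"
    define E' where "E' = colmat r (axis r 1 - axis c 1)"
    have EE: "E' ** E = mat 1"
      unfolding matrix_eq using rc
      by (simp add: matrix_vector_mul_assoc[symmetric] vec_eq_iff colmat_mult axis_def E_def E'_def)
    define A1 where "A1 = E ** A"
    have A1: "A1 $ i $ j = (if i = c then A $ c $ j + A $ r $ j else A $ i $ j)" for i j
    proof -
      have "A1 $ i $ j = (E *v column j A) $ i"
        by (simp add: A1_def matrix_matrix_mult_def matrix_vector_mult_def column_def)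
      then show ?thesis using rc by (auto simp: E_def colmat_mult axis_def column_def)
    qed
    have AE: "A = E' ** A1"
      unfolding A1_def by (simp add: matrix_mul_assoc EE)
    have dE: "det E = 1" "det E' = 1"
      using rc by (auto simp: E_def E'_def det_colmat axis_def)
    have dA: "det A1 = det A" by (simp add: A1_def det_mul dE)
    have "scales_by A1 (1 / (norm (det A1))\<^sup>2)"
    proof (rule pivot)
      show "det A1 \<noteq> 0" using dA insert.prems by simp
      show "A1 $ c $ c \<noteq> 0" using True r by (simp add: A1)
      fix c' i assume "c' \<notin> insert c S"
      then show "A1 $ i $ c' = of_bool (i = c')"
        using insert.prems(2)[of c'] r by (auto simp: A1)
    qed
    moreover have "scales_by E' 1"
      using scales_by_colmat[of "axis r 1 - axis c 1" r] rc by (simp add: E'_def axis_def)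
    ultimately show ?thesis
      using scales_by_mult[of E' 1 A1] AE dA by simp
  qed
qed

lemma emeasure_complex_matrix_vimage:
  fixes A :: "complex^'n::finite^'n"
  assumes "det A \<noteq> 0" "S \<in> sets borel"
  shows "emeasure lborel ((*v) A -` S) = ennreal (1 / (norm (det A))\<^sup>2) * emeasure lborel S"
  using scales_by_det_aux[of UNIV A] assms unfolding scales_by_def by simp

lemma emeasure_complex_mult_vimage:
  assumes "norm w = 1" "S \<in> sets borel"
  shows "emeasure lborel ((*) w -` S) = emeasure lborel (S :: complex set)"
proof -
  have "w \<noteq> 0" using assms by auto
  then have "bij ((*) w)"
    by (intro o_bij[of "(*) (inverse w)"]) (auto simp: fun_eq_iff)
  moreover have "linear ((*) w)" by (simp add: linear_iff algebra_simps)
  ultimately obtain k where k: "k > 0"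
    "\<And>S. S \<in> sets borel \<Longrightarrow> emeasure lborel ((*) w -` S) = ennreal k * emeasure lborel S"
    using linear_vimage_scale by metis
  obtain b where b: "b > 0" "emeasure lborel (ball (0::complex) 1) = ennreal b"
    by (rule ball_emeasure)
  have "(*) w -` ball 0 1 = ball 0 1" using assms(1) by (auto simp: norm_mult)
  then have "ennreal b = ennreal k * ennreal b"
    using k(2)[of "ball 0 1"] b by simp
  then have "ennreal b = ennreal (k * b)"
    using k b by (simp add: ennreal_mult)
  then have "k = 1" using k b by simp
  then show ?thesis using k(2)[OF assms(2)] by simp
qed

section \<open>Square-integrable singularities of holomorphic functions\<close>

lemma nn_integral_complex_rotate:
  assumes "norm w = 1" and [measurable]: "f \<in> borel_measurable borel"
  shows "(\<integral>\<^sup>+z. f (w * z) \<partial>lborel) = (\<integral>\<^sup>+z. f z \<partial>(lborel :: complex measure))"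
proof -
  have "distr lborel borel ((*) w) = lborel"
  proof (rule measure_eqI)
    fix A assume "A \<in> sets (distr lborel borel ((*) w))"
    then have A: "A \<in> sets borel" by simp
    show "emeasure (distr lborel borel ((*) w)) A = emeasure lborel A"
      using A by (subst emeasure_distr) (auto simp: emeasure_complex_mult_vimage[OF assms(1)])
  qed simp
  then have "(\<integral>\<^sup>+z. f z \<partial>lborel) = (\<integral>\<^sup>+z. f z \<partial>(distr lborel borel ((*) w)))" by simp
  also have "\<dots> = (\<integral>\<^sup>+z. f (w * z) \<partial>lborel)" by (subst nn_integral_distr) auto
  finally show ?thesis by simp
qed

text \<open>Cauchy's formula is applied to the square of \<open>f\<close> along the line through
  \<open>z\<close>, as a function of \<open>u\<close> on the unit disc; taking norms gives the
  inequality for |f|^2 directly.\<close>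

lemma circle_sub_mean_value:
  assumes f: "f holomorphic_on ball a r" and z: "norm z < r"
  shows "ennreal ((norm (f a))\<^sup>2) \<le>
    (\<integral>\<^sup>+t. ennreal (indicator {0..1::real} t * (norm (f (a + exp (2 * of_real pi * \<i> * of_real t) * z)))\<^sup>2) \<partial>lborel)"
proof -
  define h where "h u = (f (a + u * z))\<^sup>2" for u
  define e where "e t = exp (2 * of_real pi * \<i> * of_real t)" for t :: real
  have inb: "a + u * z \<in> ball a r" if "norm u \<le> 1" for u
  proof -
    have "norm u * norm z \<le> 1 * norm z" using that by (intro mult_right_mono) auto
    then show ?thesis using z by (simp add: dist_norm norm_mult)
  qed
  have ne: "norm (e t) = 1" for t by (simp add: e_def norm_exp_eq_Re)
  have hol: "(\<lambda>u. f (a + u * z)) holomorphic_on {u. a + u * z \<in> ball a r}"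
    by (rule holomorphic_on_compose_gen[unfolded o_def, OF _ f]) (auto intro!: holomorphic_intros)
  have hc: "h holomorphic_on cball 0 1"
    unfolding h_def by (rule holomorphic_on_power, rule holomorphic_on_subset[OF hol]) (use inb in auto)
  have ch: "continuous_on (cball 0 1) h" using hc holomorphic_on_imp_continuous_on by blast
  have ce: "continuous_on S e" for S unfolding e_def by (intro continuous_intros)
  have che: "continuous_on S (\<lambda>t. h (e t))" for S
    by (rule continuous_on_compose2[OF ch ce]) (use ne in auto)
  have "((\<lambda>u. h u / (u - 0)) has_contour_integral (2 * of_real pi * \<i> * h 0)) (circlepath 0 1)"
    by (rule Cauchy_integral_circlepath) (use ch hc in \<open>auto intro: holomorphic_on_subset\<close>)
  then have "((\<lambda>t. (2 * of_real pi * \<i>) * h (e t)) has_integral (2 * of_real pi * \<i> * h 0)) {0..1}"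
    unfolding has_contour_integral_def
    by (rule has_integral_eq[rotated]) (auto simp: vector_derivative_circlepath01, auto simp: circlepath e_def)
  then have 1: "((\<lambda>t. h (e t)) has_integral h 0) {0..1}"
    by (subst (asm) has_integral_mult_right_iff) auto
  have "norm (h 0) \<le> integral {0..1} (\<lambda>t. norm (h (e t)))"
    using 1 integral_norm_bound_integral[of "\<lambda>t. h (e t)" "{0..1}" "\<lambda>t. norm (h (e t))"]
    by (metis che continuous_on_norm has_integral_integrable integrable_continuous_real integral_unique order_refl)
  moreover have hi: "((\<lambda>t. norm (h (e t))) has_integral integral {0..1} (\<lambda>t. norm (h (e t)))) {0..1}"
    by (intro integrable_integral integrable_continuous_real continuous_on_norm che)
  ultimately have "ennreal (norm (h 0)) \<le> ennreal (integral {0..1} (\<lambda>t. norm (h (e t))))"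
    by (intro ennreal_leI)
  also have "\<dots> = (\<integral>\<^sup>+t. ennreal (indicator {0..1} t * norm (h (e t))) \<partial>lborel)"
  proof (rule nn_integral_has_integral_lborel[symmetric])
    have [measurable]: "(\<lambda>t. h (e t)) \<in> borel_measurable borel"
      by (rule borel_measurable_continuous_onI[OF che])
    show "(\<lambda>t. indicator {0..1} t * norm (h (e t))) \<in> borel_measurable borel" by measurable
    show "((\<lambda>t. indicator {0..1} t * norm (h (e t))) has_integral integral {0..1} (\<lambda>t. norm (h (e t)))) UNIV"
      using hi by (subst (asm) has_integral_restrict_UNIV[symmetric]) (simp add: indicator_def of_bool_def if_distrib[of "\<lambda>x. x * y" for y] cong: if_cong)
  qed auto
  finally show ?thesis by (simp add: h_def e_def norm_power)
qed

text \<open>Averaging over rotations turns the mean value property on circles into one on areas.\<close>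
lemma area_sub_mean_value:
  assumes f: "f holomorphic_on ball a r" and A: "A \<in> sets borel" "A \<subseteq> ball 0 r"
    and rot: "\<And>w z. norm w = 1 \<Longrightarrow> w * z \<in> A \<longleftrightarrow> z \<in> A"
  shows "ennreal ((norm (f a))\<^sup>2) * emeasure lborel A \<le>
    (\<integral>\<^sup>+z. ennreal ((norm (f (a + z)))\<^sup>2) * indicator A z \<partial>lborel)"
proof -
  note A(1)[measurable]
  define e where "e t = exp (2 * of_real pi * \<i> * of_real t)" for t :: real
  have ne: "norm (e t) = 1" for t by (simp add: e_def norm_exp_eq_Re)
  have [measurable]: "e \<in> borel_measurable borel"
    unfolding e_def by (intro borel_measurable_continuous_onI continuous_intros)
  define g where "g z = indicator (ball 0 r) z *\<^sub>R f (a + z)" for z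
  have "continuous_on (ball 0 r) (\<lambda>z. f (a + z))"
    by (rule continuous_on_compose2[OF holomorphic_on_imp_continuous_on[OF f]])
       (auto intro!: continuous_intros simp: dist_norm)
  then have [measurable]: "g \<in> borel_measurable borel"
    unfolding g_def by (intro borel_measurable_continuous_on_indicator) auto
  have "ennreal ((norm (f a))\<^sup>2) * emeasure lborel A
      = (\<integral>\<^sup>+z. ennreal ((norm (f a))\<^sup>2) * indicator A z \<partial>lborel)"
    by (simp add: nn_integral_cmult_indicator)
  also have "\<dots> \<le> (\<integral>\<^sup>+z. (\<integral>\<^sup>+t. ennreal (indicator {0..1::real} t * (norm (g (e t * z)))\<^sup>2) \<partial>lborel) * indicator A z \<partial>lborel)"
  proof (intro nn_integral_mono, clarsimp split: split_indicator)
    fix z assume "z \<in> A"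
    then have z: "norm z < r" using A by auto
    then have "g (e t * z) = f (a + e t * z)" for t by (simp add: g_def norm_mult ne)
    then show "ennreal ((norm (f a))\<^sup>2) \<le> (\<integral>\<^sup>+t. ennreal (indicator {0..1::real} t * (norm (g (e t * z)))\<^sup>2) \<partial>lborel)"
      using circle_sub_mean_value[OF f z] by (simp add: e_def)
  qed
  also have "\<dots> = (\<integral>\<^sup>+z. (\<integral>\<^sup>+t. ennreal (indicator {0..1::real} t * (norm (g (e t * z)))\<^sup>2) * indicator A z \<partial>lborel) \<partial>lborel)"
    by (subst nn_integral_multc) auto
  also have "\<dots> = (\<integral>\<^sup>+t. (\<integral>\<^sup>+z. ennreal (indicator {0..1::real} t * (norm (g (e t * z)))\<^sup>2) * indicator A z \<partial>lborel) \<partial>lborel)"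
    by (rule lborel_pair.Fubini'[symmetric]) simp
  also have "\<dots> = (\<integral>\<^sup>+t. indicator {0..1::real} t * (\<integral>\<^sup>+z. ennreal ((norm (g (e t * z)))\<^sup>2) * indicator A (e t * z) \<partial>lborel) \<partial>lborel)"
    by (intro nn_integral_cong, subst nn_integral_cmult[symmetric])
       (auto simp: rot[OF ne] indicator_def intro!: nn_integral_cong)
  also have "\<dots> = (\<integral>\<^sup>+t. indicator {0..1::real} t * (\<integral>\<^sup>+z. ennreal ((norm (g z))\<^sup>2) * indicator A z \<partial>lborel) \<partial>lborel)"
    by (intro nn_integral_cong arg_cong2[of _ _ _ _ "(*)"] refl nn_integral_complex_rotate[OF ne, of "\<lambda>z. ennreal ((norm (g z))\<^sup>2) * indicator A z" for t]) simp
  also have "\<dots> = (\<integral>\<^sup>+z. ennreal ((norm (g z))\<^sup>2) * indicator A z \<partial>lborel)"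
    by (simp add: nn_integral_multc)
  also have "\<dots> = (\<integral>\<^sup>+z. ennreal ((norm (f (a + z)))\<^sup>2) * indicator A z \<partial>lborel)"
    using A(2) by (intro nn_integral_cong) (auto simp: g_def indicator_def split: if_splits)
  finally show ?thesis .
qed

text \<open>The ball of radius \<open>d = norm (z - s)\<close> about \<open>z\<close> avoids
  \<open>s\<close> and lies in \<open>ball s (2 * d)\<close>. The area mean value inequality bounds
  d^2 |f z|^2, up to a constant, by the integral of \<open>h\<close> over the latter ball, which
  tends to 0 with \<open>d\<close>. A majorant \<open>h\<close> stands in for |f|^2 because only a
  bound almost everywhere will be at hand.\<close>

lemma singularity_L2:
  assumes h [measurable]: "h \<in> borel_measurable borel"
    and fin: "(\<integral>\<^sup>+z. h z * indicator (ball s (2 * \<rho>)) z \<partial>lborel) < \<infinity>" and \<rho>: "\<rho> > 0"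
    and f: "f holomorphic_on ball s (2 * \<rho>) - {s}"
    and le: "AE z in lborel. z \<in> ball s (2 * \<rho>) \<longrightarrow> ennreal ((norm (f z))\<^sup>2) \<le> h z"
  shows "((\<lambda>z. (z - s) * f z) \<longlongrightarrow> 0) (at s)"
proof -
  \<comment> \<open>As a measure with density \<open>h\<close>, finite on
    \<open>ball s (2 * \<rho>)\<close> and null at the point \<open>s\<close>, it is continuous
    along the shrinking balls.\<close>
  define M where "M = density lborel h"
  have em: "emeasure M A = (\<integral>\<^sup>+z. h z * indicator A z \<partial>lborel)" if "A \<in> sets borel" for A
    unfolding M_def using that by (subst emeasure_density) auto
  define b where "b = measure lborel (ball (0::complex) 1)"
  have b: "b > 0" unfolding b_def by (rule content_ball_pos) simp
  have ball: "emeasure lborel (ball (x::complex) d) = ennreal (d\<^sup>2 * b)" if "d > 0" for x d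
    using that emeasure_eq_ennreal_measure[of lborel "ball x d"] emeasure_lborel_ball_finite[of x d]
    by (auto simp: content_ball_conv_unit_ball[of d x] b_def)
  have "(\<lambda>k. emeasure M (ball s (2 * \<rho> / Suc k))) \<longlonglongrightarrow> emeasure M (\<Inter>k. ball s (2 * \<rho> / Suc k))"
  proof (rule Lim_emeasure_decseq)
    show "range (\<lambda>k. ball s (2 * \<rho> / Suc k)) \<subseteq> sets M" by (auto simp: M_def)
    show "decseq (\<lambda>k. ball s (2 * \<rho> / Suc k))"
      using \<rho> by (intro decseq_SucI) (auto intro!: subset_ball simp: field_simps)
    fix k
    have "ball s (2 * \<rho> / Suc k) \<subseteq> ball s (2 * \<rho>)"
      using \<rho> by (intro subset_ball) (simp add: field_simps)
    then have "emeasure M (ball s (2 * \<rho> / Suc k)) \<le> emeasure M (ball s (2 * \<rho>))"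
      by (intro emeasure_mono) (auto simp: M_def)
    then show "emeasure M (ball s (2 * \<rho> / Suc k)) \<noteq> \<infinity>"
      using fin by (auto simp: em top.extremum_unique)
  qed
  moreover have "(\<Inter>k. ball s (2 * \<rho> / Suc k)) \<subseteq> {s}"
  proof (rule subsetI, rule ccontr)
    fix x assume x: "x \<in> (\<Inter>k. ball s (2 * \<rho> / Suc k))" "x \<notin> {s}"
    then have "dist s x > 0" by (auto simp: dist_commute)
    then obtain k where "2 * \<rho> / dist s x < real (Suc k)"
      by (metis less_SucI of_nat_less_iff reals_Archimedean2 less_trans lessI)
    then have "2 * \<rho> / Suc k < dist s x" using \<open>dist s x > 0\<close> by (simp add: field_simps)
    moreover have "x \<in> ball s (2 * \<rho> / Suc k)" using x(1) by (rule INT_D) simp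
    ultimately show False by simp
  qed
  then have "emeasure M (\<Inter>k. ball s (2 * \<rho> / Suc k)) \<le> emeasure M {s}"
    by (intro emeasure_mono) (auto simp: M_def)
  moreover have "emeasure M {s} = 0"
  proof -
    have "AE z in lborel. h z * indicator {s} z = 0"
      by (rule AE_mp[OF AE_lborel_singleton[of s]]) (auto simp: indicator_def)
    then show ?thesis by (subst em) (auto simp: nn_integral_0_iff_AE)
  qed
  ultimately have lim: "(\<lambda>k. emeasure M (ball s (2 * \<rho> / Suc k))) \<longlonglongrightarrow> 0" by simp
  have key: "ennreal ((norm ((z - s) * f z))\<^sup>2 * b) \<le> emeasure M (ball s (2 * norm (z - s)))"
    if z: "z \<noteq> s" "norm (z - s) < \<rho>" for z
  proof -
    define d where "d = norm (z - s)"
    have d: "d > 0" "d < \<rho>" using z by (auto simp: d_def)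
    have [measurable]: "ball s (2 * d) \<in> sets borel" by simp
    have zs: "dist s z = d" "dist z s = d" by (simp_all add: d_def dist_norm norm_minus_commute)
    have sub: "ball z d \<subseteq> ball s (2 * d)"
    proof
      fix x assume "x \<in> ball z d" then show "x \<in> ball s (2 * d)"
        using zs dist_triangle[of s x z] by simp
    qed
    have sub2: "ball s (2 * d) \<subseteq> ball s (2 * \<rho>)" using d by (intro subset_ball) simp
    have "s \<notin> ball z d" using zs by simp
    then have fz: "f holomorphic_on ball z d"
      using sub sub2 by (intro holomorphic_on_subset[OF f]) auto
    have "ennreal ((norm (f z))\<^sup>2) * emeasure lborel (ball (0::complex) d)
       \<le> (\<integral>\<^sup>+y. ennreal ((norm (f (z + y)))\<^sup>2) * indicator (ball 0 d) y \<partial>lborel)"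
      by (rule area_sub_mean_value[OF fz]) (auto simp: norm_mult)
    also have "\<dots> \<le> (\<integral>\<^sup>+y. h (z + y) * indicator (ball s (2 * d)) (z + y) \<partial>lborel)"
    proof (rule nn_integral_mono_AE)
      have le': "AE y in lborel. z + y \<in> ball s (2 * \<rho>) \<longrightarrow> ennreal ((norm (f (z + y)))\<^sup>2) \<le> h (z + y)"
        by (rule AE_distrD[of "(+) z" lborel borel]) (simp, subst lborel_distr_plus, rule le)
      show "AE y in lborel. ennreal ((norm (f (z + y)))\<^sup>2) * indicator (ball 0 d) y
          \<le> h (z + y) * indicator (ball s (2 * d)) (z + y)"
        using le'
      proof eventually_elim
        fix y assume y: "z + y \<in> ball s (2 * \<rho>) \<longrightarrow> ennreal ((norm (f (z + y)))\<^sup>2) \<le> h (z + y)"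
        show "ennreal ((norm (f (z + y)))\<^sup>2) * indicator (ball 0 d) y
          \<le> h (z + y) * indicator (ball s (2 * d)) (z + y)"
        proof (cases "y \<in> ball 0 d")
          case True
          then have "z + y \<in> ball z d" by (simp add: dist_norm)
          then show ?thesis using sub sub2 y by (auto simp: indicator_def)
        qed simp
      qed
    qed
    also have "\<dots> = (\<integral>\<^sup>+y. h y * indicator (ball s (2 * d)) y \<partial>lborel)"
      by (rule nn_integral_lborel_add) measurable
    also have "\<dots> = emeasure M (ball s (2 * d))" by (simp add: em)
    also have "ennreal ((norm (f z))\<^sup>2) * emeasure lborel (ball (0::complex) d)
        = ennreal ((norm ((z - s) * f z))\<^sup>2 * b)"
      using b d by (simp add: ball ennreal_mult[symmetric] d_def norm_mult power_mult_distrib mult_ac)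
    finally show ?thesis by (simp add: d_def)
  qed
  show ?thesis
    unfolding tendsto_iff eventually_at
  proof (intro allI impI)
    fix e :: real assume e: "e > 0"
    have "ennreal (e\<^sup>2 * b) > 0" using e b by simp
    from order_tendstoD(2)[OF lim this] obtain k where
      k: "emeasure M (ball s (2 * \<rho> / Suc k)) < ennreal (e\<^sup>2 * b)"
      by (auto simp: eventually_sequentially)
    show "\<exists>d>0. \<forall>x\<in>UNIV. x \<noteq> s \<and> dist x s < d \<longrightarrow> dist ((x - s) * f x) 0 < e"
    proof (intro exI conjI ballI impI)
      show "\<rho> / Suc k > 0" using \<rho> by simp
      fix x assume x: "x \<noteq> s \<and> dist x s < \<rho> / Suc k"
      have "\<rho> / Suc k \<le> \<rho>" using \<rho> by (simp add: field_simps)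
      then have "norm (x - s) < \<rho>" using x by (simp add: dist_norm)
      with x have "ennreal ((norm ((x - s) * f x))\<^sup>2 * b) \<le> emeasure M (ball s (2 * norm (x - s)))"
        by (intro key) auto
      also have "\<dots> \<le> emeasure M (ball s (2 * \<rho> / Suc k))"
        using x by (intro emeasure_mono subset_ball) (auto simp: M_def dist_norm field_simps)
      also note k
      finally have "(norm ((x - s) * f x))\<^sup>2 * b < e\<^sup>2 * b"
        using b e by (simp add: ennreal_less_iff)
      then show "dist ((x - s) * f x) 0 < e"
        using b e by (simp add: power_less_imp_less_base[of _ 2 e])
    qed
  qed
qed

text \<open>Riemann's theorem on removable singularities, one point at a time.\<close>

lemma holomorphic_extend_finite:
  assumes "finite S" "open U" "f holomorphic_on U - S"
    "\<And>s. s \<in> S \<Longrightarrow> ((\<lambda>z. (z - s) * f z) \<longlongrightarrow> 0) (at s)"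
  obtains g where "g holomorphic_on U" "\<And>z. z \<in> U - S \<Longrightarrow> g z = f z"
proof -
  have "\<exists>g. g holomorphic_on U \<and> (\<forall>z\<in>U - S. g z = f z)"
    using assms
  proof (induction S arbitrary: U rule: finite_induct)
    case empty
    then show ?case by auto
  next
    case (insert s S)
    have op: "open (U - {s})" using insert.prems by auto
    have "U - {s} - S = U - insert s S" by auto
    then obtain g where g: "g holomorphic_on U - {s}" "\<forall>z\<in>U - insert s S. g z = f z"
      using insert.IH[OF op] insert.prems by auto
    show ?case
    proof (cases "s \<in> U")
      case False
      then show ?thesis using g by (metis Diff_insert0 Diff_empty)
    next
      case True
      have "eventually (\<lambda>z. z \<in> U - S) (at s)"
        by (rule eventually_at_in_open') (use insert True in \<open>auto intro!: open_Diff finite_imp_closed\<close>)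
      then have "eventually (\<lambda>z. (z - s) * f z = (z - s) * g z) (at s)"
        using eventually_neq_at_within[of s] by eventually_elim (use g in auto)
      then have "((\<lambda>z. (z - s) * g z) \<longlongrightarrow> 0) (at s)"
        using insert.prems(3)[of s] by (auto intro: Lim_transform_eventually)
      moreover have "s \<in> interior U" using True insert.prems by (simp add: interior_open)
      ultimately obtain k where "k holomorphic_on U" "\<forall>z\<in>U - {s}. k z = g z"
        using holomorphic_on_extend_lim[OF g(1)] by blast
      then show ?thesis using g by (intro exI[of _ k]) auto
    qed
  qed
  then show ?thesis using that by blast
qed

text \<open>Integrability is asked only on annuli about 0, because the majorant used later is
  controlled only by a negative power of \<open>norm z\<close>. This is why 0 itself must not be a
  singularity.\<close>

lemma L2_mean_value_with_singularities:
  assumes "finite S" "0 \<notin> S" and f: "f holomorphic_on - S"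
    and h [measurable]: "h \<in> borel_measurable borel"
    and le: "AE z in lborel. ennreal ((norm (f z))\<^sup>2) \<le> h z"
    and fin: "\<And>r::nat. (\<integral>\<^sup>+z. h z * indicator {z. 1 / Suc r \<le> norm z \<and> norm z \<le> Suc r} z \<partial>lborel) < \<infinity>"
  shows "ennreal ((norm (f 0))\<^sup>2) * emeasure lborel {z::complex. R \<le> norm z \<and> norm z \<le> 2 * R}
    \<le> (\<integral>\<^sup>+z. h z * indicator {z. R \<le> norm z \<and> norm z \<le> 2 * R} z \<partial>lborel)"
proof -
  have "((\<lambda>z. (z - s) * f z) \<longlongrightarrow> 0) (at s)" if s: "s \<in> S" for s
  proof -
    have "s \<noteq> 0" using s assms by auto
    have "open (- (insert 0 (S - {s})))" using assms(1) by (intro open_Compl finite_imp_closed) auto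
    moreover have "s \<in> - (insert 0 (S - {s}))" using \<open>s \<noteq> 0\<close> by auto
    ultimately obtain e where e: "e > 0" "ball s e \<subseteq> - (insert 0 (S - {s}))"
      by (meson open_contains_ball)
    \<comment> \<open>Small enough that \<open>ball s (2 * \<rho>)\<close> meets no other
      singularity and stays in an annulus away from 0.\<close>
    define \<rho> where "\<rho> = min e (norm s) / 4"
    have \<rho>: "\<rho> > 0" using e \<open>s \<noteq> 0\<close> by (simp add: \<rho>_def)
    have \<rho>2: "2 * \<rho> \<le> e" "2 * \<rho> \<le> norm s / 2" using e by (auto simp: \<rho>_def)
    obtain r :: nat where r: "max (2 / norm s) (2 * norm s) < r" using reals_Archimedean2 by blast
    have sub: "ball s (2 * \<rho>) \<subseteq> {z. 1 / Suc r \<le> norm z \<and> norm z \<le> Suc r}"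
    proof
      fix z assume "z \<in> ball s (2 * \<rho>)"
      then have "norm (s - z) < norm s / 2" using \<rho>2 by (simp add: dist_norm)
      moreover have "norm s \<le> norm (s - z) + norm z" "norm z \<le> norm (s - z) + norm s"
        by norm+
      ultimately have nz: "norm s / 2 \<le> norm z" "norm z \<le> 2 * norm s" by auto
      have "2 / norm s < real (Suc r)" using r by simp
      then have "1 / real (Suc r) \<le> norm s / 2" using \<open>s \<noteq> 0\<close> by (simp add: field_simps)
      then show "z \<in> {z. 1 / Suc r \<le> norm z \<and> norm z \<le> Suc r}" using nz r by auto
    qed
    show ?thesis
    proof (rule singularity_L2[OF h _ \<rho>])
      have "(\<integral>\<^sup>+z. h z * indicator (ball s (2 * \<rho>)) z \<partial>lborel)
          \<le> (\<integral>\<^sup>+z. h z * indicator {z. 1 / Suc r \<le> norm z \<and> norm z \<le> Suc r} z \<partial>lborel)"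
        using sub by (intro nn_integral_mono) (auto simp: indicator_def)
      also note fin[of r]
      finally show "(\<integral>\<^sup>+z. h z * indicator (ball s (2 * \<rho>)) z \<partial>lborel) < \<infinity>" .
      have "ball s (2 * \<rho>) \<subseteq> ball s e" using \<rho>2 by (intro subset_ball)
      then show "f holomorphic_on ball s (2 * \<rho>) - {s}"
        using e by (intro holomorphic_on_subset[OF f]) auto
      show "AE z in lborel. z \<in> ball s (2 * \<rho>) \<longrightarrow> ennreal ((norm (f z))\<^sup>2) \<le> h z"
        using le by eventually_elim auto
    qed
  qed
  moreover have "f holomorphic_on UNIV - S" using f by (simp add: Compl_eq_Diff_UNIV)
  ultimately obtain g where g: "g holomorphic_on UNIV" "\<And>z. z \<in> UNIV - S \<Longrightarrow> g z = f z"
    using holomorphic_extend_finite[OF assms(1) open_UNIV] by blast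
  let ?A = "{z::complex. R \<le> norm z \<and> norm z \<le> 2 * R}"
  have A [measurable]: "?A \<in> sets borel" by measurable
  have "ennreal ((norm (f 0))\<^sup>2) * emeasure lborel ?A = ennreal ((norm (g 0))\<^sup>2) * emeasure lborel ?A"
    using g(2)[of 0] assms by simp
  also have "\<dots> \<le> (\<integral>\<^sup>+z. ennreal ((norm (g (0 + z)))\<^sup>2) * indicator ?A z \<partial>lborel)"
  proof (rule area_sub_mean_value)
    show "g holomorphic_on ball 0 (2 * \<bar>R\<bar> + 1)" using g holomorphic_on_subset by blast
    show "?A \<subseteq> ball 0 (2 * \<bar>R\<bar> + 1)" by auto
  qed (auto simp: norm_mult)
  also have "\<dots> \<le> (\<integral>\<^sup>+z. h z * indicator ?A z \<partial>lborel)"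
  proof (rule nn_integral_mono_AE)
    have "AE z in lborel. z \<notin> S"
      using assms(1) by (intro AE_not_in finite_imp_null_set_lborel)
    with le show "AE z in lborel. ennreal ((norm (g (0 + z)))\<^sup>2) * indicator ?A z \<le> h z * indicator ?A z"
      by eventually_elim (auto simp: g(2) indicator_def)
  qed
  finally show ?thesis .
qed

section \<open>Algebraic dependence\<close>

text \<open>Polynomial functions in the generators \<open>C\<close>, as functions rather than formal
  polynomials: induction transports continuity, measurability and degree bounds, whatever indexes
  the variables.\<close>

inductive_set gen_algebra :: "('a \<Rightarrow> complex) set \<Rightarrow> ('a \<Rightarrow> complex) set"
  for C where
  const: "(\<lambda>_. c) \<in> gen_algebra C"
| gen: "f \<in> C \<Longrightarrow> f \<in> gen_algebra C"
| add: "f \<in> gen_algebra C \<Longrightarrow> g \<in> gen_algebra C \<Longrightarrow> (\<lambda>x. f x + g x) \<in> gen_algebra C"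
| mult: "f \<in> gen_algebra C \<Longrightarrow> g \<in> gen_algebra C \<Longrightarrow> (\<lambda>x. f x * g x) \<in> gen_algebra C"

lemma gen_algebra_diff:
  "f \<in> gen_algebra C \<Longrightarrow> g \<in> gen_algebra C \<Longrightarrow> (\<lambda>x. f x - g x) \<in> gen_algebra C"
  using gen_algebra.add[OF _ gen_algebra.mult[OF gen_algebra.const[of "-1"]], of f C g] by simp

lemma gen_algebra_sum:
  "(\<And>i. i \<in> I \<Longrightarrow> f i \<in> gen_algebra C) \<Longrightarrow> (\<lambda>x. \<Sum>i\<in>I. f i x) \<in> gen_algebra C"
  by (induction I rule: infinite_finite_induct) (auto intro: gen_algebra.intros)

lemma gen_algebra_prod:
  "(\<And>i. i \<in> I \<Longrightarrow> f i \<in> gen_algebra C) \<Longrightarrow> (\<lambda>x. \<Prod>i\<in>I. f i x) \<in> gen_algebra C"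
  by (induction I rule: infinite_finite_induct) (auto intro: gen_algebra.intros)

lemma gen_algebra_power: "f \<in> gen_algebra C \<Longrightarrow> (\<lambda>x. f x ^ n) \<in> gen_algebra C"
  by (induction n) (auto intro: gen_algebra.intros)

lemmas gen_algebra_intros = gen_algebra.const gen_algebra.add gen_algebra.mult gen_algebra_diff
  gen_algebra_sum gen_algebra_prod gen_algebra_power

lemma gen_algebra_compose:
  assumes "f \<in> gen_algebra C" "\<And>g. g \<in> C \<Longrightarrow> (\<lambda>x. g (p x)) \<in> gen_algebra C'"
  shows "(\<lambda>x. f (p x)) \<in> gen_algebra C'"
  using assms(1) by induction (auto intro: gen_algebra.intros assms(2))

lemma gen_algebra_isCont:
  assumes "f \<in> gen_algebra C" "\<And>g. g \<in> C \<Longrightarrow> isCont (\<lambda>x. g (p x)) a"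
  shows "isCont (\<lambda>x. f (p x)) a"
  using assms(1) by induction (auto intro!: continuous_intros assms(2))

lemma gen_algebra_affine: "(\<lambda>s. a + s * b) \<in> gen_algebra {\<lambda>s. s}"
  by (rule gen_algebra.add[OF gen_algebra.const gen_algebra.mult[OF gen_algebra.gen gen_algebra.const]]) simp

lemma gen_algebra_poly:
  assumes "f \<in> gen_algebra {\<lambda>s. s}"
  obtains p where "f = poly p"
proof -
  have "\<exists>p. f = poly p"
    using assms
  proof induction
    case (const c)
    then show ?case by (intro exI[of _ "[:c:]"]) auto
  next
    case (gen f)
    then show ?case by (intro exI[of _ "[:0, 1:]"]) auto
  next
    case (add f g)
    then obtain p q where "f = poly p" "g = poly q" by blast
    then show ?case by (intro exI[of _ "p + q"]) auto
  next
    case (mult f g)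
    then obtain p q where "f = poly p" "g = poly q" by blast
    then show ?case by (intro exI[of _ "p * q"]) auto
  qed
  then show ?thesis using that by blast
qed

definition coords :: "'v set \<Rightarrow> (('v \<Rightarrow> complex) \<Rightarrow> complex) set" where
  "coords X = (\<lambda>v x. x v) ` X"

definition monom_fun :: "'v set \<Rightarrow> ('v \<Rightarrow> nat) \<Rightarrow> ('v \<Rightarrow> complex) \<Rightarrow> complex" where
  "monom_fun X \<alpha> x = (\<Prod>v\<in>X. x v ^ \<alpha> v)"

lemma monom_fun_in_algebra: "monom_fun X \<alpha> \<in> gen_algebra (coords X)"
proof -
  have "(\<lambda>x. \<Prod>v\<in>X. x v ^ \<alpha> v) \<in> gen_algebra (coords X)"
    by (intro gen_algebra_prod gen_algebra_power gen_algebra.gen) (auto simp: coords_def)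
  then show ?thesis by (simp add: monom_fun_def[abs_def])
qed

text \<open>Extensional functions, so that distinct exponents give distinct monomials in the
  variables \<open>X\<close>.\<close>

abbreviation exponents :: "'v set \<Rightarrow> nat \<Rightarrow> ('v \<Rightarrow> nat) set" where
  "exponents X d \<equiv> PiE X (\<lambda>_. {..d})"

text \<open>The degree is bounded in each variable separately: the exponents then form a box with
  exactly \<open>(d + 1) ^ card X\<close> elements.\<close>

definition degree_le :: "'v set \<Rightarrow> nat \<Rightarrow> (('v \<Rightarrow> complex) \<Rightarrow> complex) \<Rightarrow> bool" where
  "degree_le X d f \<longleftrightarrow> (\<exists>a. \<forall>x. f x = (\<Sum>\<alpha>\<in>exponents X d. a \<alpha> * monom_fun X \<alpha> x))"

lemma degree_le_mono:
  assumes "finite X" "degree_le X d f" "d \<le> e"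
  shows "degree_le X e f"
proof -
  obtain a where a: "\<And>x. f x = (\<Sum>\<alpha>\<in>exponents X d. a \<alpha> * monom_fun X \<alpha> x)"
    using assms(2) unfolding degree_le_def by blast
  have sub: "exponents X d \<subseteq> exponents X e" using assms(3) by (intro PiE_mono) auto
  have "f x = (\<Sum>\<alpha>\<in>exponents X e. (if \<alpha> \<in> exponents X d then a \<alpha> else 0) * monom_fun X \<alpha> x)" for x
    unfolding a using assms(1) sub by (intro sum.mono_neutral_cong_left) (auto intro!: finite_PiE)
  then show ?thesis
    unfolding degree_le_def by (intro exI[of _ "\<lambda>\<alpha>. if \<alpha> \<in> exponents X d then a \<alpha> else 0"]) blast
qed

lemma degree_le_add:
  assumes "degree_le X d f" "degree_le X d g"
  shows "degree_le X d (\<lambda>x. f x + g x)"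
proof -
  obtain a b where "\<And>x. f x = (\<Sum>\<alpha>\<in>exponents X d. a \<alpha> * monom_fun X \<alpha> x)"
     "\<And>x. g x = (\<Sum>\<alpha>\<in>exponents X d. b \<alpha> * monom_fun X \<alpha> x)"
    using assms unfolding degree_le_def by blast
  then show ?thesis
    unfolding degree_le_def
    by (intro exI[of _ "\<lambda>\<alpha>. a \<alpha> + b \<alpha>"]) (simp add: sum.distrib algebra_simps)
qed

lemma degree_le_mult:
  assumes fin: "finite X" and "degree_le X d f" "degree_le X e g"
  shows "degree_le X (d + e) (\<lambda>x. f x * g x)"
proof -
  obtain a b where a: "\<And>x. f x = (\<Sum>\<alpha>\<in>exponents X d. a \<alpha> * monom_fun X \<alpha> x)"
     and b: "\<And>x. g x = (\<Sum>\<alpha>\<in>exponents X e. b \<alpha> * monom_fun X \<alpha> x)"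
    using assms unfolding degree_le_def by blast
  define S where "S = exponents X d \<times> exponents X e"
  define s where "s p = restrict (\<lambda>v. fst p v + snd p v) X" for p :: "('a \<Rightarrow> nat) \<times> ('a \<Rightarrow> nat)"
  have finS: "finite S" unfolding S_def using fin by (auto intro!: finite_PiE)
  have sS: "s ` S \<subseteq> exponents X (d + e)"
    by (auto simp: S_def s_def PiE_iff intro!: add_mono)
  have ms: "monom_fun X (s p) x = monom_fun X (fst p) x * monom_fun X (snd p) x" for p x
    by (simp add: monom_fun_def s_def power_add prod.distrib)
  have "f x * g x = (\<Sum>\<gamma>\<in>exponents X (d + e). (\<Sum>p\<in>{p \<in> S. s p = \<gamma>}. a (fst p) * b (snd p)) * monom_fun X \<gamma> x)" for x
  proof -
    have "f x * g x = (\<Sum>p\<in>S. a (fst p) * b (snd p) * monom_fun X (s p) x)"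
      unfolding a b S_def sum_product ms
      by (subst sum.cartesian_product) (auto intro!: sum.cong simp: algebra_simps)
    also have "\<dots> = (\<Sum>\<gamma>\<in>exponents X (d + e). \<Sum>p\<in>{p \<in> S. s p = \<gamma>}. a (fst p) * b (snd p) * monom_fun X (s p) x)"
      by (rule sum.group[symmetric, OF finS _ sS]) (use fin in \<open>auto intro!: finite_PiE\<close>)
    also have "\<dots> = (\<Sum>\<gamma>\<in>exponents X (d + e). (\<Sum>p\<in>{p \<in> S. s p = \<gamma>}. a (fst p) * b (snd p)) * monom_fun X \<gamma> x)"
      by (intro sum.cong refl) (auto simp: sum_distrib_right)
    finally show ?thesis .
  qed
  then show ?thesis unfolding degree_le_def
    by (intro exI[of _ "\<lambda>\<gamma>. \<Sum>p\<in>{p \<in> S. s p = \<gamma>}. a (fst p) * b (snd p)"]) blast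
qed

lemma degree_le_const: "finite X \<Longrightarrow> degree_le X 0 (\<lambda>_. c)"
proof -
  assume "finite X"
  have e: "exponents X 0 = {restrict (\<lambda>_. 0) X}"
    by (auto simp: PiE_iff extensional_def fun_eq_iff restrict_def)
  have "c = (\<Sum>\<alpha>\<in>exponents X 0. c * monom_fun X \<alpha> x)" for x
    unfolding e by (simp add: monom_fun_def)
  then show ?thesis unfolding degree_le_def by (intro exI[of _ "\<lambda>_. c"]) blast
qed

lemma degree_le_power:
  assumes "finite X" "degree_le X d f"
  shows "degree_le X (n * d) (\<lambda>x. f x ^ n)"
proof (induction n)
  case 0
  then show ?case using degree_le_const[OF assms(1)] by simp
next
  case (Suc n)
  then show ?case using degree_le_mult[OF assms(1) assms(2) Suc] by simp
qed

lemma degree_le_prod: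
  assumes "finite X" "finite I" "\<And>i. i \<in> I \<Longrightarrow> degree_le X d (f i)"
  shows "degree_le X (card I * d) (\<lambda>x. \<Prod>i\<in>I. f i x)"
  using assms(2,3)
proof (induction I rule: finite_induct)
  case empty
  then show ?case using degree_le_const[OF assms(1)] by simp
next
  case (insert i I)
  then show ?case using degree_le_mult[OF assms(1), of d "f i" "card I * d" "\<lambda>x. \<Prod>i\<in>I. f i x"] by simp
qed

lemma gen_algebra_degree_le:
  assumes fin: "finite X" and "f \<in> gen_algebra (coords X)"
  obtains d where "degree_le X d f"
proof -
  have "\<exists>d. degree_le X d f"
    using assms(2)
  proof induction
    case (const c)
    then show ?case using degree_le_const[OF fin] by blast
  next
    case (gen f)
    then obtain v where v: "v \<in> X" "f = (\<lambda>x. x v)" by (auto simp: coords_def)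
    define \<alpha> where "\<alpha> = restrict (\<lambda>w. if w = v then 1 else 0::nat) X"
    have m: "monom_fun X \<alpha> x = x v" for x
    proof -
      have "monom_fun X \<alpha> x = (\<Prod>w\<in>X. if w = v then x w else 1)"
        unfolding monom_fun_def by (rule prod.cong) (auto simp: \<alpha>_def)
      then show ?thesis using fin v by simp
    qed
    have "\<alpha> \<in> exponents X 1" by (auto simp: \<alpha>_def)
    then have "f x = (\<Sum>\<beta>\<in>exponents X 1. (if \<beta> = \<alpha> then 1 else 0) * monom_fun X \<beta> x)" for x
      using fin v m by (simp add: if_distrib[of "\<lambda>t. t * y" for y] sum.delta finite_PiE cong: if_cong)
    then show ?case unfolding degree_le_def
      by (intro exI[of _ 1] exI[of _ "\<lambda>\<beta>. if \<beta> = \<alpha> then 1 else 0"]) blast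
  next
    case (add f g)
    then obtain d e where "degree_le X d f" "degree_le X e g" by blast
    then have "degree_le X (max d e) f" "degree_le X (max d e) g"
      using degree_le_mono[OF fin] by auto
    then show ?case using degree_le_add by blast
  next
    case (mult f g)
    then show ?case using degree_le_mult[OF fin] by blast
  qed
  then show ?thesis using that by blast
qed

lemma sum_exponents_insert:
  assumes "finite X" "v \<notin> X"
  shows "(\<Sum>\<alpha>\<in>exponents (insert v X) d. h \<alpha>) = (\<Sum>k\<le>d. \<Sum>\<alpha>\<in>exponents X d. h (\<alpha>(v := k)))"
proof -
  have "(\<Sum>\<alpha>\<in>exponents (insert v X) d. h \<alpha>) = (\<Sum>p\<in>{..d} \<times> exponents X d. h ((snd p)(v := fst p)))"
    unfolding PiE_insert_eq
    by (subst sum.reindex) (use inj_combinator[OF assms(2), of "\<lambda>_. {..d}"] in \<open>auto simp: case_prod_unfold o_def\<close>)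
  also have "\<dots> = (\<Sum>k\<le>d. \<Sum>\<alpha>\<in>exponents X d. h (\<alpha>(v := k)))"
    by (subst sum.cartesian_product) (simp add: case_prod_unfold)
  finally show ?thesis .
qed

text \<open>As a polynomial in the new variable \<open>v\<close> the sum vanishes identically, hence
  so does each of its coefficients, which is a sum of the same kind over \<open>X\<close>.\<close>

lemma monom_fun_independent:
  assumes "finite X" "\<And>x. (\<Sum>\<alpha>\<in>exponents X d. a \<alpha> * monom_fun X \<alpha> x) = 0" "\<alpha> \<in> exponents X d"
  shows "a \<alpha> = 0"
  using assms
proof (induction X arbitrary: a \<alpha> rule: finite_induct)
  case empty
  then show ?case by (simp add: monom_fun_def)
next
  case (insert v X)
  have m: "monom_fun (insert v X) (\<alpha>(v := k)) (x(v := t)) = t ^ k * monom_fun X \<alpha> x" for \<alpha> k x t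
  proof -
    have "(\<Prod>w\<in>X. (x(v := t)) w ^ (\<alpha>(v := k)) w) = (\<Prod>w\<in>X. x w ^ \<alpha> w)"
      using insert.hyps by (intro prod.cong) auto
    then show ?thesis using insert.hyps by (simp add: monom_fun_def)
  qed
  have "(\<Sum>\<alpha>\<in>exponents X d. a (\<alpha>(v := k)) * monom_fun X \<alpha> x) = 0" if k: "k \<le> d" for k x
  proof -
    have "(\<Sum>k\<le>d. (\<Sum>\<alpha>\<in>exponents X d. a (\<alpha>(v := k)) * monom_fun X \<alpha> x) * t ^ k) = 0" for t
      using insert.prems(1)[of "x(v := t)"]
      unfolding sum_exponents_insert[OF insert.hyps, of "\<lambda>\<alpha>. a \<alpha> * monom_fun (insert v X) \<alpha> (x(v := t))" d] m
      by (simp add: sum_distrib_left sum_distrib_right mult_ac)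
    then show ?thesis using polyfun_eq_0[of "\<lambda>k. \<Sum>\<alpha>\<in>exponents X d. a (\<alpha>(v := k)) * monom_fun X \<alpha> x" d] k
      by blast
  qed
  then have z: "a (\<beta>(v := k)) = 0" if "k \<le> d" "\<beta> \<in> exponents X d" for k \<beta>
    using insert.IH[of "\<lambda>\<alpha>. a (\<alpha>(v := k))" \<beta>] that by blast
  have "\<alpha> \<in> (\<lambda>(y, g). g(v := y)) ` ({..d} \<times> exponents X d)"
    using insert.prems(2) unfolding PiE_insert_eq .
  then show ?case using z by auto
qed

text \<open>One elimination step per equation: a nonzero coefficient \<open>a s0 u\<close> disposes
  of the unknown \<open>s0\<close> together with the equation \<open>u\<close>.\<close>

lemma underdetermined_system:
  fixes a :: "'s \<Rightarrow> 'u \<Rightarrow> 'f::field"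
  assumes "finite U" "finite S" "card U < card S"
  shows "\<exists>r. (\<exists>s\<in>S. r s \<noteq> 0) \<and> (\<forall>u\<in>U. (\<Sum>s\<in>S. r s * a s u) = 0)"
  using assms
proof (induction U arbitrary: S a rule: finite_induct)
  case empty
  then have "S \<noteq> {}" by auto
  then show ?case by (intro exI[of _ "\<lambda>_. 1"]) auto
next
  case (insert u U)
  show ?case
  proof (cases "\<forall>s\<in>S. a s u = 0")
    case True
    obtain r where "\<exists>s\<in>S. r s \<noteq> 0" "\<forall>u\<in>U. (\<Sum>s\<in>S. r s * a s u) = 0"
      using insert.IH[of S a] insert.prems insert.hyps by auto
    then show ?thesis using True by (intro exI[of _ r]) auto
  next
    case False
    then obtain s0 where s0: "s0 \<in> S" "a s0 u \<noteq> 0" by blast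
    define b where "b s v = a s v - a s u / a s0 u * a s0 v" for s v
    have "card U < card (S - {s0})" using insert s0 by simp
    then obtain r where r: "\<exists>s\<in>S - {s0}. r s \<noteq> 0" "\<forall>v\<in>U. (\<Sum>s\<in>S - {s0}. r s * b s v) = 0"
      using insert.IH[of "S - {s0}" b] insert.prems by auto
    define q where "q = - (\<Sum>s\<in>S - {s0}. r s * a s u) / a s0 u"
    define r' where "r' = r(s0 := q)"
    have e: "(\<Sum>s\<in>S. r' s * a s v) = q * a s0 v + (\<Sum>s\<in>S - {s0}. r s * a s v)" for v
    proof -
      have "(\<Sum>s\<in>S - {s0}. r' s * a s v) = (\<Sum>s\<in>S - {s0}. r s * a s v)"
        by (intro sum.cong) (auto simp: r'_def)
      then show ?thesis using insert.prems s0 by (simp add: sum.remove[of S s0] r'_def)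
    qed
    show ?thesis
    proof (intro exI[of _ r'] conjI ballI)
      show "\<exists>s\<in>S. r' s \<noteq> 0" using r(1) by (auto simp: r'_def)
      fix v assume "v \<in> insert u U"
      then consider "v = u" | "v \<in> U" by blast
      then show "(\<Sum>s\<in>S. r' s * a s v) = 0"
      proof cases
        case 1
        then show ?thesis using s0 by (simp add: e q_def)
      next
        case 2
        have "(\<Sum>s\<in>S - {s0}. r s * b s v) = (\<Sum>s\<in>S - {s0}. r s * a s v) - (\<Sum>s\<in>S - {s0}. r s * a s u) / a s0 u * a s0 v"
          by (simp add: b_def algebra_simps sum_subtractf sum_distrib_left sum_distrib_right sum_divide_distrib)
        then show ?thesis using r(2) 2 by (simp add: e q_def)
      qed
    qed
  qed
qed

text \<open>The extra factor \<open>Suc A\<close> on the right stems from the additional function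
  \<open>T\<close>; once \<open>A\<close> reaches the constant \<open>(C + 1) ^ p\<close>, that
  factor wins.\<close>

lemma power_count:
  fixes C A p q :: nat
  assumes "p \<le> q" "(C + 1) ^ p \<le> A"
  shows "Suc (C * A) ^ p < Suc A ^ q * Suc A"
proof -
  have "Suc (C * A) \<le> (C + 1) * Suc A" by simp
  then have "Suc (C * A) ^ p \<le> (C + 1) ^ p * Suc A ^ p"
    by (metis power_mono power_mult_distrib zero_le)
  also have "\<dots> \<le> A * Suc A ^ q"
    using assms by (intro mult_mono power_increasing) auto
  also have "\<dots> < Suc A ^ q * Suc A" by simp
  finally show ?thesis .
qed

text \<open>
  There are more monomials of degree at most \<open>A\<close> in the \<open>card Y + 1\<close> functions than there are
  monomials of degree \<open>O(A)\<close> in the \<open>card X\<close> variables.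
\<close>
lemma algebraic_dependence:
  assumes X: "finite X" and Y: "finite Y" and c: "card X \<le> card Y"
    and e: "e \<in> gen_algebra (coords X)" and N: "\<And>l. l \<in> Y \<Longrightarrow> N l \<in> gen_algebra (coords X)"
    and T: "T \<in> gen_algebra (coords X)"
  obtains A r where "\<exists>k\<le>A. \<exists>\<alpha>\<in>exponents Y A. r k \<alpha> \<noteq> 0"
    "\<And>x. (\<Sum>k\<le>A. \<Sum>\<alpha>\<in>exponents Y A. r k \<alpha> *
        ((\<Prod>l\<in>Y. N l x ^ \<alpha> l * e x ^ (A - \<alpha> l)) * (T x ^ k * e x ^ (A - k)))) = 0"
proof -
  obtain de where de: "degree_le X de e" using gen_algebra_degree_le[OF X e] .
  obtain dT where dT: "degree_le X dT T" using gen_algebra_degree_le[OF X T] .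
  have "\<forall>l\<in>Y. \<exists>d. degree_le X d (N l)" using gen_algebra_degree_le[OF X N] by metis
  then obtain dN where dN: "\<And>l. l \<in> Y \<Longrightarrow> degree_le X (dN l) (N l)" by metis
  define d where "d = de + dT + (\<Sum>l\<in>Y. dN l)"
  have d: "degree_le X d e" "degree_le X d T"
    using degree_le_mono[OF X de] degree_le_mono[OF X dT] by (auto simp: d_def)
  have dN': "degree_le X d (N l)" if "l \<in> Y" for l
    using member_le_sum[of l Y dN] Y that by (intro degree_le_mono[OF X dN[OF that]]) (auto simp: d_def)
  \<comment> \<open>Each of the \<open>card Y + 1\<close> factors of \<open>f s\<close> below has
    degree at most \<open>A * d\<close>, so \<open>C * A\<close> bounds the degree of the
    product.\<close>
  define C where "C = (card Y + 1) * d"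
  define A where "A = (C + 1) ^ card X"
  define S where "S = {..A} \<times> exponents Y A"
  define U where "U = exponents X (C * A)"
  \<comment> \<open>A monomial in the fractions \<open>N l / e\<close> and \<open>T / e\<close>,
    with denominators cleared by a power of \<open>e\<close> that is the same for all
    \<open>s\<close>.\<close>
  define f where "f s x = (\<Prod>l\<in>Y. N l x ^ snd s l * e x ^ (A - snd s l)) * (T x ^ fst s * e x ^ (A - fst s))"
    for s :: "nat \<times> ('b \<Rightarrow> nat)" and x
  have pw: "degree_le X (A * d) (\<lambda>x. g x ^ k * e x ^ (A - k))" if "k \<le> A" "degree_le X d g" for g k
  proof -
    have "k * d + (A - k) * d = A * d" using that(1) by (metis add_mult_distrib le_add_diff_inverse)
    then show ?thesis
      using degree_le_mult[OF X degree_le_power[OF X that(2), of k] degree_le_power[OF X d(1), of "A - k"]] by simp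
  qed
  have "degree_le X (C * A) (f s)" if "s \<in> S" for s
  proof -
    have s: "fst s \<le> A" "\<And>l. l \<in> Y \<Longrightarrow> snd s l \<le> A" using that by (auto simp: S_def PiE_iff)
    have "degree_le X (card Y * (A * d)) (\<lambda>x. \<Prod>l\<in>Y. N l x ^ snd s l * e x ^ (A - snd s l))"
      by (rule degree_le_prod[OF X Y]) (rule pw[OF s(2) dN'])
    from degree_le_mult[OF X this pw[OF s(1) d(2)]]
    show ?thesis by (simp add: f_def[abs_def] C_def algebra_simps)
  qed
  then have "\<forall>s\<in>S. \<exists>a. \<forall>x. f s x = (\<Sum>\<alpha>\<in>U. a \<alpha> * monom_fun X \<alpha> x)"
    by (auto simp: degree_le_def U_def)
  then obtain a where a: "\<And>s x. s \<in> S \<Longrightarrow> f s x = (\<Sum>\<alpha>\<in>U. a s \<alpha> * monom_fun X \<alpha> x)" by metis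
  have fin: "finite U" "finite S" using X Y by (auto simp: U_def S_def intro!: finite_PiE)
  have cU: "card U = Suc (C * A) ^ card X" using X by (simp add: U_def card_PiE)
  have cS: "card S = Suc A ^ card Y * Suc A" using Y by (simp add: S_def card_PiE card_cartesian_product)
  have "card U < card S"
    unfolding cU cS by (rule power_count[OF c]) (simp add: A_def)
  then obtain r where r: "\<exists>s\<in>S. r s \<noteq> 0" "\<forall>u\<in>U. (\<Sum>s\<in>S. r s * a s u) = 0"
    using underdetermined_system[OF fin, of a] by blast
  show ?thesis
  proof (rule that[of A "\<lambda>k \<alpha>. r (k, \<alpha>)"])
    show "\<exists>k\<le>A. \<exists>\<alpha>\<in>exponents Y A. r (k, \<alpha>) \<noteq> 0"
      using r(1) unfolding S_def by blast
    fix x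
    have "(\<Sum>k\<le>A. \<Sum>\<alpha>\<in>exponents Y A. r (k, \<alpha>) *
        ((\<Prod>l\<in>Y. N l x ^ \<alpha> l * e x ^ (A - \<alpha> l)) * (T x ^ k * e x ^ (A - k)))) = (\<Sum>s\<in>S. r s * f s x)"
      unfolding S_def by (subst sum.cartesian_product) (simp add: case_prod_unfold f_def)
    also have "\<dots> = (\<Sum>s\<in>S. \<Sum>u\<in>U. r s * (a s u * monom_fun X u x))"
      by (intro sum.cong) (auto simp: a sum_distrib_left)
    also have "\<dots> = (\<Sum>u\<in>U. (\<Sum>s\<in>S. r s * a s u) * monom_fun X u x)"
      by (subst sum.swap) (simp add: sum_distrib_right mult.assoc)
    also have "\<dots> = 0" using r(2) by simp
    finally show "(\<Sum>k\<le>A. \<Sum>\<alpha>\<in>exponents Y A. r (k, \<alpha>) *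
        ((\<Prod>l\<in>Y. N l x ^ \<alpha> l * e x ^ (A - \<alpha> l)) * (T x ^ k * e x ^ (A - k)))) = 0" .
  qed
qed

text \<open>
  The relation may be divided by a power of \<open>T / e\<close>: it persists where \<open>T\<close> vanishes because the
  complement of the zero set of \<open>T\<close> is dense.
\<close>
lemma algebraic_relation:
  assumes X: "finite X" and Y: "finite Y" and c: "card X \<le> card Y"
    and e: "e \<in> gen_algebra (coords X)" and N: "\<And>l. l \<in> Y \<Longrightarrow> N l \<in> gen_algebra (coords X)"
    and T: "T \<in> gen_algebra (coords X)" and x0: "T x0 \<noteq> 0"
  obtains K c where "\<And>k. c k \<in> gen_algebra (coords Y)" "\<exists>y. c 0 y \<noteq> 0"
    "\<And>x. e x \<noteq> 0 \<Longrightarrow> (\<Sum>k\<le>K. c k (\<lambda>l. N l x / e x) * (T x / e x) ^ k) = 0"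
proof -
  obtain A r where r: "\<exists>k\<le>A. \<exists>\<alpha>\<in>exponents Y A. r k \<alpha> \<noteq> 0"
    "\<And>x. (\<Sum>k\<le>A. \<Sum>\<alpha>\<in>exponents Y A. r k \<alpha> *
        ((\<Prod>l\<in>Y. N l x ^ \<alpha> l * e x ^ (A - \<alpha> l)) * (T x ^ k * e x ^ (A - k)))) = 0"
    by (rule algebraic_dependence[OF X Y c e N T]) (assumption, rule that)
  define c' where "c' k y = (\<Sum>\<alpha>\<in>exponents Y A. r k \<alpha> * monom_fun Y \<alpha> y)" for k y
  have c'alg: "c' k \<in> gen_algebra (coords Y)" for k
    unfolding c'_def[abs_def] by (intro gen_algebra_intros monom_fun_in_algebra)
  define y where "y x l = N l x / e x" for x l
  have rel: "(\<Sum>k\<le>A. c' k (y x) * (T x / e x) ^ k) = 0" if ex: "e x \<noteq> 0" for x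
  proof -
    have pe: "a ^ k * e x ^ (A - k) = e x ^ A * (a / e x) ^ k" if "k \<le> A" for a k
    proof -
      have "e x ^ A = e x ^ k * e x ^ (A - k)" using that by (metis le_add_diff_inverse power_add)
      then show ?thesis using ex by (simp add: power_divide)
    qed
    define E where "E = (e x ^ A) ^ card Y * e x ^ A"
    have "0 = (\<Sum>k\<le>A. \<Sum>\<alpha>\<in>exponents Y A. r k \<alpha> *
        ((\<Prod>l\<in>Y. N l x ^ \<alpha> l * e x ^ (A - \<alpha> l)) * (T x ^ k * e x ^ (A - k))))" using r(2) by simp
    also have "\<dots> = (\<Sum>k\<le>A. \<Sum>\<alpha>\<in>exponents Y A. E * (r k \<alpha> * monom_fun Y \<alpha> (y x) * (T x / e x) ^ k))"
    proof (intro sum.cong refl)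
      fix k \<alpha> assume k: "k \<in> {..A}" and \<alpha>: "\<alpha> \<in> exponents Y A"
      have "(\<Prod>l\<in>Y. N l x ^ \<alpha> l * e x ^ (A - \<alpha> l)) = (\<Prod>l\<in>Y. e x ^ A * y x l ^ \<alpha> l)"
        by (intro prod.cong refl) (use \<alpha> in \<open>auto simp: y_def intro!: pe\<close>)
      also have "\<dots> = (e x ^ A) ^ card Y * monom_fun Y \<alpha> (y x)"
        by (simp add: prod.distrib monom_fun_def)
      finally show "r k \<alpha> * ((\<Prod>l\<in>Y. N l x ^ \<alpha> l * e x ^ (A - \<alpha> l)) * (T x ^ k * e x ^ (A - k)))
         = E * (r k \<alpha> * monom_fun Y \<alpha> (y x) * (T x / e x) ^ k)"
        using pe[of k "T x"] k by (simp add: E_def)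
    qed
    also have "\<dots> = E * (\<Sum>k\<le>A. c' k (y x) * (T x / e x) ^ k)"
      by (simp add: c'_def sum_distrib_left sum_distrib_right mult_ac)
    finally show ?thesis using ex by (simp add: E_def)
  qed
  have "\<exists>k\<le>A. \<exists>y. c' k y \<noteq> 0"
  proof (rule ccontr)
    assume "\<not> ?thesis"
    then have "(\<Sum>\<alpha>\<in>exponents Y A. r k \<alpha> * monom_fun Y \<alpha> y) = 0" if "k \<le> A" for k y
      using that by (auto simp: c'_def)
    then have "r k \<alpha> = 0" if "k \<le> A" "\<alpha> \<in> exponents Y A" for k \<alpha>
      using monom_fun_independent[OF Y, where a = "r k" and d = A] that by blast
    then show False using r(1) by blast
  qed
  \<comment> \<open>The lowest coefficient that is not identically zero becomes \<open>c 0\<close>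
    after division by a power of \<open>T / e\<close>.\<close>
  define k0 where "k0 = (LEAST k. \<exists>y. c' k y \<noteq> 0)"
  obtain k1 where k1: "k1 \<le> A" "\<exists>y. c' k1 y \<noteq> 0"
    using \<open>\<exists>k\<le>A. \<exists>y. c' k y \<noteq> 0\<close> by blast
  have k0: "\<exists>y. c' k0 y \<noteq> 0" unfolding k0_def by (rule LeastI[of "\<lambda>k. \<exists>y. c' k y \<noteq> 0", OF k1(2)])
  have "k0 \<le> k1" unfolding k0_def by (rule Least_le[of "\<lambda>k. \<exists>y. c' k y \<noteq> 0", OF k1(2)])
  then have k0A: "k0 \<le> A" using k1 by simp
  have below: "c' k y = 0" if "k < k0" for k y
    using not_less_Least[OF that[unfolded k0_def]] by blast
  define G where "G x = (\<Sum>k\<le>A - k0. c' (k0 + k) (y x) * (T x / e x) ^ k)" for x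
  have G0: "G x = 0" if "e x \<noteq> 0" "T x \<noteq> 0" for x
  proof -
    have "0 = (\<Sum>k\<le>A. c' k (y x) * (T x / e x) ^ k)" using rel[OF that(1)] by simp
    also have "\<dots> = (\<Sum>k\<in>{k0..A}. c' k (y x) * (T x / e x) ^ k)"
      by (rule sum.mono_neutral_right) (auto simp: below not_le)
    also have "\<dots> = (\<Sum>k\<le>A - k0. c' (k0 + k) (y x) * (T x / e x) ^ (k0 + k))"
      using k0A by (intro sum.reindex_bij_witness[of _ "\<lambda>k. k0 + k" "\<lambda>k. k - k0"]) auto
    also have "\<dots> = (T x / e x) ^ k0 * G x"
      by (simp add: G_def sum_distrib_left power_add mult_ac)
    finally show ?thesis using that by simp
  qed
  have Gall: "G x1 = 0" if ex1: "e x1 \<noteq> 0" for x1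
  proof -
    \<comment> \<open>On the line from \<open>x1\<close> to \<open>x0\<close> the function
      \<open>T\<close> is a polynomial in one variable, nonzero at 1, so its zeros do not accumulate
      at 0; the relation reaches \<open>x1\<close> by continuity.\<close>
    define p where "p s v = x1 v + s * (x0 v - x1 v)" for s v
    have p0: "p 0 = x1" "p 1 = x0" by (auto simp: p_def)
    have palg: "(\<lambda>s. g (p s)) \<in> gen_algebra {\<lambda>s. s}" if "g \<in> gen_algebra (coords X)" for g
    proof (rule gen_algebra_compose[OF that])
      fix f assume "f \<in> coords X"
      then obtain v where "f = (\<lambda>x. x v)" by (auto simp: coords_def)
      then show "(\<lambda>s. f (p s)) \<in> gen_algebra {\<lambda>s. s}"
        by (auto simp: p_def gen_algebra_affine)
    qed
    have cont: "isCont (\<lambda>s. g (p s)) s" if "g \<in> gen_algebra (coords X)" for g s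
      by (rule gen_algebra_isCont[OF that]) (auto simp: coords_def p_def intro!: continuous_intros)
    obtain P where P: "(\<lambda>s. T (p s)) = poly P" using gen_algebra_poly[OF palg[OF T]] by blast
    have "poly P 1 \<noteq> 0" using x0 P p0 by (metis)
    then have "finite {s. poly P s = 0}" by (intro poly_roots_finite) auto
    then have "eventually (\<lambda>s. T (p s) \<noteq> 0) (at 0)"
      using P islimpt_finite[of "{s. poly P s = 0}" 0]
      by (simp add: islimpt_iff_eventually fun_eq_iff)
    moreover have "eventually (\<lambda>s. e (p s) \<noteq> 0) (at 0)"
      using cont[OF e, of 0] ex1 p0 unfolding isCont_def
      by (intro tendsto_imp_eventually_ne[where c = "e (p 0)"]) auto
    ultimately have ev: "eventually (\<lambda>s. G (p s) = 0) (at 0)"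
      by eventually_elim (rule G0)
    have "isCont (\<lambda>s. c' k (y (p s))) 0" for k
    proof (rule gen_algebra_isCont[OF c'alg])
      fix g assume "g \<in> coords Y"
      then obtain l where l: "l \<in> Y" "g = (\<lambda>x. x l)" by (auto simp: coords_def)
      have "isCont (\<lambda>s. N l (p s) / e (p s)) 0"
        by (rule continuous_divide[OF cont[OF N[OF l(1)]] cont[OF e]]) (use ex1 p0 in simp)
      then show "isCont (\<lambda>s. g (y (p s))) 0" by (simp add: l y_def)
    qed
    then have "isCont (\<lambda>s. G (p s)) 0"
      unfolding G_def using ex1 p0 cont[OF T, of 0] cont[OF e, of 0] by (intro continuous_intros) auto
    then have "((\<lambda>s. G (p s)) \<longlongrightarrow> G (p 0)) (at 0)" by (simp add: isCont_def)
    moreover have "((\<lambda>s. G (p s)) \<longlongrightarrow> 0) (at 0)"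
      by (rule tendsto_eventually[OF ev])
    ultimately show ?thesis using p0 tendsto_unique[OF trivial_limit_at] by metis
  qed
  show ?thesis
  proof (rule that[of "\<lambda>k. c' (k0 + k)" "A - k0"])
    show "c' (k0 + k) \<in> gen_algebra (coords Y)" for k by (rule c'alg)
    show "\<exists>y. c' (k0 + 0) y \<noteq> 0" using k0 by simp
    show "(\<Sum>k\<le>A - k0. c' (k0 + k) (\<lambda>l. N l x / e x) * (T x / e x) ^ k) = 0" if "e x \<noteq> 0" for x
      using Gall[OF that] by (simp add: G_def y_def[abs_def])
  qed
qed

section \<open>Vanishing of polynomials and local mass of simple zeros\<close>

lemma gen_algebra_measurable:
  assumes "f \<in> gen_algebra C" "\<And>g. g \<in> C \<Longrightarrow> (\<lambda>x. g (p x)) \<in> borel_measurable M"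
  shows "(\<lambda>x. f (p x)) \<in> borel_measurable M"
  using assms(1) by induction (auto intro!: borel_measurable_add borel_measurable_times assms(2))

definition vec_algebra :: "(complex^'n::finite \<Rightarrow> complex) set" where
  "vec_algebra = gen_algebra (range (\<lambda>i z. z $ i))"

lemma vec_nth_borel [measurable]: "(\<lambda>z. z $ i) \<in> borel_measurable (borel :: (complex^'n::finite) measure)"
  by (intro borel_measurable_continuous_onI continuous_intros)

lemma vec_algebra_borel: "f \<in> vec_algebra \<Longrightarrow> f \<in> borel_measurable borel"
  unfolding vec_algebra_def
  by (rule gen_algebra_measurable[of f "range (\<lambda>i z. z $ i)" "\<lambda>x. x"]) auto

text \<open>On each line through \<open>x0\<close> the function is a nonzero polynomial in the real
  parameter and has finitely many zeros. Fubini for direction and parameter then shows that some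
  dilate of the zero set about \<open>x0\<close>, hence the set itself, is null.\<close>

lemma vec_algebra_AE_nonzero:
  assumes f: "f \<in> vec_algebra" and x0: "f x0 \<noteq> 0"
  shows "AE x in lborel. f x \<noteq> 0"
proof -
  have fm [measurable]: "f \<in> borel_measurable borel" using f by (rule vec_algebra_borel)
  define E where "E = {y. f (x0 + y) = 0}"
  have E [measurable]: "E \<in> sets borel" unfolding E_def by measurable
  have fin: "finite {s::real. f (x0 + s *\<^sub>R y) = 0}" for y
  proof -
    define g where "g s = f (\<chi> i. x0 $ i + s * y $ i)" for s :: complex
    have "g \<in> gen_algebra {\<lambda>s. s}"
      unfolding g_def using f[unfolded vec_algebra_def]
    proof (rule gen_algebra_compose)
      fix h assume "h \<in> range (\<lambda>i (z::complex^'a). z $ i)"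
      then show "(\<lambda>s. h (\<chi> i. x0 $ i + s * y $ i)) \<in> gen_algebra {\<lambda>s. s}"
        by (auto simp: gen_algebra_affine)
    qed
    then obtain p where p: "g = poly p" by (rule gen_algebra_poly)
    have "g 0 \<noteq> 0" using x0 by (simp add: g_def)
    then have "p \<noteq> 0" using p by auto
    then have "finite {s. poly p s = 0}" by (rule poly_roots_finite)
    then have "finite (complex_of_real -` {s. poly p s = 0})"
      by (rule finite_vimageI) (simp add: inj_def)
    moreover have "(\<chi> i. x0 $ i + complex_of_real s * y $ i) = x0 + s *\<^sub>R y" for s
      by (simp add: vec_eq_iff flip: scaleR_conv_of_real)
    ultimately show ?thesis by (simp add: vimage_def p[symmetric] g_def)
  qed
  have "(\<integral>\<^sup>+s. (\<integral>\<^sup>+y. indicator E (s *\<^sub>R y) \<partial>lborel) \<partial>(lborel :: real measure))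
      = (\<integral>\<^sup>+y. (\<integral>\<^sup>+s. indicator E (s *\<^sub>R y) \<partial>(lborel :: real measure)) \<partial>lborel)"
    by (rule lborel_pair.Fubini') measurable
  also have "\<dots> = (\<integral>\<^sup>+(y::complex^'a). 0 \<partial>lborel)"
  proof (rule nn_integral_cong)
    fix y
    have "AE s in lborel. s \<notin> {s::real. f (x0 + s *\<^sub>R y) = 0}"
      using fin by (intro AE_not_in finite_imp_null_set_lborel)
    then have "AE s in lborel. (indicator E (s *\<^sub>R y) :: ennreal) = 0"
      by eventually_elim (auto simp: E_def)
    then show "(\<integral>\<^sup>+s. indicator E (s *\<^sub>R y) \<partial>(lborel :: real measure)) = 0"
      by (subst nn_integral_0_iff_AE) measurable
  qed
  finally have "(\<integral>\<^sup>+s. (\<integral>\<^sup>+y. indicator E (s *\<^sub>R y) \<partial>lborel) \<partial>(lborel :: real measure)) = 0" by simp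
  then have "AE s in (lborel :: real measure). (\<integral>\<^sup>+y. indicator E (s *\<^sub>R y) \<partial>lborel) = 0"
    by (subst (asm) nn_integral_0_iff_AE) (auto intro!: lborel.borel_measurable_nn_integral)
  moreover have "AE s in (lborel :: real measure). s \<noteq> 0" by (rule AE_lborel_singleton)
  ultimately have "AE s in (lborel :: real measure). (\<integral>\<^sup>+y. indicator E (s *\<^sub>R y) \<partial>lborel) = 0 \<and> s \<noteq> 0"
    by eventually_elim auto
  then obtain s :: real where s: "(\<integral>\<^sup>+y. indicator E (s *\<^sub>R y) \<partial>lborel) = 0" "s \<noteq> 0"
    using eventually_happens'[of "ae_filter (lborel :: real measure)"
        "\<lambda>s. (\<integral>\<^sup>+y. indicator E (s *\<^sub>R y) \<partial>lborel) = 0 \<and> s \<noteq> 0"]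
    by (auto simp: ae_filter_eq_bot_iff simp del: AE_conj_iff)
  have "bij ((*\<^sub>R) s :: complex^'a \<Rightarrow> _)"
    using s(2) by (intro o_bij[of "(*\<^sub>R) (inverse s)"]) (auto simp: fun_eq_iff)
  then obtain k where k: "k > 0"
    "\<And>S. S \<in> sets borel \<Longrightarrow> emeasure lborel ((*\<^sub>R) s -` S) = ennreal k * emeasure lborel (S :: (complex^'a) set)"
    using linear_vimage_scale[OF linear_scaleR] by metis
  have vm [measurable]: "(*\<^sub>R) s -` E \<in> sets borel"
    using measurable_sets[of "(*\<^sub>R) s" borel borel E] by simp
  have "ennreal k * emeasure lborel E = emeasure lborel ((*\<^sub>R) s -` E)" using k(2)[OF E] by simp
  also have "\<dots> = (\<integral>\<^sup>+y. indicator ((*\<^sub>R) s -` E) y \<partial>lborel)" by simp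
  also have "\<dots> = 0" using s(1) by (simp add: indicator_vimage o_def)
  finally have "emeasure lborel E = 0" using k(1) by simp
  have "(\<integral>\<^sup>+x. indicator {x. f x = 0} x \<partial>lborel) = (\<integral>\<^sup>+x. indicator {x. f x = 0} (x0 + x) \<partial>lborel)"
    by (rule nn_integral_lborel_add[symmetric]) measurable
  also have "\<dots> = (\<integral>\<^sup>+x. indicator E x \<partial>lborel)" by (simp add: E_def indicator_def)
  also have "\<dots> = 0" using \<open>emeasure lborel E = 0\<close> by simp
  finally have "emeasure lborel {x. f x = 0} = 0" by simp
  then show ?thesis by (intro AE_I[of _ _ "{x. f x = 0}"]) auto
qed

section \<open>The uniform distribution on the polydisc and its finite products\<close>

definition polydisc :: "(complex^'n::finite) set" where
  "polydisc = {x. \<forall>j. norm (x $ j) < 1}"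

lemma open_polydisc: "open (polydisc :: (complex^'n::finite) set)"
proof -
  have "polydisc = (\<Inter>j\<in>UNIV. {x :: complex^'n. norm (x $ j) < 1})" by (auto simp: polydisc_def)
  also have "open \<dots>" by (intro open_INT finite ballI open_Collect_less continuous_intros)
  finally show ?thesis .
qed

lemma polydisc_borel [measurable]: "polydisc \<in> sets borel"
  by (rule borel_open[OF open_polydisc])

lemma norm_le_sum_components: "norm (x :: complex^'n::finite) \<le> (\<Sum>j\<in>UNIV. norm (x $ j))"
  unfolding norm_vec_def by (intro L2_set_le_sum) auto

lemma emeasure_polydisc: obtains b where "b > 0" "emeasure lborel (polydisc :: (complex^'n::finite) set) = ennreal b"
proof -
  have "polydisc \<subseteq> ball (0 :: complex^'n) (real CARD('n) + 1)"
  proof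
    fix x :: "complex^'n" assume "x \<in> polydisc"
    then have "(\<Sum>j\<in>UNIV. norm (x $ j)) \<le> (\<Sum>j\<in>(UNIV::'n set). 1)"
      by (intro sum_mono) (auto simp: polydisc_def less_imp_le)
    then show "x \<in> ball 0 (real CARD('n) + 1)" using norm_le_sum_components[of x] by simp
  qed
  then have "bounded (polydisc :: (complex^'n) set)" using bounded_ball bounded_subset by blast
  then have fin: "emeasure lborel (polydisc :: (complex^'n) set) < \<infinity>" by (rule emeasure_bounded_finite)
  obtain b where b: "b > 0" "emeasure lborel (ball (0::complex^'n) 1) = ennreal b"
    by (rule ball_emeasure)
  have "ball (0::complex^'n) 1 \<subseteq> polydisc"
    by (auto simp: polydisc_def intro: order.strict_trans1[OF Finite_Cartesian_Product.norm_nth_le])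
  then have "emeasure lborel (ball (0::complex^'n) 1) \<le> emeasure lborel (polydisc :: (complex^'n) set)"
    by (rule emeasure_mono) simp
  then have "emeasure lborel (polydisc :: (complex^'n) set) > 0" using b by (simp add: b(2)) (metis ennreal_less_zero_iff less_le_trans)
  then show ?thesis using fin that by (cases "emeasure lborel (polydisc :: (complex^'n) set)") auto
qed

definition unif_polydisc :: "(complex^'n::finite) measure" where
  "unif_polydisc = uniform_measure lborel polydisc"

lemma sets_unif_polydisc [simp, measurable_cong]: "sets unif_polydisc = sets borel"
  by (simp add: unif_polydisc_def)

lemma space_unif_polydisc [simp]: "space unif_polydisc = UNIV"
  by (simp add: unif_polydisc_def)

lemma emeasure_unif_polydisc_UNIV: "emeasure (unif_polydisc :: (complex^'n::finite) measure) UNIV = 1"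
proof -
  obtain b where "b > 0" "emeasure lborel (polydisc :: (complex^'n) set) = ennreal b"
    by (rule emeasure_polydisc)
  then show ?thesis by (simp add: unif_polydisc_def ennreal_divide_self)
qed

lemma finite_measure_unif_polydisc: "finite_measure (unif_polydisc :: (complex^'n::finite) measure)"
  by (rule finite_measureI) (simp add: emeasure_unif_polydisc_UNIV)

interpretation unif: product_sigma_finite "\<lambda>_::nat. unif_polydisc :: (complex^'n::finite) measure"
  by (simp add: product_sigma_finite_def finite_measure.axioms(1) finite_measure_unif_polydisc)

lemma emeasure_unif_PiM:
  assumes "finite I"
  shows "emeasure (Pi\<^sub>M I (\<lambda>_::nat. unif_polydisc :: (complex^'n::finite) measure)) (space (Pi\<^sub>M I (\<lambda>_. unif_polydisc))) = 1"
  unfolding space_PiM using unif.emeasure_PiM[OF assms, of "\<lambda>_. UNIV"] by (simp add: emeasure_unif_polydisc_UNIV)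

definition flatten :: "(nat \<Rightarrow> complex^'n) \<Rightarrow> nat \<times> 'n \<Rightarrow> complex" where
  "flatten w = (\<lambda>(\<nu>, j). w \<nu> $ j)"

text \<open>Vectors outside \<open>I\<close> are frozen at the nonvanishing point \<open>w0\<close>
  and released one at a time. For almost every choice of those already released, the function of the
  next one is a nonzero polynomial, as its value at \<open>w0 \<nu>\<close> shows.\<close>

lemma flatten_algebra_AE_nonzero:
  fixes f :: "(nat \<times> 'n::finite \<Rightarrow> complex) \<Rightarrow> complex"
  assumes f: "f \<in> gen_algebra (coords Y)" and w0: "f (flatten w0) \<noteq> 0" and I: "finite I"
  shows "AE w in Pi\<^sub>M I (\<lambda>_. unif_polydisc). f (flatten (\<lambda>\<nu>. if \<nu> \<in> I then w \<nu> else w0 \<nu>)) \<noteq> 0"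
  using I
proof (induction I rule: finite_induct)
  case empty
  then show ?case using w0 by simp
next
  case (insert \<nu> I)
  define c where "c I w = flatten (\<lambda>\<nu>. if \<nu> \<in> I then w \<nu> else w0 \<nu>)" for I :: "nat set" and w :: "nat \<Rightarrow> complex^'n"
  have meas: "(\<lambda>w. f (c J w)) \<in> borel_measurable (Pi\<^sub>M J (\<lambda>_. unif_polydisc))" for J
  proof (rule gen_algebra_measurable[OF f])
    fix g assume "g \<in> coords Y"
    then obtain \<nu> j where g: "g = (\<lambda>x. x (\<nu>, j))" by (auto simp: coords_def)
    show "(\<lambda>w. g (c J w)) \<in> borel_measurable (Pi\<^sub>M J (\<lambda>_. unif_polydisc))"
      unfolding g c_def flatten_def by (cases "\<nu> \<in> J") simp_all
  qed
  have alg: "(\<lambda>x. f (c (insert \<nu> I) (w(\<nu> := x)))) \<in> vec_algebra" for w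
    unfolding vec_algebra_def
  proof (rule gen_algebra_compose[OF f])
    fix g assume "g \<in> coords Y"
    then obtain \<mu> j where g: "g = (\<lambda>x. x (\<mu>, j))" by (auto simp: coords_def)
    show "(\<lambda>x. g (c (insert \<nu> I) (w(\<nu> := x)))) \<in> gen_algebra (range (\<lambda>i z. z $ i))"
      unfolding g c_def flatten_def
      by (cases "\<mu> = \<nu>"; cases "\<mu> \<in> I") (auto intro: gen_algebra.const gen_algebra.gen)
  qed
  have fm: "Measurable.pred (Pi\<^sub>M (insert \<nu> I) (\<lambda>_. unif_polydisc)) (\<lambda>w. f (c (insert \<nu> I) w) = 0)"
    using meas[of "insert \<nu> I"] by measurable
  have "(\<integral>\<^sup>+w. indicator {0} (f (c (insert \<nu> I) w)) \<partial>Pi\<^sub>M (insert \<nu> I) (\<lambda>_. unif_polydisc))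
     = (\<integral>\<^sup>+w. (\<integral>\<^sup>+x. indicator {0} (f (c (insert \<nu> I) (w(\<nu> := x)))) \<partial>unif_polydisc) \<partial>Pi\<^sub>M I (\<lambda>_. unif_polydisc))"
    by (rule unif.product_nn_integral_insert[OF insert.hyps]) (use meas[of "insert \<nu> I"] in measurable)
  also have "\<dots> = (\<integral>\<^sup>+w. 0 \<partial>Pi\<^sub>M I (\<lambda>_. unif_polydisc :: (complex^'n) measure))"
  proof (rule nn_integral_cong_AE, use insert.IH in eventually_elim)
    fix w :: "nat \<Rightarrow> complex^'n" assume "f (flatten (\<lambda>\<nu>. if \<nu> \<in> I then w \<nu> else w0 \<nu>)) \<noteq> 0"
    moreover have "c I w = c (insert \<nu> I) (w(\<nu> := w0 \<nu>))"
      using insert.hyps by (auto simp: c_def intro!: arg_cong[of _ _ flatten])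
    ultimately have "f (c (insert \<nu> I) (w(\<nu> := w0 \<nu>))) \<noteq> 0" by (simp add: c_def)
    then have "AE x in lborel. f (c (insert \<nu> I) (w(\<nu> := x))) \<noteq> 0"
      using vec_algebra_AE_nonzero[OF alg] by blast
    then have "AE x in unif_polydisc. f (c (insert \<nu> I) (w(\<nu> := x))) \<noteq> 0"
      unfolding unif_polydisc_def by (intro AE_uniform_measureI) (auto elim: eventually_mono)
    then have "AE x in unif_polydisc. indicator {0} (f (c (insert \<nu> I) (w(\<nu> := x)))) = (0::ennreal)"
      by eventually_elim simp
    then show "(\<integral>\<^sup>+x. indicator {0} (f (c (insert \<nu> I) (w(\<nu> := x)))) \<partial>unif_polydisc) = 0"
      using vec_algebra_borel[OF alg, of w] by (subst nn_integral_0_iff_AE) measurable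
  qed
  finally have "(\<integral>\<^sup>+w. indicator {0} (f (c (insert \<nu> I) w)) \<partial>Pi\<^sub>M (insert \<nu> I) (\<lambda>_. unif_polydisc)) = 0"
    by simp
  then have "AE w in Pi\<^sub>M (insert \<nu> I) (\<lambda>_. unif_polydisc). indicator {0} (f (c (insert \<nu> I) w)) = (0::ennreal)"
    using meas[of "insert \<nu> I"] by (subst (asm) nn_integral_0_iff_AE) (measurable, simp)
  then show ?case unfolding c_def by eventually_elim (auto simp: indicator_def split: if_splits)
qed

section \<open>Mass concentrated near a simple zero\<close>

lemma matrix_inj_bounded_below:
  assumes "det (A :: complex^'n::finite^'n) \<noteq> 0"
  obtains b where "b > 0" "\<And>x. b * norm x \<le> norm (A *v x)"
proof -
  obtain b where "b > 0" "\<And>x. b * norm x \<le> norm (A *v x)"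
    using linear_inj_bounded_below_pos[OF linear_complex_matrix[of A] bij_is_inj[OF bij_complex_matrix[OF assms]]]
    by blast
  then show ?thesis using that by blast
qed

lemma emeasure_scaled_polydisc:
  fixes A :: "complex^'n::finite^'n"
  assumes "det A \<noteq> 0" "c > 0"
  shows "emeasure lborel {x. \<forall>j. norm ((A *v x) $ j) < 1 / c}
      = ennreal (1 / ((norm (det A))\<^sup>2 * c ^ (2 * CARD('n)))) * emeasure lborel (polydisc :: (complex^'n) set)"
proof -
  define A' where "A' = mat (complex_of_real c) ** A"
  have dm: "det (mat (complex_of_real c) :: complex^'n^'n) = complex_of_real c ^ CARD('n)"
    by (subst det_diagonal) (auto simp: mat_def)
  have d: "det A' = complex_of_real c ^ CARD('n) * det A" by (simp add: A'_def det_mul dm)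
  have "(mat (complex_of_real c) *v y) $ j = complex_of_real c * y $ j" for y :: "complex^'n" and j
    by (simp add: matrix_vector_mult_def mat_def if_distrib[of "\<lambda>t. t * y" for y] cong: if_cong)
  then have A': "(A' *v x) $ j = complex_of_real c * (A *v x) $ j" for x j
    by (simp add: A'_def matrix_vector_mul_assoc[symmetric])
  have "{x. \<forall>j. norm ((A *v x) $ j) < 1 / c} = (*v) A' -` polydisc"
    using assms(2) by (auto simp: polydisc_def A' norm_mult field_simps)
  then show ?thesis
    using emeasure_complex_matrix_vimage[of A' polydisc] assms
    by (simp add: d norm_mult norm_power power_mult_distrib power_mult[symmetric] mult_ac)
qed

text \<open>Near \<open>z0\<close> the map \<open>f\<close> agrees with \<open>A\<close> up to a
  small error, so the set where all components are below \<open>1 / k\<close> contains a translated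
  preimage under \<open>A\<close> of the polydisc of radius \<open>1 / (2 * k)\<close>. Halving the
  radius costs \<open>4 ^ CARD('n)\<close>, halving |q|^2 costs 2, and the power of \<open>k\<close>
  compensates the shrinking volume.\<close>

lemma simple_zero_local_mass:
  fixes f :: "complex^'n::finite \<Rightarrow> complex^'n" and q :: "complex^'n \<Rightarrow> complex"
  assumes f0: "f z0 = 0" and fd: "(f has_derivative (*v) A) (at z0)" and dA: "det A \<noteq> 0"
    and U: "open U" "z0 \<in> U" and q: "isCont q z0"
  shows "eventually (\<lambda>k. ennreal ((norm (q z0))\<^sup>2 / 2 / (norm (det A))\<^sup>2 / 4 ^ CARD('n)) *
      emeasure lborel (polydisc :: (complex^'n) set) \<le>
      ennreal (real k ^ (2 * CARD('n))) *
        (\<integral>\<^sup>+z. ennreal ((norm (q z))\<^sup>2) * indicator {z \<in> U. \<forall>j. norm (f z $ j) < 1 / real k} z \<partial>lborel)) sequentially"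
proof (cases "q z0 = 0")
  case True
  then show ?thesis by simp
next
  case False
  obtain b where b: "b > 0" "\<And>x. b * norm x \<le> norm (A *v x)" using matrix_inj_bounded_below[OF dA] by blast
  define n where "n = real CARD('n)"
  have n: "n > 0" by (simp add: n_def)
  have lt: "(norm (q z0))\<^sup>2 / 2 < (norm (q z0))\<^sup>2" using False by simp
  have "((\<lambda>z. (norm (q z))\<^sup>2) \<longlongrightarrow> (norm (q z0))\<^sup>2) (at z0)"
    using q by (auto simp: isCont_def intro!: tendsto_intros)
  from order_tendstoD(1)[OF this lt] lt
  have "eventually (\<lambda>z. (norm (q z))\<^sup>2 > (norm (q z0))\<^sup>2 / 2) (nhds z0)"
    by (simp add: eventually_nhds_conv_at)
  with U have "eventually (\<lambda>z. z \<in> U \<and> (norm (q z))\<^sup>2 > (norm (q z0))\<^sup>2 / 2) (nhds z0)"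
    by (intro eventually_conj) (auto simp: eventually_nhds)
  then obtain r1 where r1: "r1 > 0" "\<And>z. dist z z0 < r1 \<Longrightarrow> z \<in> U \<and> (norm (q z))\<^sup>2 > (norm (q z0))\<^sup>2 / 2"
    unfolding eventually_nhds_metric by blast
  \<comment> \<open>The tolerance \<open>b / n\<close> is matched to the estimate of
    \<open>norm x\<close> by \<open>n / (2 * k * b)\<close> below: the linearisation error is then
    at most \<open>1 / (2 * k)\<close>.\<close>
  obtain r2 where r2: "r2 > 0" "\<And>z. norm (z - z0) < r2 \<Longrightarrow> norm (f z - f z0 - A *v (z - z0)) \<le> b / n * norm (z - z0)"
    using fd b(1) n unfolding has_derivative_at_alt by (metis divide_pos_pos)
  have "eventually (\<lambda>k. n / (2 * b * min r1 r2) < real k) sequentially"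
    using eventually_gt_at_top[of "nat \<lceil>n / (2 * b * min r1 r2)\<rceil>"] by eventually_elim linarith
  moreover have "eventually (\<lambda>k. k > 0) sequentially" by (rule eventually_gt_at_top)
  ultimately show ?thesis
  proof eventually_elim
    fix k :: nat assume k: "n / (2 * b * min r1 r2) < real k" "k > 0"
    define S where "S = {x. \<forall>j. norm ((A *v x) $ j) < 1 / (2 * real k)}"
    have S [measurable]: "S \<in> sets borel" unfolding S_def by measurable
    have sub: "z0 + x \<in> U \<and> (norm (q (z0 + x)))\<^sup>2 > (norm (q z0))\<^sup>2 / 2 \<and> (\<forall>j. norm (f (z0 + x) $ j) < 1 / real k)"
      if x: "x \<in> S" for x
    proof -
      have "norm (A *v x) \<le> (\<Sum>j\<in>UNIV. norm ((A *v x) $ j))" by (rule norm_le_sum_components)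
      also have "\<dots> \<le> (\<Sum>j\<in>(UNIV::'n set). 1 / (2 * real k))"
        using x by (intro sum_mono) (auto simp: S_def less_imp_le)
      finally have "norm (A *v x) \<le> n / (2 * real k)" by (simp add: n_def)
      with b(2)[of x] have "b * norm x \<le> n / (2 * real k)" by linarith
      then have nx: "norm x \<le> n / (2 * real k) / b" using b(1) by (subst pos_le_divide_eq[OF b(1)]) (simp add: mult.commute)
      also have "\<dots> < min r1 r2"
      proof -
        define r where "r = min r1 r2"
        have "r > 0" using r1(1) r2(1) by (simp add: r_def)
        then show ?thesis using k b(1) unfolding r_def[symmetric] by (simp add: field_simps)
      qed
      finally have nx2: "norm x < min r1 r2" .
      have 1: "z0 + x \<in> U \<and> (norm (q (z0 + x)))\<^sup>2 > (norm (q z0))\<^sup>2 / 2"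
        using nx2 by (intro r1(2)) (simp add: dist_norm)
      have "norm (f (z0 + x) - A *v x) \<le> b / n * norm x"
        using r2(2)[of "z0 + x"] nx2 f0 by simp
      also have "\<dots> \<le> b / n * (n / (2 * real k) / b)"
        using nx b(1) n by (intro mult_left_mono) auto
      also have "\<dots> = 1 / (2 * real k)" using b(1) n by simp
      finally have 2: "norm (f (z0 + x) - A *v x) \<le> 1 / (2 * real k)" .
      have "norm (f (z0 + x) $ j) < 1 / real k" for j
      proof -
        have "norm ((f (z0 + x) - A *v x) $ j) \<le> 1 / (2 * real k)"
          using 2 Finite_Cartesian_Product.norm_nth_le order_trans by blast
        moreover have "norm ((A *v x) $ j) < 1 / (2 * real k)" using x by (simp add: S_def)
        moreover have "norm (f (z0 + x) $ j) \<le> norm ((f (z0 + x) - A *v x) $ j) + norm ((A *v x) $ j)"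
          using norm_triangle_ineq[of "(f (z0 + x) - A *v x) $ j" "(A *v x) $ j"] by simp
        ultimately have "norm (f (z0 + x) $ j) < 1 / (2 * real k) + 1 / (2 * real k)" by linarith
        then show ?thesis by simp
      qed
      then show ?thesis using 1 by blast
    qed
    have "ennreal ((norm (q z0))\<^sup>2 / 2) * emeasure lborel S
        = (\<integral>\<^sup>+x. ennreal ((norm (q z0))\<^sup>2 / 2) * indicator S x \<partial>lborel)"
      by (simp add: nn_integral_cmult_indicator)
    also have "\<dots> = (\<integral>\<^sup>+z. ennreal ((norm (q z0))\<^sup>2 / 2) * indicator S (- z0 + z) \<partial>lborel)"
      by (rule nn_integral_lborel_add[symmetric]) measurable
    also have "\<dots> \<le> (\<integral>\<^sup>+z. ennreal ((norm (q z))\<^sup>2) * indicator {z \<in> U. \<forall>j. norm (f z $ j) < 1 / real k} z \<partial>lborel)"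
    proof (rule nn_integral_mono)
      fix z
      show "ennreal ((norm (q z0))\<^sup>2 / 2) * indicator S (- z0 + z) \<le>
        ennreal ((norm (q z))\<^sup>2) * indicator {z \<in> U. \<forall>j. norm (f z $ j) < 1 / real k} z"
        using sub[of "- z0 + z"] by (cases "- z0 + z \<in> S") (auto intro!: ennreal_leI)
    qed
    finally have le: "ennreal ((norm (q z0))\<^sup>2 / 2) * emeasure lborel S \<le> \<dots>" .
    have eS: "emeasure lborel S = ennreal (1 / ((norm (det A))\<^sup>2 * (2 * real k) ^ (2 * CARD('n)))) * emeasure lborel (polydisc :: (complex^'n) set)"
      unfolding S_def using k by (intro emeasure_scaled_polydisc[OF dA]) auto
    have pe: "(norm (q z0))\<^sup>2 / 2 / (norm (det A))\<^sup>2 / 4 ^ CARD('n)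
       = real k ^ (2 * CARD('n)) * ((norm (q z0))\<^sup>2 / 2 * (1 / ((norm (det A))\<^sup>2 * (2 * real k) ^ (2 * CARD('n)))))"
    proof -
      have "(2 * real k) ^ (2 * CARD('n)) = 4 ^ CARD('n) * real k ^ (2 * CARD('n))"
        by (simp add: power_mult_distrib power_mult)
      then show ?thesis using k dA by (simp add: field_simps)
    qed
    have "ennreal ((norm (q z0))\<^sup>2 / 2 / (norm (det A))\<^sup>2 / 4 ^ CARD('n)) * emeasure lborel (polydisc :: (complex^'n) set)
       = ennreal (real k ^ (2 * CARD('n))) * (ennreal ((norm (q z0))\<^sup>2 / 2) * emeasure lborel S)"
      unfolding pe eS by (subst ennreal_mult, simp, simp, subst ennreal_mult) (auto simp: mult_ac)
    also have "\<dots> \<le> ennreal (real k ^ (2 * CARD('n))) *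
        (\<integral>\<^sup>+z. ennreal ((norm (q z))\<^sup>2) * indicator {z \<in> U. \<forall>j. norm (f z $ j) < 1 / real k} z \<partial>lborel)"
      by (intro mult_left_mono le) auto
    finally show "ennreal ((norm (q z0))\<^sup>2 / 2 / (norm (det A))\<^sup>2 / 4 ^ CARD('n)) *
      emeasure lborel (polydisc :: (complex^'n) set) \<le>
      ennreal (real k ^ (2 * CARD('n))) *
        (\<integral>\<^sup>+z. ennreal ((norm (q z))\<^sup>2) * indicator {z \<in> U. \<forall>j. norm (f z $ j) < 1 / real k} z \<partial>lborel)" .
  qed
qed

section \<open>Zeros of a holomorphic pencil\<close>

lemma vec_algebra_nth: "(\<lambda>z. z $ i) \<in> vec_algebra"
  unfolding vec_algebra_def by (rule gen_algebra.gen) simp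

lemmas vec_algebra_intros = gen_algebra_intros[where C = "range (\<lambda>i z. z $ i)", folded vec_algebra_def]

lemma vec_algebra_induct [consumes 1, case_names const nth add mult]:
  assumes "f \<in> vec_algebra" "\<And>c. R (\<lambda>_. c)" "\<And>i. R (\<lambda>z. z $ i)"
    "\<And>f g. f \<in> vec_algebra \<Longrightarrow> R f \<Longrightarrow> g \<in> vec_algebra \<Longrightarrow> R g \<Longrightarrow> R (\<lambda>x. f x + g x)"
    "\<And>f g. f \<in> vec_algebra \<Longrightarrow> R f \<Longrightarrow> g \<in> vec_algebra \<Longrightarrow> R g \<Longrightarrow> R (\<lambda>x. f x * g x)"
  shows "R f"
  using assms(1) unfolding vec_algebra_def
proof induction
  case (gen f)
  then show ?case using assms(3) by auto
qed (use assms(2,4,5) in \<open>auto simp: vec_algebra_def\<close>)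

lemma vec_algebra_has_derivative:
  assumes "f \<in> vec_algebra"
  obtains D where "\<And>k. D k \<in> vec_algebra" "\<And>z. (f has_derivative (\<lambda>h. \<Sum>k\<in>UNIV. h $ k * D k z)) (at z)"
proof -
  have "\<exists>D. (\<forall>k. D k \<in> vec_algebra) \<and> (\<forall>z. (f has_derivative (\<lambda>h. \<Sum>k\<in>UNIV. h $ k * D k z)) (at z))"
    using assms
  proof (induction rule: vec_algebra_induct)
    case (const c)
    show ?case by (intro exI[of _ "\<lambda>_ _. 0"]) (auto intro: vec_algebra_intros)
  next
    case (nth i)
    have eq: "(\<Sum>k\<in>UNIV. h $ k * (if k = i then 1 else 0)) = h $ i" for h :: "complex^'a"
      by (simp add: if_distrib[of "\<lambda>t. y * t" for y] cong: if_cong)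
    show ?case
    proof (intro exI[of _ "\<lambda>k _. if k = i then 1 else 0"] conjI allI)
      show "((\<lambda>z::complex^'a. z $ i) has_derivative (\<lambda>h. \<Sum>k\<in>UNIV. h $ k * (if k = i then 1 else 0))) (at z)" for z
        using bounded_linear_imp_has_derivative[OF bounded_linear_vec_nth, of i] by (simp add: eq)
    qed (auto intro: vec_algebra_intros)
  next
    case (add f g)
    then obtain D E where "\<And>k. D k \<in> vec_algebra" "\<And>z. (f has_derivative (\<lambda>h. \<Sum>k\<in>UNIV. h $ k * D k z)) (at z)"
      "\<And>k. E k \<in> vec_algebra" "\<And>z. (g has_derivative (\<lambda>h. \<Sum>k\<in>UNIV. h $ k * E k z)) (at z)" by blast
    then show ?case
      by (intro exI[of _ "\<lambda>k z. D k z + E k z"])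
         (auto intro!: vec_algebra_intros has_derivative_add simp: distrib_left sum.distrib)
  next
    case (mult f g)
    then obtain D E where D: "\<And>k. D k \<in> vec_algebra" "\<And>z. (f has_derivative (\<lambda>h. \<Sum>k\<in>UNIV. h $ k * D k z)) (at z)"
      "\<And>k. E k \<in> vec_algebra" "\<And>z. (g has_derivative (\<lambda>h. \<Sum>k\<in>UNIV. h $ k * E k z)) (at z)" by blast
    show ?case
    proof (intro exI[of _ "\<lambda>k z. f z * E k z + D k z * g z"] conjI allI)
      fix z
      have "((\<lambda>x. f x * g x) has_derivative (\<lambda>h. f z * (\<Sum>k\<in>UNIV. h $ k * E k z) + (\<Sum>k\<in>UNIV. h $ k * D k z) * g z)) (at z)"
        by (rule has_derivative_mult[OF D(2) D(4)])
      then show "((\<lambda>x. f x * g x) has_derivative (\<lambda>h. \<Sum>k\<in>UNIV. h $ k * (f z * E k z + D k z * g z))) (at z)"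
        by (simp add: distrib_left sum.distrib sum_distrib_left sum_distrib_right mult_ac)
    qed (use mult D in \<open>auto intro!: vec_algebra_intros\<close>)
  qed
  then show ?thesis using that by blast
qed

lemma bounded_linear_axis: "bounded_linear (axis k :: complex \<Rightarrow> complex^'n::finite)"
  by (rule linear_conv_bounded_linear[THEN iffD1], rule linearI) (auto simp: axis_def vec_eq_iff)

lemma has_derivative_vec_componentwise:
  fixes f :: "'a::real_normed_vector \<Rightarrow> complex^'n::finite"
  assumes "\<And>j. ((\<lambda>x. f x $ j) has_derivative (\<lambda>d. f' d $ j)) (at x)"
  shows "(f has_derivative f') (at x)"
proof -
  have eq: "y = (\<Sum>j\<in>UNIV. axis j (y $ j))" for y :: "complex^'n"
    by (simp add: vec_eq_iff axis_def)
  have "((\<lambda>x. \<Sum>j\<in>UNIV. axis j (f x $ j)) has_derivative (\<lambda>d. \<Sum>j\<in>UNIV. axis j (f' d $ j))) (at x)"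
    by (intro has_derivative_sum bounded_linear.has_derivative[OF bounded_linear_axis] assms)
  then show ?thesis by (simp only: eq[symmetric])
qed

lemma partial_deriv_eq:
  assumes "(f has_derivative (\<lambda>h. \<Sum>k\<in>UNIV. h $ k * D k)) (at z)"
  shows "partial_deriv k f z = D k"
proof -
  define c where "c t = (\<chi> i. if i = k then t else z $ i)" for t
  have c: "c t = z + axis k (t - z $ k)" for t by (simp add: c_def vec_eq_iff axis_def)
  have c0: "c (z $ k) = z" by (simp add: c_def vec_eq_iff)
  have "(c has_derivative axis k) (at (z $ k))"
    unfolding c by (rule derivative_eq_intros bounded_linear.has_derivative[OF bounded_linear_axis] | simp)+
  moreover have "(f has_derivative (\<lambda>h. \<Sum>k\<in>UNIV. h $ k * D k)) (at (c (z $ k)))"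
    using assms by (simp add: c0)
  ultimately have "((\<lambda>t. f (c t)) has_derivative (\<lambda>d. \<Sum>i\<in>UNIV. axis k d $ i * D i)) (at (z $ k))"
    by (rule has_derivative_compose)
  moreover have "(\<Sum>i\<in>UNIV. axis k d $ i * D i) = D k * d" for d
    by (simp add: axis_def if_distrib[of "\<lambda>t. t * y" for y] cong: if_cong)
  ultimately have "((\<lambda>t. f (c t)) has_field_derivative D k) (at (z $ k))"
    by (simp add: has_field_derivative_def)
  then show ?thesis by (simp add: partial_deriv_def c_def DERIV_imp_deriv)
qed

lemma vec_algebra_partial_deriv:
  assumes "f \<in> vec_algebra"
  shows "partial_deriv k f \<in> vec_algebra"
    and "(f has_derivative (\<lambda>h. \<Sum>k\<in>UNIV. h $ k * partial_deriv k f z)) (at z)"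
proof -
  obtain D where D: "\<And>k. D k \<in> vec_algebra" "\<And>z. (f has_derivative (\<lambda>h. \<Sum>k\<in>UNIV. h $ k * D k z)) (at z)"
    using vec_algebra_has_derivative[OF assms] by blast
  have "partial_deriv k f = D k" for k using partial_deriv_eq[OF D(2)] by (rule ext)
  then show "partial_deriv k f \<in> vec_algebra"
    "(f has_derivative (\<lambda>h. \<Sum>k\<in>UNIV. h $ k * partial_deriv k f z)) (at z)" using D by auto
qed

lemma vec_algebra_isCont: "f \<in> vec_algebra \<Longrightarrow> isCont f z"
  using vec_algebra_partial_deriv(2) has_derivative_continuous by blast

lemma vec_algebra_continuous_on: "f \<in> vec_algebra \<Longrightarrow> continuous_on S f"
  using vec_algebra_isCont continuous_at_imp_continuous_on by blast

lemma vec_algebra_holomorphic: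
  assumes "f \<in> vec_algebra" "\<And>i. (\<lambda>s. \<psi> s $ i) holomorphic_on S"
  shows "(\<lambda>s. f (\<psi> s)) holomorphic_on S"
  using assms(1) by (induction rule: vec_algebra_induct) (auto intro!: holomorphic_intros assms(2))

lemma det_nonzero_if_inj:
  fixes A :: "complex^'n::finite^'n"
  assumes "\<And>h. A *v h = 0 \<Longrightarrow> h = 0"
  shows "det A \<noteq> 0"
proof -
  have "inj ((*v) A)"
    using assms by (intro injI) (metis eq_iff_diff_eq_0 matrix_vector_mult_diff_distrib)
  then show ?thesis
    by (metis invertible_det_nz invertible_left_inverse matrix_left_invertible_injective)
qed

section \<open>Following simple zeros as the parameter varies\<close>

definition pencil :: "('n \<Rightarrow> complex^'n::finite \<Rightarrow> complex) \<Rightarrow> ('n \<Rightarrow> complex^'n \<Rightarrow> complex) \<Rightarrow>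
    complex \<Rightarrow> complex^'n \<Rightarrow> complex^'n" where
  "pencil F p s z = (\<chi> j. F j z - s * p j z)"

definition pencil_jac :: "('n \<Rightarrow> complex^'n::finite \<Rightarrow> complex) \<Rightarrow> ('n \<Rightarrow> complex^'n \<Rightarrow> complex) \<Rightarrow>
    complex \<Rightarrow> complex^'n \<Rightarrow> complex^'n^'n" where
  "pencil_jac F p s z = (\<chi> j k. partial_deriv k (F j) z - s * partial_deriv k (p j) z)"

text \<open>The inverse function theorem is applied to the map from (s, z) to (s,
  \<open>pencil F p s z\<close>), whose derivative at the zero is invertible. It is a statement over
  the reals, so complex differentiability of the branch has to be recovered afterwards.\<close>

lemma zero_branch:
  fixes F p :: "'n::finite \<Rightarrow> complex^'n \<Rightarrow> complex"
  assumes F: "\<And>j. F j \<in> vec_algebra" and p: "\<And>j. p j \<in> vec_algebra"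
    and z0: "pencil F p s0 z0 = 0" "det (pencil_jac F p s0 z0) \<noteq> 0" and U: "open U" "z0 \<in> U"
  obtains r V \<psi> where "r > 0" "open V" "V \<subseteq> U" "z0 \<in> V" "\<And>i. (\<lambda>s. \<psi> s $ i) holomorphic_on ball s0 r"
    "\<And>s. s \<in> ball s0 r \<Longrightarrow> \<psi> s \<in> V \<and> det (pencil_jac F p s (\<psi> s)) \<noteq> 0 \<and> (\<forall>z\<in>V. pencil F p s z = 0 \<longleftrightarrow> z = \<psi> s)"
proof -
  define H where "H x = (fst x, pencil F p (fst x) (snd x))" for x
  define H' where "H' x d = (fst d, pencil_jac F p (fst x) (snd x) *v snd d - (\<chi> j. fst d * p j (snd x)))"
    for x d :: "complex \<times> (complex^'n)"
  have Fd: "(F j has_derivative (\<lambda>h. \<Sum>k\<in>UNIV. h $ k * partial_deriv k (F j) z)) (at z)"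
    and pd: "(p j has_derivative (\<lambda>h. \<Sum>k\<in>UNIV. h $ k * partial_deriv k (p j) z)) (at z)" for j z
    by (intro vec_algebra_partial_deriv F p)+
  have comp: "((\<lambda>x. F j (snd x) - fst x * p j (snd x)) has_derivative (\<lambda>d. snd (H' x d) $ j)) (at x)" for x j
  proof -
    have s: "(snd has_derivative snd) (at x)" "(fst has_derivative fst) (at x)"
      by (auto intro!: derivative_eq_intros)
    have "((\<lambda>x. F j (snd x) - fst x * p j (snd x)) has_derivative
       (\<lambda>d. (\<Sum>k\<in>UNIV. snd d $ k * partial_deriv k (F j) (snd x)) -
         (fst x * (\<Sum>k\<in>UNIV. snd d $ k * partial_deriv k (p j) (snd x)) + fst d * p j (snd x)))) (at x)"
      by (intro has_derivative_diff has_derivative_mult has_derivative_compose[OF s(1) Fd]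
          has_derivative_compose[OF s(1) pd] s(2))
    then show ?thesis
      by (simp add: H'_def pencil_jac_def matrix_vector_mult_def sum_distrib_left algebra_simps sum_subtractf)
  qed
  have Hd: "(H has_derivative H' x) (at x)" for x
  proof -
    have "((\<lambda>x. pencil F p (fst x) (snd x)) has_derivative (\<lambda>d. snd (H' x d))) (at x)"
      by (rule has_derivative_vec_componentwise) (use comp in \<open>simp add: pencil_def\<close>)
    then have "((\<lambda>x. (fst x, pencil F p (fst x) (snd x))) has_derivative (\<lambda>d. (fst d, snd (H' x d)))) (at x)"
      by (intro has_derivative_Pair) (auto intro!: derivative_eq_intros)
    then show ?thesis by (simp add: H_def[abs_def] H'_def[abs_def])
  qed
  have bl: "bounded_linear (H' x)" for x using Hd by (rule has_derivative_bounded_linear)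
  define B where "B x = Blinfun (H' x)" for x
  have B: "blinfun_apply (B x) = H' x" for x
    unfolding B_def by (rule bounded_linear_Blinfun_apply[OF bl])
  have cB: "continuous_on UNIV B"
  proof (rule continuous_on_blinfun_componentwise)
    fix i :: "complex \<times> (complex^'n)"
    have 1: "continuous_on UNIV (\<lambda>x::complex \<times> (complex^'n). g (snd x))" if "g \<in> vec_algebra" for g
      by (rule continuous_on_compose2[OF vec_algebra_continuous_on[OF that, of UNIV]]) (auto intro: continuous_intros)
    show "continuous_on UNIV (\<lambda>x. blinfun_apply (B x) i)"
      unfolding B H'_def pencil_jac_def matrix_vector_mult_def
      by (intro continuous_intros continuous_on_vec_lambda 1 F p vec_algebra_partial_deriv)
  qed
  have inj0: "inj (H' (s0, z0))"
  proof (rule injI)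
    fix a b assume ab: "H' (s0, z0) a = H' (s0, z0) b"
    then have f: "fst a = fst b" by (simp add: H'_def)
    with ab have "pencil_jac F p s0 z0 *v snd a = pencil_jac F p s0 z0 *v snd b" by (simp add: H'_def)
    then have "snd a = snd b" using bij_complex_matrix[OF z0(2)] by (meson bij_is_inj injD)
    with f show "a = b" by (simp add: prod_eq_iff)
  qed
  obtain I where I: "linear I" "I \<circ> H' (s0, z0) = id"
    using linear_injective_left_inverse[OF bounded_linear.linear[OF bl] inj0] by blast
  have "I (H' (s0, z0) x) = x" for x using I(2) by (metis comp_apply id_apply)
  then have "Blinfun I o\<^sub>L B (s0, z0) = id_blinfun"
    using I(1) by (intro blinfun_eqI) (simp add: B bounded_linear_Blinfun_apply linear_conv_bounded_linear)
  from inverse_function_theorem[OF open_UNIV _ cB UNIV_I this, of H, unfolded B] Hd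
  obtain U' V' g g' where ift: "open U'" "(s0, z0) \<in> U'" "open V'" "H (s0, z0) \<in> V'" "homeomorphism U' V' H g"
    "\<And>y. y \<in> V' \<Longrightarrow> (g has_derivative (g' y)) (at y)"
    "\<And>y. y \<in> V' \<Longrightarrow> g' y = inv (H' (g y))" "\<And>y. y \<in> V' \<Longrightarrow> bij (H' (g y))"
    by (metis UNIV_I)
  have "open (U' \<inter> UNIV \<times> U)" "(s0, z0) \<in> U' \<inter> UNIV \<times> U"
    using ift U by (auto intro!: open_Int open_Times)
  \<comment> \<open>A product neighbourhood lets uniqueness of the zero be stated in a set
    \<open>V\<close> that does not depend on \<open>s\<close>.\<close>
  then obtain A V where AV: "open A" "open V" "(s0, z0) \<in> A \<times> V" "A \<times> V \<subseteq> U' \<inter> UNIV \<times> U"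
    by (rule open_prod_elim)
  have H0: "H (s0, z0) = (s0, 0)" using z0 by (simp add: H_def)
  have g0: "g (s0, 0) = (s0, z0)" using ift(2,5) H0 by (metis homeomorphism_apply1)
  have "open (V' \<inter> g -` (A \<times> V))"
    using continuous_open_preimage[OF homeomorphism_cont2[OF ift(5)] ift(3) open_Times[OF AV(1,2)]] by simp
  then have "open ((\<lambda>s. (s, 0)) -` (V' \<inter> g -` (A \<times> V)) \<inter> A)"
    by (rule open_Int[OF open_vimage AV(1)]) (intro continuous_intros)
  moreover have "s0 \<in> (\<lambda>s. (s, 0)) -` (V' \<inter> g -` (A \<times> V)) \<inter> A"
    using ift(4) H0 g0 AV(3) by auto
  ultimately obtain r where r: "r > 0" "ball s0 r \<subseteq> (\<lambda>s. (s, 0)) -` (V' \<inter> g -` (A \<times> V)) \<inter> A"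
    by (meson open_contains_ball)
  define \<psi> where "\<psi> s = snd (g (s, 0))" for s
  have g: "g (s, 0) = (s, \<psi> s)" "\<psi> s \<in> V" "(s, 0) \<in> V'" "pencil F p s (\<psi> s) = 0" "s \<in> A" if "s \<in> ball s0 r" for s
  proof -
    have s: "(s, 0) \<in> V'" "g (s, 0) \<in> A \<times> V" "s \<in> A" using that r(2) by auto
    have "H (g (s, 0)) = (s, 0)" using ift(5) s(1) by (metis homeomorphism_apply2)
    then show "g (s, 0) = (s, \<psi> s)" "pencil F p s (\<psi> s) = 0"
      by (auto simp: H_def \<psi>_def prod_eq_iff)
    show "\<psi> s \<in> V" "(s, 0) \<in> V'" "s \<in> A" using s by (auto simp: \<psi>_def mem_Times_iff)
  qed
  show ?thesis
  proof (rule that[of r V \<psi>])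
    show "r > 0" "open V" "z0 \<in> V" "V \<subseteq> U" using r AV by auto
    show "\<psi> s \<in> V \<and> det (pencil_jac F p s (\<psi> s)) \<noteq> 0 \<and> (\<forall>z\<in>V. pencil F p s z = 0 \<longleftrightarrow> z = \<psi> s)" if s: "s \<in> ball s0 r" for s
    proof (intro conjI ballI)
      show "\<psi> s \<in> V" by (rule g[OF s])
      show "det (pencil_jac F p s (\<psi> s)) \<noteq> 0"
      proof (rule det_nonzero_if_inj)
        fix h assume "pencil_jac F p s (\<psi> s) *v h = 0"
        then have "H' (g (s, 0)) (0, h) = H' (g (s, 0)) (0, 0)"
          by (simp add: H'_def g[OF s] vec_eq_iff)
        then show "h = 0" using ift(8)[OF g(3)[OF s]] by (metis bij_is_inj injD prod.inject)
      qed
      fix z assume z: "z \<in> V"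
      show "pencil F p s z = 0 \<longleftrightarrow> z = \<psi> s"
      proof
        assume "pencil F p s z = 0"
        then have "H (s, z) = (s, 0)" by (simp add: H_def)
        moreover have "(s, z) \<in> U'" using AV(4) g(5)[OF s] z by auto
        ultimately have "g (s, 0) = (s, z)" using ift(5) by (metis homeomorphism_apply1)
        then show "z = \<psi> s" by (simp add: \<psi>_def)
      qed (use g[OF s] in simp)
    qed
    fix i
    have "((\<lambda>s. \<psi> s $ i) has_field_derivative (snd (inv (H' (g (s, 0))) (1, 0)) $ i)) (at s)" if s: "s \<in> ball s0 r" for s
    proof -
      define K where "K = inv (H' (g (s, 0)))"
      have bij: "bij (H' (g (s, 0)))" by (rule ift(8)[OF g(3)[OF s]])
      have K: "H' (g (s, 0)) (K y) = y" for y
        using bij by (simp add: K_def bij_is_surj surj_f_inv_f)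
      \<comment> \<open>Complex linearity of the inverse derivative along the \<open>s\<close> axis:
        the solution \<open>h\<close> for \<open>d = 1\<close>, multiplied by \<open>d\<close>,
        solves the equation for \<open>d\<close>, and \<open>H'\<close> is injective.\<close>
      have lin: "K (d, 0) = (d, \<chi> i. d * snd (K (1, 0)) $ i)" for d
      proof -
        define h where "h = snd (K (1, 0))"
        have "fst (K (1, 0)) = 1" using K[of "(1, 0)"] by (simp add: H'_def)
        then have h: "pencil_jac F p s (\<psi> s) *v h - (\<chi> j. p j (\<psi> s)) = 0"
          using K[of "(1, 0)"] by (simp add: H'_def g[OF s] h_def)
        have "pencil_jac F p s (\<psi> s) *v (\<chi> i. d * h $ i) = (\<chi> j. d * (pencil_jac F p s (\<psi> s) *v h) $ j)"
          by (simp add: matrix_vector_mult_def vec_eq_iff sum_distrib_left mult_ac)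
        also have "\<dots> = (\<chi> j. d * p j (\<psi> s))" using h by (simp add: vec_eq_iff)
        finally have eq: "H' (g (s, 0)) (d, \<chi> i. d * h $ i) = (d, 0)" by (simp add: H'_def g[OF s])
        have "K (H' (g (s, 0)) (d, \<chi> i. d * h $ i)) = (d, \<chi> i. d * h $ i)"
          unfolding K_def by (rule inv_f_f[OF bij_is_inj[OF bij]])
        then have "K (d, 0) = (d, \<chi> i. d * h $ i)" unfolding eq .
        then show ?thesis unfolding h_def .
      qed
      have "((\<lambda>t. (t, 0)) has_derivative (\<lambda>t. (t, 0))) (at s)"
        by (auto intro!: derivative_eq_intros)
      from has_derivative_compose[OF this ift(6)[OF g(3)[OF s]]]
      have "((\<lambda>t. g (t, 0)) has_derivative (\<lambda>t. K (t, 0))) (at s)"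
        by (simp add: ift(7)[OF g(3)[OF s]] K_def)
      then have "((\<lambda>t. snd (g (t, 0)) $ i) has_derivative (\<lambda>t. snd (K (t, 0)) $ i)) (at s)"
        by (intro bounded_linear.has_derivative[OF bounded_linear_vec_nth] has_derivative_snd)
      moreover have "(\<lambda>t. snd (K (t, 0)) $ i) = (*) (snd (K (1, 0)) $ i)"
        by (rule ext, subst lin) (simp add: mult.commute)
      ultimately have "((\<lambda>t. snd (g (t, 0)) $ i) has_derivative (*) (snd (K (1, 0)) $ i)) (at s)"
        by (simp only:)
      then show ?thesis
        unfolding \<psi>_def has_field_derivative_def K_def .
    qed
    then show "(\<lambda>s. \<psi> s $ i) holomorphic_on ball s0 r"
      unfolding holomorphic_on_open[OF open_ball] by blast
  qed
qed

lemma torus_open: "open (torus :: (complex^'n::finite) set)"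
proof -
  have "torus = (\<Inter>i\<in>UNIV. {z :: complex^'n. z $ i \<noteq> 0})" by (auto simp: torus_def)
  also have "open \<dots>" by (intro open_INT finite ballI open_Collect_neq continuous_intros)
  finally show ?thesis .
qed

lemma torus_borel [measurable]: "torus \<in> sets borel"
  by (rule borel_open[OF torus_open])

text \<open>Confinement to the compact set \<open>L\<close> makes the zeros at \<open>s0\<close>
  finite in number and lets none leave or enter: on the part of \<open>L\<close> outside the
  neighbourhoods of the branches, the pencil stays nonzero for nearby \<open>s\<close>. The sum
  therefore runs over a fixed finite set of holomorphic branches.\<close>

lemma residue_sum_holomorphic:
  fixes F p :: "'n::finite \<Rightarrow> complex^'n \<Rightarrow> complex"
  assumes F: "\<And>j. F j \<in> vec_algebra" and p: "\<And>j. p j \<in> vec_algebra" and Q: "Q \<in> vec_algebra"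
    and L: "compact L" "L \<subseteq> torus" and r0: "r0 > 0"
    and inL: "\<And>s z. s \<in> ball s0 r0 \<Longrightarrow> z \<in> torus \<Longrightarrow> pencil F p s z = 0 \<Longrightarrow> z \<in> L"
    and nondeg: "\<And>z. z \<in> torus \<Longrightarrow> pencil F p s0 z = 0 \<Longrightarrow> det (pencil_jac F p s0 z) \<noteq> 0"
  shows "finite {z \<in> torus. pencil F p s0 z = 0}"
    and "\<exists>r>0. (\<lambda>s. \<Sum>z\<in>{z \<in> torus. pencil F p s z = 0}. Q z / (\<Prod>i\<in>UNIV. z $ i) / det (pencil_jac F p s z))
            holomorphic_on ball s0 r"
proof -
  define Z where "Z s = {z \<in> torus. pencil F p s z = 0}" for s
  have cont: "continuous_on S (pencil F p s)" for S s
    unfolding pencil_def by (intro continuous_on_vec_lambda continuous_intros vec_algebra_continuous_on F p)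
  have Z0: "Z s0 = L \<inter> {z. pencil F p s0 z = 0}"
    using inL[of s0] r0 L(2) by (auto simp: Z_def)
  have "closed {z. pencil F p s0 z = 0}" by (intro closed_Collect_eq cont continuous_on_const)
  then have cZ: "compact (Z s0)" unfolding Z0 by (rule compact_Int_closed[OF L(1)])
  have "\<exists>V. open V \<and> z \<in> V \<and> V \<inter> Z s0 = {z}" if "z \<in> Z s0" for z
  proof -
    have z: "pencil F p s0 z = 0" "det (pencil_jac F p s0 z) \<noteq> 0" using that nondeg by (auto simp: Z_def)
    obtain r V \<psi> where b: "r > 0" "open V" "z \<in> V"
      "\<And>s. s \<in> ball s0 r \<Longrightarrow> \<psi> s \<in> V \<and> det (pencil_jac F p s (\<psi> s)) \<noteq> 0 \<and> (\<forall>z\<in>V. pencil F p s z = 0 \<longleftrightarrow> z = \<psi> s)"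
      by (rule zero_branch[OF F p z open_UNIV UNIV_I]) (rule that)
    have "\<forall>z\<in>V. pencil F p s0 z = 0 \<longleftrightarrow> z = \<psi> s0" using b(4)[of s0] b(1) by simp
    then have "V \<inter> Z s0 = {z}" using b(3) z that by (auto simp: Z_def)
    then show ?thesis using b by blast
  qed
  then obtain W where W: "\<And>z. z \<in> Z s0 \<Longrightarrow> open (W z) \<and> z \<in> W z \<and> W z \<inter> Z s0 = {z}" by metis
  obtain C where C: "C \<subseteq> Z s0" "finite C" "Z s0 \<subseteq> (\<Union>z\<in>C. W z)"
    using compactE_image[OF cZ, of "Z s0" W] W by blast
  have "Z s0 \<subseteq> C"
  proof
    fix x assume x: "x \<in> Z s0"
    then obtain z where z: "z \<in> C" "x \<in> W z" using C(3) by blast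
    then have "W z \<inter> Z s0 = {z}" using W[of z] C(1) by auto
    then show "x \<in> C" using z x by auto
  qed
  then have fin: "finite (Z s0)" using C(2) finite_subset by blast
  then show "finite {z \<in> torus. pencil F p s0 z = 0}" by (simp add: Z_def)
  obtain d where d: "\<And>z. d z > 0" "\<And>z x. x \<in> Z s0 \<Longrightarrow> x \<noteq> z \<Longrightarrow> d z \<le> dist z x"
    using finite_set_avoid[OF fin] by metis
  define Br where "Br z r V \<psi> \<longleftrightarrow> r > 0 \<and> open V \<and> V \<subseteq> ball z (d z / 2) \<inter> torus \<and> z \<in> V \<and>
      (\<forall>i. (\<lambda>s. \<psi> s $ i) holomorphic_on ball s0 r) \<and>
      (\<forall>s\<in>ball s0 r. \<psi> s \<in> V \<and> det (pencil_jac F p s (\<psi> s)) \<noteq> 0 \<and> (\<forall>z\<in>V. pencil F p s z = 0 \<longleftrightarrow> z = \<psi> s))"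
    for z r V \<psi>
  have "\<exists>r V \<psi>. Br z r V \<psi>"
    if "z \<in> Z s0" for z
  proof -
    have z: "pencil F p s0 z = 0" "det (pencil_jac F p s0 z) \<noteq> 0" using that nondeg by (auto simp: Z_def)
    have U: "open (ball z (d z / 2) \<inter> torus)" "z \<in> ball z (d z / 2) \<inter> torus"
      using torus_open d that by (auto simp: Z_def)
    show ?thesis unfolding Br_def by (rule zero_branch[OF F p z U]) blast
  qed
  then obtain r V \<psi> where "\<And>z. z \<in> Z s0 \<Longrightarrow> Br z (r z) (V z) (\<psi> z)" by metis
  then have b: "z \<in> Z s0 \<Longrightarrow> r z > 0 \<and> open (V z) \<and> V z \<subseteq> ball z (d z / 2) \<inter> torus \<and> z \<in> V z \<and>
      (\<forall>i. (\<lambda>s. \<psi> z s $ i) holomorphic_on ball s0 (r z)) \<and>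
      (\<forall>s\<in>ball s0 (r z). \<psi> z s \<in> V z \<and> det (pencil_jac F p s (\<psi> z s)) \<noteq> 0 \<and> (\<forall>x\<in>V z. pencil F p s x = 0 \<longleftrightarrow> x = \<psi> z s))" for z
    unfolding Br_def .
  have rpos: "r z > 0" and Vopen: "open (V z)" and Vball: "V z \<subseteq> ball z (d z / 2)" and Vtor: "V z \<subseteq> torus" and zV: "z \<in> V z"
    if "z \<in> Z s0" for z
    using b[OF that] by simp_all
  have disj: "z = z'" if "z \<in> Z s0" "z' \<in> Z s0" "x \<in> V z" "x \<in> V z'" for z z' x
  proof (rule ccontr)
    assume ne: "z \<noteq> z'"
    have "dist z x < d z / 2" "dist z' x < d z' / 2"
      using Vball[OF that(1)] Vball[OF that(2)] that(3,4) by auto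
    moreover have "dist z z' \<le> dist z x + dist z' x" by (metis dist_commute dist_triangle)
    moreover have "d z \<le> dist z z'" "d z' \<le> dist z z'" using d(2)[of z' z] d(2)[of z z'] ne that by (auto simp: dist_commute)
    ultimately show False by linarith
  qed
  define K where "K = L - (\<Union>z\<in>Z s0. V z)"
  have "open (\<Union>z\<in>Z s0. V z)" using Vopen by auto
  then have cK: "compact K" unfolding K_def using L(1) by (intro compact_diff)
  have Kne: "pencil F p s0 z \<noteq> 0" if "z \<in> K" for z
  proof
    assume "pencil F p s0 z = 0"
    then have "z \<in> Z s0" using that L(2) by (auto simp: Z_def K_def)
    then show False using zV that by (auto simp: K_def)
  qed
  obtain r1 where r1: "r1 > 0" "\<And>s z. s \<in> ball s0 r1 \<Longrightarrow> z \<in> K \<Longrightarrow> pencil F p s z \<noteq> 0"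
  proof (cases "K = {}")
    case True
    then show ?thesis using that[of 1] by simp
  next
    case False
    obtain x where x: "x \<in> K" "\<And>z. z \<in> K \<Longrightarrow> norm (pencil F p s0 x) \<le> norm (pencil F p s0 z)"
      using continuous_attains_inf[OF cK False continuous_on_norm[OF cont[of K s0]]] by blast
    have cp: "continuous_on K (\<lambda>z. \<chi> j. p j z)"
      by (intro continuous_on_vec_lambda vec_algebra_continuous_on p)
    obtain y where y: "\<And>z. z \<in> K \<Longrightarrow> norm (\<chi> j. p j z) \<le> norm (\<chi> j. p j y)"
      using continuous_attains_sup[OF cK False continuous_on_norm[OF cp]] by blast
    \<comment> \<open>On \<open>K\<close> the pencil at \<open>s0\<close> has norm at least
      \<open>a\<close>, and passing to \<open>s\<close> changes it by at most
      \<open>norm (s - s0) * M\<close>; the radius \<open>a / (M + 1)\<close> keeps this change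
      below \<open>a\<close>.\<close>
    define a where "a = norm (pencil F p s0 x)"
    define M where "M = norm (\<chi> j. p j y)"
    have a: "a > 0" using Kne[OF x(1)] by (simp add: a_def)
    have M: "M \<ge> 0" by (simp add: M_def)
    show ?thesis
    proof (rule that[of "a / (M + 1)"])
      show "a / (M + 1) > 0" using a M by simp
      fix s z assume s: "s \<in> ball s0 (a / (M + 1))" and z: "z \<in> K"
      show "pencil F p s z \<noteq> 0"
      proof
        assume 0: "pencil F p s z = 0"
        have "pencil F p s0 z = pencil F p s0 z - pencil F p s z" using 0 by simp
        also have "\<dots> = (\<chi> j. (s - s0) * p j z)" by (simp add: pencil_def vec_eq_iff algebra_simps)
        finally have "norm (pencil F p s0 z) = norm (s - s0) * norm (\<chi> j. p j z)"
          by (simp add: norm_vec_def norm_mult L2_set_right_distrib)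
        also have "\<dots> \<le> norm (s - s0) * M" using y[OF z] by (intro mult_left_mono) (auto simp: M_def)
        also have "\<dots> \<le> a / (M + 1) * M" using s M by (intro mult_right_mono) (auto simp: dist_norm norm_minus_commute)
        also have "\<dots> < a" using a M by (simp add: field_simps)
        finally show False using x(2)[OF z] by (simp add: a_def)
      qed
    qed
  qed
  define R where "R = Min (insert r0 (insert r1 (r ` Z s0)))"
  have R: "R > 0" "R \<le> r0" "R \<le> r1" "\<And>z. z \<in> Z s0 \<Longrightarrow> R \<le> r z"
    using fin r0 r1(1) rpos unfolding R_def by (auto intro!: Min_le simp del: Min_insert)
  have Zs: "Z s = (\<lambda>z. \<psi> z s) ` Z s0" "inj_on (\<lambda>z. \<psi> z s) (Z s0)" if s: "s \<in> ball s0 R" for s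
  proof -
    have sr: "s \<in> ball s0 r0" "s \<in> ball s0 r1" "\<And>z. z \<in> Z s0 \<Longrightarrow> s \<in> ball s0 (r z)"
      using s R(2,3) R(4) by (force simp: mem_ball)+
    have V: "\<psi> z s \<in> V z" "pencil F p s (\<psi> z s) = 0" "\<psi> z s \<in> torus" if "z \<in> Z s0" for z
      using b[OF that] sr(3)[OF that] Vtor[OF that] by auto
    show "Z s = (\<lambda>z. \<psi> z s) ` Z s0"
    proof
      show "(\<lambda>z. \<psi> z s) ` Z s0 \<subseteq> Z s" using V by (auto simp: Z_def)
      show "Z s \<subseteq> (\<lambda>z. \<psi> z s) ` Z s0"
      proof
        fix x assume x: "x \<in> Z s"
        then have "x \<in> L" using inL sr(1) by (auto simp: Z_def)
        moreover have "x \<notin> K" using r1(2)[OF sr(2)] x by (auto simp: Z_def)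
        ultimately obtain z where z: "z \<in> Z s0" "x \<in> V z" by (auto simp: K_def)
        then have "x = \<psi> z s" using b[OF z(1)] sr(3)[OF z(1)] x by (auto simp: Z_def)
        then show "x \<in> (\<lambda>z. \<psi> z s) ` Z s0" using z by blast
      qed
    qed
    show "inj_on (\<lambda>z. \<psi> z s) (Z s0)"
    proof (rule inj_onI)
      fix z z' assume z: "z \<in> Z s0" "z' \<in> Z s0" "\<psi> z s = \<psi> z' s"
      show "z = z'" by (rule disj[OF z(1,2) V(1)[OF z(1)]]) (use V(1)[OF z(2)] z(3) in simp)
    qed
  qed
  have hol: "(\<lambda>s. f (\<psi> z s)) holomorphic_on ball s0 R" if "f \<in> vec_algebra" "z \<in> Z s0" for f z
    by (rule vec_algebra_holomorphic[OF that(1)])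
       (use b[OF that(2)] in \<open>auto intro: holomorphic_on_subset[OF _ subset_ball[OF R(4)[OF that(2)]]]\<close>)
  have nz: "\<psi> z s \<in> torus" "det (pencil_jac F p s (\<psi> z s)) \<noteq> 0" if "z \<in> Z s0" "s \<in> ball s0 R" for z s
  proof -
    have "s \<in> ball s0 (r z)" using that R(4)[OF that(1)] by auto
    then show "\<psi> z s \<in> torus" "det (pencil_jac F p s (\<psi> z s)) \<noteq> 0" using b[OF that(1)] Vtor[OF that(1)] by auto
  qed
  have pz: "(\<Prod>i\<in>UNIV. \<psi> z s $ i) \<noteq> 0" if "z \<in> Z s0" "s \<in> ball s0 R" for z s
    using nz(1)[OF that] by (simp add: torus_def)
  have "(\<lambda>s. \<Sum>z\<in>Z s0. Q (\<psi> z s) / (\<Prod>i\<in>UNIV. \<psi> z s $ i) / det (pencil_jac F p s (\<psi> z s))) holomorphic_on ball s0 R"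
  proof (rule holomorphic_on_sum)
    fix z assume z: "z \<in> Z s0"
    have "(\<lambda>s. det (pencil_jac F p s (\<psi> z s))) holomorphic_on ball s0 R"
      unfolding det_def pencil_jac_def
      by (simp, intro holomorphic_intros hol z vec_algebra_partial_deriv F p)
    moreover have "(\<lambda>s. \<Prod>i\<in>UNIV. \<psi> z s $ i) holomorphic_on ball s0 R"
      by (intro holomorphic_intros hol[OF vec_algebra_nth z])
    ultimately show "(\<lambda>s. Q (\<psi> z s) / (\<Prod>i\<in>UNIV. \<psi> z s $ i) / det (pencil_jac F p s (\<psi> z s))) holomorphic_on ball s0 R"
      using pz[OF z] nz(2)[OF z] by (intro holomorphic_on_divide hol[OF Q z]) auto
  qed
  moreover have "(\<Sum>z\<in>Z s0. Q (\<psi> z s) / (\<Prod>i\<in>UNIV. \<psi> z s $ i) / det (pencil_jac F p s (\<psi> z s)))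
     = (\<Sum>z\<in>Z s. Q z / (\<Prod>i\<in>UNIV. z $ i) / det (pencil_jac F p s z))" if "s \<in> ball s0 R" for s
    unfolding Zs(1)[OF that] by (simp add: sum.reindex[OF Zs(2)[OF that]] o_def)
  ultimately have "(\<lambda>s. \<Sum>z\<in>Z s. Q z / (\<Prod>i\<in>UNIV. z $ i) / det (pencil_jac F p s z)) holomorphic_on ball s0 R"
    by (rule holomorphic_transform)
  then show "\<exists>r>0. (\<lambda>s. \<Sum>z\<in>{z \<in> torus. pencil F p s z = 0}. Q z / (\<Prod>i\<in>UNIV. z $ i) / det (pencil_jac F p s z))
            holomorphic_on ball s0 r"
    using R(1) unfolding Z_def by blast
qed

section \<open>Deformations of a polynomial system\<close>

text \<open>The exceptional set consists of the roots of the highest coefficient that is not the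
  zero polynomial. Away from it this coefficient is bounded below by \<open>a\<close> near
  \<open>s0\<close>, and Cauchy's root bound \<open>1 + C / a\<close> applies.\<close>

lemma root_bound_off_finite:
  fixes P :: "nat \<Rightarrow> complex poly"
  assumes "k1 \<le> K" "P k1 \<noteq> 0"
  obtains S where "finite S"
    "\<And>s. s \<notin> S \<Longrightarrow> \<exists>k\<le>K. poly (P k) s \<noteq> 0"
    "\<And>s0. s0 \<notin> S \<Longrightarrow> \<exists>r>0. \<exists>B>0. \<forall>s\<in>ball s0 r. \<forall>t. (\<Sum>k\<le>K. poly (P k) s * t ^ k) = 0 \<longrightarrow> norm t \<le> B"
proof -
  define k0 where "k0 = (GREATEST k. k \<le> K \<and> P k \<noteq> 0)"
  have k0: "k0 \<le> K \<and> P k0 \<noteq> 0"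
    unfolding k0_def by (rule GreatestI_nat[of _ k1 K]) (use assms in auto)
  have above: "P k = 0" if "k0 < k" "k \<le> K" for k
    using Greatest_le_nat[of "\<lambda>k. k \<le> K \<and> P k \<noteq> 0" k K] that unfolding k0_def[symmetric] by force
  show ?thesis
  proof (rule that[of "{s. poly (P k0) s = 0}"])
    show "finite {s. poly (P k0) s = 0}" using k0 by (intro poly_roots_finite) auto
    show "\<exists>k\<le>K. poly (P k) s \<noteq> 0" if "s \<notin> {s. poly (P k0) s = 0}" for s using that k0 by auto
    fix s0 assume "s0 \<notin> {s. poly (P k0) s = 0}"
    then have nz: "poly (P k0) s0 \<noteq> 0" by simp
    define a where "a = norm (poly (P k0) s0) / 2"
    have a: "a > 0" using nz by (simp add: a_def)
    have "isCont (\<lambda>s. norm (poly (P k0) s)) s0" by (intro continuous_intros)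
    then have "eventually (\<lambda>s. norm (poly (P k0) s) > a) (at s0)"
      using nz by (intro order_tendstoD(1)[of _ "norm (poly (P k0) s0)"]) (auto simp: isCont_def a_def)
    then have "eventually (\<lambda>s. norm (poly (P k0) s) > a) (nhds s0)"
      using nz by (simp add: eventually_nhds_conv_at a_def)
    then obtain r where r: "r > 0" "\<And>s. dist s s0 < r \<Longrightarrow> norm (poly (P k0) s) > a"
      unfolding eventually_nhds_metric by blast
    have "\<exists>b. \<forall>s\<in>cball s0 r. norm (poly (P k) s) \<le> b" for k
    proof -
      have "compact ((\<lambda>s. poly (P k) s) ` cball s0 r)"
        by (intro compact_continuous_image continuous_intros) auto
      then show ?thesis using compact_imp_bounded bounded_iff by (metis image_eqI)
    qed
    then obtain b where b: "\<And>k s. s \<in> cball s0 r \<Longrightarrow> norm (poly (P k) s) \<le> b k" by metis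
    define C where "C = (\<Sum>k<k0. b k)"
    have bpos: "b k \<ge> 0" for k using b[of s0 k] r(1) norm_ge_zero order_trans by (metis centre_in_cball less_imp_le)
    have C: "C \<ge> 0" unfolding C_def by (intro sum_nonneg bpos)
    show "\<exists>r>0. \<exists>B>0. \<forall>s\<in>ball s0 r. \<forall>t. (\<Sum>k\<le>K. poly (P k) s * t ^ k) = 0 \<longrightarrow> norm t \<le> B"
    proof (rule exI[of _ r], intro conjI exI[of _ "1 + C / a"] ballI allI impI)
      show "r > 0" "1 + C / a > 0" using r a C by (auto intro: add_pos_nonneg)
      fix s t assume s: "s \<in> ball s0 r" and rel: "(\<Sum>k\<le>K. poly (P k) s * t ^ k) = 0"
      show "norm t \<le> 1 + C / a"
      proof (rule ccontr)
        assume "\<not> ?thesis"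
        then have t: "norm t > 1 + C / a" by simp
        have t1: "norm t \<ge> 1" using t C a by (smt (verit) divide_nonneg_pos)
        have "(\<Sum>k\<le>K. poly (P k) s * t ^ k) = (\<Sum>k\<le>k0. poly (P k) s * t ^ k)"
          by (rule sum.mono_neutral_right) (use k0 above in auto)
        also have "\<dots> = (\<Sum>k<k0. poly (P k) s * t ^ k) + poly (P k0) s * t ^ k0"
          by (simp flip: lessThan_Suc_atMost)
        finally have "poly (P k0) s * t ^ k0 = - (\<Sum>k<k0. poly (P k) s * t ^ k)"
          using rel by (simp add: eq_neg_iff_add_eq_0 add.commute)
        then have "norm (poly (P k0) s) * norm t ^ k0 = norm (\<Sum>k<k0. poly (P k) s * t ^ k)"
          by (metis norm_minus_cancel norm_mult norm_power)
        also have "\<dots> \<le> (\<Sum>k<k0. b k * norm t ^ (k0 - 1))"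
        proof (rule sum_norm_le)
          fix k assume k: "k \<in> {..<k0}"
          have "norm t ^ k \<le> norm t ^ (k0 - 1)" using t1 k by (intro power_increasing) auto
          then show "norm (poly (P k) s * t ^ k) \<le> b k * norm t ^ (k0 - 1)"
            using b[of s k] s bpos by (auto simp: norm_mult norm_power intro!: mult_mono)
        qed
        also have "\<dots> = C * norm t ^ (k0 - 1)" by (simp add: C_def sum_distrib_right)
        finally have 1: "norm (poly (P k0) s) * norm t ^ k0 \<le> C * norm t ^ (k0 - 1)" .
        have 2: "a < norm (poly (P k0) s)" using r(2)[of s] s by (simp add: dist_commute)
        show False
        proof (cases k0)
          case 0
          then show ?thesis using 1 2 a by (simp add: C_def)
        next
          case (Suc k)
          have tp: "norm t ^ k > 0" using t1 by (intro zero_less_power) linarith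
          have "norm (poly (P k0) s) * norm t * norm t ^ k \<le> C * norm t ^ k" using 1 Suc by (simp add: mult_ac)
          then have "norm (poly (P k0) s) * norm t \<le> C" using tp by simp
          moreover have "a * norm t < norm (poly (P k0) s) * norm t" using 2 t1 by (intro mult_strict_right_mono) auto
          moreover have "a * norm t > C" using t a by (simp add: field_simps)
          ultimately show False by linarith
        qed
      qed
    qed
  qed
qed

lemma compact_torus_box:
  fixes B :: real
  assumes "B > 0"
  shows "compact {z :: complex^'n::finite. \<forall>i. norm (z $ i) \<le> B \<and> 1 / B \<le> norm (z $ i)}"
    and "{z :: complex^'n. \<forall>i. norm (z $ i) \<le> B \<and> 1 / B \<le> norm (z $ i)} \<subseteq> torus"
proof -
  let ?L = "{z :: complex^'n. \<forall>i. norm (z $ i) \<le> B \<and> 1 / B \<le> norm (z $ i)}"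
  have "?L = (\<Inter>i. {z. norm (z $ i) \<le> B} \<inter> {z. 1 / B \<le> norm (z $ i)})" by auto
  also have "closed \<dots>" by (intro closed_INT ballI closed_Int closed_Collect_le continuous_intros)
  finally have "closed ?L" .
  moreover have "bounded ?L"
  proof (rule boundedI)
    fix z assume "z \<in> ?L"
    then have "(\<Sum>i\<in>UNIV. norm (z $ i)) \<le> (\<Sum>i\<in>(UNIV::'n set). B)" by (intro sum_mono) auto
    then show "norm z \<le> real CARD('n) * B" using norm_le_sum_components[of z] by simp
  qed
  ultimately show "compact ?L" by (simp add: compact_eq_bounded_closed)
  show "?L \<subseteq> torus"
  proof
    fix z assume z: "z \<in> ?L"
    have "norm (z $ i) > 0" for i using z assms by (smt (verit) mem_Collect_eq zero_less_divide_1_iff)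
    then show "z \<in> torus" by (auto simp: torus_def)
  qed
qed

section \<open>The family of perturbed systems and its incidence variety\<close>

locale deformation =
  fixes F :: "'n::finite \<Rightarrow> complex^'n \<Rightarrow> complex"
    and P :: "nat \<Rightarrow> 'n \<Rightarrow> complex^'n \<Rightarrow> complex"
    and Q :: "complex^'n \<Rightarrow> complex"
    and m :: nat
  assumes F_alg: "\<And>j. F j \<in> vec_algebra" and P_alg: "\<And>\<nu> j. P \<nu> j \<in> vec_algebra"
    and Q_alg: "Q \<in> vec_algebra" and m_pos: "m > 0"
    and P_nonzero: "\<And>\<nu> j z. z \<in> torus \<Longrightarrow> P \<nu> j z \<noteq> 0"
begin

definition dir :: "(nat \<Rightarrow> complex^'n) \<Rightarrow> 'n \<Rightarrow> complex^'n \<Rightarrow> complex" where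
  "dir w j z = (\<Sum>\<nu><m. w \<nu> $ j * P \<nu> j z)"

definition zeros :: "(nat \<Rightarrow> complex^'n) \<Rightarrow> complex \<Rightarrow> (complex^'n) set" where
  "zeros w s = {z \<in> torus. pencil F (dir w) s z = 0}"

abbreviation jac :: "(nat \<Rightarrow> complex^'n) \<Rightarrow> complex \<Rightarrow> complex^'n \<Rightarrow> complex" where
  "jac w s z \<equiv> det (pencil_jac F (dir w) s z)"

text \<open>Only the products of \<open>s\<close> with \<open>w\<close> enter the equations, so
  relations valid for all parameters \<open>u\<close> can be restricted to the complex line through
  \<open>w\<close>.\<close>

definition smul :: "complex \<Rightarrow> (nat \<Rightarrow> complex^'n) \<Rightarrow> nat \<Rightarrow> complex^'n" where
  "smul s w \<nu> = (\<chi> j. s * w \<nu> $ j)"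

definition residue_sum :: "(nat \<Rightarrow> complex^'n) \<Rightarrow> complex \<Rightarrow> complex" where
  "residue_sum w s = (\<Sum>z\<in>zeros w s. Q z / (\<Prod>i\<in>UNIV. z $ i) / jac w s z)"

lemma dir_alg: "dir w j \<in> vec_algebra"
  unfolding dir_def by (intro vec_algebra_intros P_alg)

lemma partial_deriv_dir: "partial_deriv k (dir w j) z = (\<Sum>\<nu><m. w \<nu> $ j * partial_deriv k (P \<nu> j) z)"
proof (rule partial_deriv_eq)
  have "(dir w j has_derivative (\<lambda>h. \<Sum>\<nu><m. w \<nu> $ j * (\<Sum>k\<in>UNIV. h $ k * partial_deriv k (P \<nu> j) z))) (at z)"
    unfolding dir_def by (intro has_derivative_sum has_derivative_mult_right vec_algebra_partial_deriv P_alg)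
  moreover have "(\<Sum>\<nu><m. w \<nu> $ j * (\<Sum>k\<in>UNIV. h $ k * partial_deriv k (P \<nu> j) z))
      = (\<Sum>k\<in>UNIV. h $ k * (\<Sum>\<nu><m. w \<nu> $ j * partial_deriv k (P \<nu> j) z))" for h :: "complex^'n"
    unfolding sum_distrib_left by (subst sum.swap) (simp add: mult_ac)
  ultimately show "(dir w j has_derivative (\<lambda>h. \<Sum>k\<in>UNIV. h $ k * (\<Sum>\<nu><m. w \<nu> $ j * partial_deriv k (P \<nu> j) z))) (at z)"
    by simp
qed

lemma zeros_iff:
  "z \<in> zeros w s \<longleftrightarrow> z \<in> torus \<and> (\<forall>j. F j z = (\<Sum>\<nu><m. smul s w \<nu> $ j * P \<nu> j z))"
  by (simp add: zeros_def pencil_def vec_eq_iff dir_def smul_def sum_distrib_left mult.assoc)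

text \<open>
  The incidence variety of pairs \<open>(u, z)\<close> is a graph over the coordinates \<open>z\<close> and \<open>u\<^sub>\<nu>\<close> for \<open>\<nu> \<ge> 1\<close>:
  its equations can be solved for \<open>u\<^sub>0\<close> because \<open>P\<^sub>0\<^sub>j\<close> has no zeros on the torus. Here \<open>X\<close> indexes these
  coordinates and \<open>num l / pivot_prod\<close> is the coordinate \<open>l\<close> of \<open>u\<close> as a function of them.
\<close>
definition X :: "('n + nat \<times> 'n) set" where
  "X = range Inl \<union> Inr ` ({1..<m} \<times> UNIV)"

definition Y :: "(nat \<times> 'n) set" where
  "Y = {..<m} \<times> UNIV"

definition zx :: "('n + nat \<times> 'n \<Rightarrow> complex) \<Rightarrow> complex^'n" where
  "zx x = (\<chi> i. x (Inl i))"

definition pt :: "(nat \<Rightarrow> complex^'n) \<Rightarrow> complex^'n \<Rightarrow> 'n + nat \<times> 'n \<Rightarrow> complex" where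
  "pt u z v = (case v of Inl i \<Rightarrow> z $ i | Inr l \<Rightarrow> flatten u l)"

definition pivot_prod :: "('n + nat \<times> 'n \<Rightarrow> complex) \<Rightarrow> complex" where
  "pivot_prod x = (\<Prod>j\<in>UNIV. P 0 j (zx x))"

definition rest :: "'n \<Rightarrow> ('n + nat \<times> 'n \<Rightarrow> complex) \<Rightarrow> complex" where
  "rest j x = F j (zx x) - (\<Sum>\<nu>\<in>{1..<m}. x (Inr (\<nu>, j)) * P \<nu> j (zx x))"

definition num :: "nat \<times> 'n \<Rightarrow> ('n + nat \<times> 'n \<Rightarrow> complex) \<Rightarrow> complex" where
  "num l x = (if fst l = 0 then rest (snd l) x * (\<Prod>j\<in>UNIV - {snd l}. P 0 j (zx x)) else x (Inr l) * pivot_prod x)"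

text \<open>The variety has n + (m - 1) n = m n free coordinates, as many as there are parameters.
  This is the dimension count that makes functions on it algebraic over the parameters.\<close>

lemma card_XY: "finite X" "finite Y" "card X \<le> card Y"
proof -
  show "finite X" "finite Y" by (auto simp: X_def Y_def)
  have "card X \<le> card (range (Inl :: 'n \<Rightarrow> 'n + nat \<times> 'n)) + card (Inr ` ({1..<m} \<times> (UNIV::'n set)) :: ('n + nat \<times> 'n) set)"
    unfolding X_def by (rule card_Un_le)
  also have "\<dots> = CARD('n) + (m - 1) * CARD('n)"
    by (simp add: card_image card_cartesian_product)
  also have "\<dots> = card Y" using m_pos by (simp add: Y_def card_cartesian_product mult_eq_if)
  finally show "card X \<le> card Y" .
qed

lemma coord_alg: "v \<in> X \<Longrightarrow> (\<lambda>x. x v) \<in> gen_algebra (coords X)"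
  by (rule gen_algebra.gen) (simp add: coords_def)

lemma Inl_X: "Inl i \<in> X" and Inr_X: "1 \<le> \<nu> \<Longrightarrow> \<nu> < m \<Longrightarrow> Inr (\<nu>, j) \<in> X"
  by (auto simp: X_def)

lemma zx_alg: "f \<in> vec_algebra \<Longrightarrow> (\<lambda>x. f (zx x)) \<in> gen_algebra (coords X)"
  unfolding vec_algebra_def
  by (erule gen_algebra_compose) (auto simp: zx_def intro!: coord_alg Inl_X)

lemma rest_alg: "rest j \<in> gen_algebra (coords X)"
  unfolding rest_def[abs_def]
  by (intro gen_algebra_intros zx_alg F_alg P_alg coord_alg Inr_X) auto

lemma pivot_prod_alg: "pivot_prod \<in> gen_algebra (coords X)"
  unfolding pivot_prod_def[abs_def] by (intro gen_algebra_intros zx_alg P_alg)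

lemma num_alg: "l \<in> Y \<Longrightarrow> num l \<in> gen_algebra (coords X)"
  unfolding num_def[abs_def]
  by (cases "fst l = 0") (auto intro!: gen_algebra_intros zx_alg vec_algebra_intros P_alg rest_alg pivot_prod_alg coord_alg Inr_X simp: Y_def)

lemma zx_pt [simp]: "zx (pt u z) = z" by (simp add: zx_def pt_def vec_eq_iff)

lemma pivot_prod_nonzero: "z \<in> torus \<Longrightarrow> pivot_prod (pt u z) \<noteq> 0"
  by (simp add: pivot_prod_def P_nonzero)

lemma rest_eq:
  assumes "\<forall>j. F j z = (\<Sum>\<nu><m. u \<nu> $ j * P \<nu> j z)"
  shows "rest j (pt u z) = u 0 $ j * P 0 j z"
proof -
  have "{..<m} = insert 0 {1..<m}" using m_pos by auto
  then show ?thesis using assms by (simp add: rest_def pt_def flatten_def)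
qed

lemma num_over_pivot:
  assumes "z \<in> torus" "\<forall>j. F j z = (\<Sum>\<nu><m. u \<nu> $ j * P \<nu> j z)"
  shows "(\<lambda>l. num l (pt u z) / pivot_prod (pt u z)) = flatten u"
proof
  fix l :: "nat \<times> 'n"
  have pp: "pivot_prod (pt u z) = P 0 j z * (\<Prod>j\<in>UNIV - {j}. P 0 j z)" for j
    by (simp add: pivot_prod_def prod.remove[of UNIV j])
  show "num l (pt u z) / pivot_prod (pt u z) = flatten u l"
  proof (cases "fst l = 0")
    case True
    then have "num l (pt u z) = u 0 $ snd l * pivot_prod (pt u z)"
      by (simp add: num_def rest_eq[OF assms(2)] pp[of "snd l"])
    then show ?thesis using pivot_prod_nonzero[OF assms(1)] True by (cases l) (simp add: flatten_def)
  next
    case False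
    then show ?thesis using pivot_prod_nonzero[OF assms(1)] by (simp add: num_def pt_def)
  qed
qed

text \<open>At a zero of a perturbed system the fractions \<open>num l / pivot_prod\<close> evaluate
  to the parameters, so the abstract relation among fractions becomes one with coefficients in the
  parameters, valid at all zeros of all systems.\<close>

lemma incidence_relation:
  assumes "T \<in> gen_algebra (coords X)" "T x0 \<noteq> 0"
  obtains K c where "\<And>k. c k \<in> gen_algebra (coords Y)" "\<exists>y. c 0 y \<noteq> 0"
    "\<And>w s z. z \<in> zeros w s \<Longrightarrow>
        (\<Sum>k\<le>K. c k (flatten (smul s w)) * (T (pt (smul s w) z) / pivot_prod (pt (smul s w) z)) ^ k) = 0"
proof -
  obtain K c where c: "\<And>k. c k \<in> gen_algebra (coords Y)" "\<exists>y. c 0 y \<noteq> 0"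
    "\<And>x. pivot_prod x \<noteq> 0 \<Longrightarrow> (\<Sum>k\<le>K. c k (\<lambda>l. num l x / pivot_prod x) * (T x / pivot_prod x) ^ k) = 0"
    by (rule algebraic_relation[OF card_XY pivot_prod_alg num_alg assms]) (assumption, rule that)
  show ?thesis
  proof (rule that[of c K])
    show "c k \<in> gen_algebra (coords Y)" for k by (rule c(1))
    show "\<exists>y. c 0 y \<noteq> 0" by (rule c(2))
    fix w s z assume z: "z \<in> zeros w s"
    then have "(\<lambda>l. num l (pt (smul s w) z) / pivot_prod (pt (smul s w) z)) = flatten (smul s w)"
      by (intro num_over_pivot) (auto simp: zeros_iff)
    moreover have "pivot_prod (pt (smul s w) z) \<noteq> 0"
      using z by (intro pivot_prod_nonzero) (auto simp: zeros_iff)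
    ultimately show "(\<Sum>k\<le>K. c k (flatten (smul s w)) * (T (pt (smul s w) z) / pivot_prod (pt (smul s w) z)) ^ k) = 0"
      using c(3)[of "pt (smul s w) z"] by simp
  qed
qed

text \<open>With \<open>T\<close> the coordinate times \<open>pivot_prod\<close>, the fraction
  \<open>T / pivot_prod\<close> is the coordinate itself; that \<open>T\<close> is not identically
  zero is tested where all coordinates of \<open>z\<close> are 1.\<close>

lemma coordinate_relation:
  obtains K c where "\<And>k. c k \<in> gen_algebra (coords Y)" "\<exists>y. c 0 y \<noteq> 0"
    "\<And>w s z. z \<in> zeros w s \<Longrightarrow> (\<Sum>k\<le>K. c k (flatten (smul s w)) * (z $ i) ^ k) = 0"
proof -
  define T where "T x = x (Inl i) * pivot_prod x" for x
  have T: "T \<in> gen_algebra (coords X)"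
    unfolding T_def[abs_def] by (intro gen_algebra_intros coord_alg pivot_prod_alg Inl_X)
  have one: "(\<chi> i. 1) \<in> (torus :: (complex^'n) set)" by (simp add: torus_def)
  have T0: "T (pt (\<lambda>_. 0) (\<chi> i. 1)) \<noteq> 0"
    using pivot_prod_nonzero[OF one] by (simp add: T_def pt_def)
  obtain K c where c: "\<And>k. c k \<in> gen_algebra (coords Y)" "\<exists>y. c 0 y \<noteq> 0"
    "\<And>w s z. z \<in> zeros w s \<Longrightarrow>
        (\<Sum>k\<le>K. c k (flatten (smul s w)) * (T (pt (smul s w) z) / pivot_prod (pt (smul s w) z)) ^ k) = 0"
    by (rule incidence_relation[OF T T0]) (rule that)
  show ?thesis
  proof (rule that[of c K])
    show "c k \<in> gen_algebra (coords Y)" for k by (rule c(1))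
    show "\<exists>y. c 0 y \<noteq> 0" by (rule c(2))
    fix w s z assume z: "z \<in> zeros w s"
    have "T (pt (smul s w) z) / pivot_prod (pt (smul s w) z) = z $ i"
      using z pivot_prod_nonzero[of z "smul s w"] by (simp add: T_def pt_def zeros_iff)
    then show "(\<Sum>k\<le>K. c k (flatten (smul s w)) * (z $ i) ^ k) = 0" using c(3)[OF z] by simp
  qed
qed

text \<open>Multiplying row \<open>j\<close> of the Jacobian matrix by \<open>P 0 j\<close> clears
  the denominator that arises from solving for \<open>u\<^sub>0\<close>, and multiplies the
  determinant by \<open>pivot_prod\<close>. The given nondegenerate zero shows that the result does
  not vanish identically.\<close>

lemma jacobian_relation:
  assumes "z0 \<in> zeros w0 0" "jac w0 0 z0 \<noteq> 0"
  obtains K c where "\<And>k. c k \<in> gen_algebra (coords Y)" "\<exists>y. c 0 y \<noteq> 0"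
    "\<And>w s z. z \<in> zeros w s \<Longrightarrow> (\<Sum>k\<le>K. c k (flatten (smul s w)) * (jac w s z) ^ k) = 0"
proof -
  define E where "E x = (\<chi> j k. P 0 j (zx x) * (partial_deriv k (F j) (zx x) -
      (\<Sum>\<nu>\<in>{1..<m}. x (Inr (\<nu>, j)) * partial_deriv k (P \<nu> j) (zx x))) - rest j x * partial_deriv k (P 0 j) (zx x))" for x
  define T where "T x = det (E x)" for x
  have "(\<lambda>x. E x $ j $ k) \<in> gen_algebra (coords X)" for j k
    unfolding E_def
    by (simp, intro gen_algebra_intros zx_alg vec_algebra_partial_deriv P_alg F_alg rest_alg coord_alg Inr_X) auto
  then have T: "T \<in> gen_algebra (coords X)"
    unfolding T_def[abs_def] det_def by (intro gen_algebra_intros)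
  have TJ: "T (pt (smul s w) z) = pivot_prod (pt (smul s w) z) * jac w s z" if z: "z \<in> zeros w s" for w s z
  proof -
    define u where "u = smul s w"
    have eq: "\<forall>j. F j z = (\<Sum>\<nu><m. u \<nu> $ j * P \<nu> j z)" using z by (simp add: zeros_iff u_def)
    have set: "{..<m} = insert 0 {1..<m}" using m_pos by auto
    have "E (pt u z) $ j $ k = P 0 j z * (partial_deriv k (F j) z - s * partial_deriv k (dir w j) z)" for j k
    proof -
      have "s * partial_deriv k (dir w j) z = (\<Sum>\<nu><m. u \<nu> $ j * partial_deriv k (P \<nu> j) z)"
        by (simp add: partial_deriv_dir u_def smul_def sum_distrib_left mult.assoc)
      also have "\<dots> = u 0 $ j * partial_deriv k (P 0 j) z + (\<Sum>\<nu>\<in>{1..<m}. u \<nu> $ j * partial_deriv k (P \<nu> j) z)"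
        unfolding set by simp
      finally show ?thesis
        by (simp add: E_def rest_eq[OF eq] pt_def flatten_def algebra_simps)
    qed
    then have "E (pt u z) = (\<chi> j. P 0 j z *s pencil_jac F (dir w) s z $ j)"
      by (simp add: vec_eq_iff pencil_jac_def)
    then have "T (pt u z) = (\<Prod>j\<in>UNIV. P 0 j z) * det (\<chi> j. pencil_jac F (dir w) s z $ j)"
      by (simp add: T_def det_rows_mul)
    then show ?thesis by (simp add: pivot_prod_def u_def)
  qed
  have T0: "T (pt (smul 0 w0) z0) \<noteq> 0"
    using TJ[OF assms(1)] assms(2) pivot_prod_nonzero[of z0] assms(1) by (simp add: zeros_iff)
  obtain K c where c: "\<And>k. c k \<in> gen_algebra (coords Y)" "\<exists>y. c 0 y \<noteq> 0"
    "\<And>w s z. z \<in> zeros w s \<Longrightarrow>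
        (\<Sum>k\<le>K. c k (flatten (smul s w)) * (T (pt (smul s w) z) / pivot_prod (pt (smul s w) z)) ^ k) = 0"
    by (rule incidence_relation[OF T T0]) (rule that)
  show ?thesis
  proof (rule that[of c K])
    show "c k \<in> gen_algebra (coords Y)" for k by (rule c(1))
    show "\<exists>y. c 0 y \<noteq> 0" by (rule c(2))
    fix w s z assume z: "z \<in> zeros w s"
    have "T (pt (smul s w) z) / pivot_prod (pt (smul s w) z) = jac w s z"
      using pivot_prod_nonzero[of z "smul s w"] z TJ[OF z] by (simp add: zeros_iff)
    then show "(\<Sum>k\<le>K. c k (flatten (smul s w)) * (jac w s z) ^ k) = 0" using c(3)[OF z] by simp
  qed
qed

lemma line_poly:
  assumes "c \<in> gen_algebra (coords Y)"
  obtains p where "\<And>s. c (flatten (smul s w)) = poly p s"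
proof -
  have "(\<lambda>s. c (flatten (smul s w))) \<in> gen_algebra {\<lambda>s. s}"
  proof (rule gen_algebra_compose[OF assms])
    fix g assume "g \<in> coords Y"
    then obtain \<nu> j where "g = (\<lambda>y. y (\<nu>, j))" by (auto simp: coords_def)
    then show "(\<lambda>s. g (flatten (smul s w))) \<in> gen_algebra {\<lambda>s. s}"
      using gen_algebra_affine[of 0 "w \<nu> $ j"] by (simp add: flatten_def smul_def)
  qed
  then show ?thesis using gen_algebra_poly that by (metis)
qed

lemma smul_one [simp]: "smul 1 w = w"
  by (simp add: smul_def vec_eq_iff fun_eq_iff)

end

lemma gen_algebra_cong:
  assumes "f \<in> gen_algebra C" "\<And>g. g \<in> C \<Longrightarrow> g x = g y"
  shows "f x = f y"
  using assms(1) by induction (auto simp: assms(2))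

section \<open>Behaviour along a generic line of parameters\<close>

context deformation
begin

text \<open>Confinement is asked in a whole neighbourhood of \<open>s0\<close>, nondegeneracy only
  at \<open>s0\<close>, from where it spreads along the branches of zeros.\<close>

definition good :: "(nat \<Rightarrow> complex^'n) \<Rightarrow> complex \<Rightarrow> bool" where
  "good w s0 \<longleftrightarrow> (\<exists>L r. compact L \<and> L \<subseteq> torus \<and> r > 0 \<and> (\<forall>s\<in>ball s0 r. zeros w s \<subseteq> L)) \<and>
     (\<forall>z\<in>zeros w s0. jac w s0 z \<noteq> 0)"

lemma good_holomorphic:
  assumes "good w s0"
  shows "finite (zeros w s0)" "\<exists>r>0. residue_sum w holomorphic_on ball s0 r"
proof -
  obtain L r where L: "compact L" "L \<subseteq> torus" "r > 0" "\<And>s. s \<in> ball s0 r \<Longrightarrow> zeros w s \<subseteq> L"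
    and nd: "\<And>z. z \<in> zeros w s0 \<Longrightarrow> jac w s0 z \<noteq> 0"
    using assms unfolding good_def by blast
  note * = residue_sum_holomorphic[where F = F and p = "dir w" and ?s0.0 = s0, OF F_alg dir_alg Q_alg L(1,2,3)]
  show "finite (zeros w s0)" unfolding zeros_def
    by (rule *(1)) (use L(4) nd in \<open>auto simp: zeros_def\<close>)
  show "\<exists>r>0. residue_sum w holomorphic_on ball s0 r" unfolding residue_sum_def[abs_def] zeros_def
    by (rule *(2)) (use L(4) nd in \<open>auto simp: zeros_def\<close>)
qed

text \<open>The constant coefficients are nonzero at \<open>s = 1\<close>, hence nonzero polynomials
  in \<open>s\<close>. Those of the coordinate relations keep coordinates away from 0 off finitely
  many \<open>s\<close>, that of the Jacobian relation excludes \<open>jac = 0\<close>, and the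
  degrees \<open>K i\<close> bound the number of zeros.\<close>

lemma generic_line:
  fixes w :: "nat \<Rightarrow> complex^'n"
  assumes rel: "\<And>i s z. z \<in> zeros w s \<Longrightarrow> (\<Sum>k\<le>K i. c i k (flatten (smul s w)) * (z $ i) ^ k) = 0"
    and relJ: "\<And>s z. z \<in> zeros w s \<Longrightarrow> (\<Sum>k\<le>KJ. cJ k (flatten (smul s w)) * (jac w s z) ^ k) = 0"
    and alg: "\<And>i k. c i k \<in> gen_algebra (coords Y)" "\<And>k. cJ k \<in> gen_algebra (coords Y)"
    and nz: "\<And>i. c i 0 (flatten w) \<noteq> 0" "cJ 0 (flatten w) \<noteq> 0"
  shows "\<exists>S. finite S \<and> (\<forall>s. s \<notin> S \<longrightarrow> good w s \<and> card (zeros w s) \<le> (\<Prod>i\<in>UNIV. K i))"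
proof -
  have "\<forall>i k. \<exists>p. \<forall>s. c i k (flatten (smul s w)) = poly p s" using line_poly[OF alg(1)] by metis
  then obtain p where p: "\<And>i k s. c i k (flatten (smul s w)) = poly (p i k) s" by metis
  obtain pJ where pJ: "\<And>s. cJ 0 (flatten (smul s w)) = poly pJ s" using line_poly[OF alg(2)] by metis
  have p0: "p i 0 \<noteq> 0" for i using nz(1)[of i] p[of i 0 1] by auto
  have pJ0: "pJ \<noteq> 0" using nz(2) pJ[of 1] by auto
  define ub where "ub P K s0 \<longleftrightarrow> (\<exists>r>0. \<exists>B>0. \<forall>s\<in>ball s0 r. \<forall>t. (\<Sum>k\<le>K. poly (P k) s * t ^ k) = 0 \<longrightarrow> norm t \<le> B)"
    for P :: "nat \<Rightarrow> complex poly" and K s0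
  have "\<exists>S. finite S \<and> (\<forall>s. s \<notin> S \<longrightarrow> (\<exists>k\<le>K i. poly (p i k) s \<noteq> 0) \<and> ub (p i) (K i) s)" for i
    by (rule root_bound_off_finite[of 0 "K i" "p i"]) (use p0 in \<open>auto simp: ub_def\<close>)
  then obtain S1 where S1: "\<And>i. finite (S1 i)" "\<And>i s. s \<notin> S1 i \<Longrightarrow> (\<exists>k\<le>K i. poly (p i k) s \<noteq> 0) \<and> ub (p i) (K i) s"
    by metis
  \<comment> \<open>The reversed polynomial has the inverse of the coordinate as a root; its
    coefficient of index \<open>K i\<close> is \<open>p i 0\<close>, which is not the zero
    polynomial.\<close>
  have "\<exists>S. finite S \<and> (\<forall>s. s \<notin> S \<longrightarrow> ub (\<lambda>k. p i (K i - k)) (K i) s)" for i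
    by (rule root_bound_off_finite[of "K i" "K i" "\<lambda>k. p i (K i - k)"]) (use p0 in \<open>auto simp: ub_def\<close>)
  then obtain S2 where S2: "\<And>i. finite (S2 i)" "\<And>i s. s \<notin> S2 i \<Longrightarrow> ub (\<lambda>k. p i (K i - k)) (K i) s"
    by metis
  define S where "S = (\<Union>i. S1 i \<union> S2 i) \<union> {s. poly pJ s = 0}"
  show ?thesis
  proof (intro exI[of _ S] conjI allI impI)
    show "finite S" unfolding S_def using S1(1) S2(1) poly_roots_finite[OF pJ0] by auto
    fix s0 assume s0: "s0 \<notin> S"
    have "ub (p i) (K i) s0" for i using S1(2)[of s0 i] s0 by (auto simp: S_def)
    then obtain r1 B1 where 1: "\<And>i. r1 i > 0" "\<And>i. B1 i > 0"
      "\<And>i s t. s \<in> ball s0 (r1 i) \<Longrightarrow> (\<Sum>k\<le>K i. poly (p i k) s * t ^ k) = 0 \<Longrightarrow> norm t \<le> B1 i"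
      unfolding ub_def by metis
    have "ub (\<lambda>k. p i (K i - k)) (K i) s0" for i using S2(2)[of s0 i] s0 by (auto simp: S_def)
    then obtain r2 B2 where 2: "\<And>i. r2 i > 0" "\<And>i. B2 i > 0"
      "\<And>i s t. s \<in> ball s0 (r2 i) \<Longrightarrow> (\<Sum>k\<le>K i. poly (p i (K i - k)) s * t ^ k) = 0 \<Longrightarrow> norm t \<le> B2 i"
      unfolding ub_def by metis
    define r where "r = Min (range r1 \<union> range r2)"
    have r: "r > 0" using 1(1) 2(1) by (auto simp: r_def)
    have rle: "r \<le> r1 i" "r \<le> r2 i" for i unfolding r_def by (auto intro!: Min_le)
    define B where "B = (\<Sum>i\<in>UNIV. B1 i + B2 i)"
    have Bge: "B1 i + B2 i \<le> B" for i
      unfolding B_def using 1(2) 2(2) by (intro member_le_sum[of i UNIV "\<lambda>i. B1 i + B2 i"]) (auto intro: add_nonneg_nonneg less_imp_le)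
    have B: "B > 0" using Bge[of undefined] 1(2)[of undefined] 2(2)[of undefined] by linarith
    let ?L = "{z :: complex^'n. \<forall>i. norm (z $ i) \<le> B \<and> 1 / B \<le> norm (z $ i)}"
    have "zeros w s \<subseteq> ?L" if s: "s \<in> ball s0 r" for s
    proof (intro subsetI CollectI allI)
      fix z i assume z: "z \<in> zeros w s"
      have zi: "z $ i \<noteq> 0" using z by (auto simp: zeros_def torus_def)
      have eq: "(\<Sum>k\<le>K i. poly (p i k) s * (z $ i) ^ k) = 0" using rel[OF z, of i] by (simp add: p)
      have "norm (z $ i) \<le> B1 i" by (rule 1(3)[OF _ eq]) (use s rle[of i] in auto)
      moreover have "(\<Sum>k\<le>K i. poly (p i (K i - k)) s * inverse (z $ i) ^ k) = 0"
      proof -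
        have "(\<Sum>k\<le>K i. poly (p i (K i - k)) s * inverse (z $ i) ^ k)
            = (\<Sum>k\<le>K i. poly (p i k) s * inverse (z $ i) ^ (K i - k))"
          by (rule sum.reindex_bij_witness[of _ "\<lambda>k. K i - k" "\<lambda>k. K i - k"]) auto
        also have "\<dots> = (\<Sum>k\<le>K i. inverse (z $ i) ^ K i * (poly (p i k) s * (z $ i) ^ k))"
        proof (rule sum.cong[OF refl])
          fix k assume "k \<in> {..K i}"
          then have "inverse (z $ i) ^ K i = inverse (z $ i) ^ (K i - k) * inverse (z $ i) ^ k"
            by (metis atMost_iff le_add_diff_inverse2 power_add)
          then show "poly (p i k) s * inverse (z $ i) ^ (K i - k) = inverse (z $ i) ^ K i * (poly (p i k) s * (z $ i) ^ k)"
            using zi by (simp add: power_inverse)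
        qed
        also have "\<dots> = 0" using eq by (simp flip: sum_distrib_left)
        finally show ?thesis .
      qed
      then have "norm (inverse (z $ i)) \<le> B2 i" by (rule 2(3)[rotated]) (use s rle[of i] in auto)
      then have "norm (inverse (z $ i)) \<le> B" using Bge[of i] 1(2)[of i] by linarith
      then have "1 / B \<le> norm (z $ i)" using zi B by (simp add: norm_inverse norm_divide field_simps)
      ultimately show "norm (z $ i) \<le> B \<and> 1 / B \<le> norm (z $ i)" using Bge[of i] 2(2)[of i] by linarith
    qed
    moreover have "jac w s0 z \<noteq> 0" if z: "z \<in> zeros w s0" for z
    proof
      assume "jac w s0 z = 0"
      then have "(\<Sum>k\<le>KJ. cJ k (flatten (smul s0 w)) * 0 ^ k) = 0" using relJ[OF z] by simp
      then have "cJ 0 (flatten (smul s0 w)) = 0" by (simp add: sum.atMost_shift)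
      then show False using s0 pJ by (simp add: S_def)
    qed
    ultimately show "good w s0"
      unfolding good_def using compact_torus_box[OF B, where ?'n = 'n] r by blast
    define R where "R i = {t. (\<Sum>k\<le>K i. poly (p i k) s0 * t ^ k) = 0}" for i
    have R: "finite (R i) \<and> card (R i) \<le> K i" for i
    proof -
      have "\<exists>k\<le>K i. poly (p i k) s0 \<noteq> 0" using S1(2)[of s0 i] s0 by (auto simp: S_def)
      then obtain k where "poly (p i k) s0 \<noteq> 0" "k \<le> K i" by blast
      then show ?thesis unfolding R_def using polyfun_rootbound[of "K i" "\<lambda>k. poly (p i k) s0"] by blast
    qed
    have inj: "inj_on (\<lambda>z i. z $ i) (zeros w s0)" by (auto simp: inj_on_def vec_eq_iff fun_eq_iff)
    have "(\<lambda>z i. z $ i) ` zeros w s0 \<subseteq> PiE UNIV R"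
      using rel by (auto simp: R_def p)
    then have "card (zeros w s0) \<le> card (PiE UNIV R)"
      using R by (intro card_inj_on_le[OF inj]) (auto intro!: finite_PiE)
    also have "\<dots> = (\<Prod>i\<in>UNIV. card (R i))" by (simp add: card_PiE)
    also have "\<dots> \<le> (\<Prod>i\<in>UNIV. K i)" using R by (intro prod_mono) auto
    finally show "card (zeros w s0) \<le> (\<Prod>i\<in>UNIV. K i)" .
  qed
qed

text \<open>Only coordinates in \<open>Y\<close> are read by \<open>c\<close>, so the vectors with
  index outside \<open>{..<m}\<close> may be replaced by those of a witness.\<close>

lemma AE_generic:
  assumes c: "c \<in> gen_algebra (coords Y)" "\<exists>y. c y \<noteq> 0"
  shows "AE w in Pi\<^sub>M {..<m} (\<lambda>_. unif_polydisc). c (flatten w) \<noteq> 0"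
proof -
  obtain y where y: "c y \<noteq> 0" using c(2) by blast
  define w0 where "w0 \<nu> = (\<chi> j. y (\<nu>, j))" for \<nu>
  have fw: "flatten w0 = y" by (auto simp: flatten_def w0_def fun_eq_iff)
  have "AE w in Pi\<^sub>M {..<m} (\<lambda>_. unif_polydisc). c (flatten (\<lambda>\<nu>. if \<nu> \<in> {..<m} then w \<nu> else w0 \<nu>)) \<noteq> 0"
    by (rule flatten_algebra_AE_nonzero[OF c(1)]) (simp_all add: fw y)
  moreover have "c (flatten (\<lambda>\<nu>. if \<nu> \<in> {..<m} then w \<nu> else w0 \<nu>)) = c (flatten w)" for w
    by (rule gen_algebra_cong[OF c(1)]) (auto simp: coords_def Y_def flatten_def)
  ultimately show ?thesis by simp
qed

text \<open>The bound \<open>D\<close> is the product of the degrees of the coordinate relations and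
  is fixed before \<open>w\<close>, as averaging over \<open>w\<close> requires. The zero
  \<open>z0\<close> feeds the relation for the Jacobian.\<close>

lemma AE_generic_line:
  assumes "z0 \<in> zeros w0 0" "jac w0 0 z0 \<noteq> 0"
  obtains D :: nat where "AE w in Pi\<^sub>M {..<m} (\<lambda>_. unif_polydisc).
    \<exists>S. finite S \<and> (\<forall>s. s \<notin> S \<longrightarrow> good w s \<and> card (zeros w s) \<le> D)"
proof -
  define RR where "RR i K c \<longleftrightarrow> (\<forall>k. c k \<in> gen_algebra (coords Y)) \<and> (\<exists>y. c 0 y \<noteq> 0) \<and>
    (\<forall>w s z. z \<in> zeros w s \<longrightarrow> (\<Sum>k\<le>K. c k (flatten (smul s w)) * (z $ i) ^ k) = 0)"
    for i and K :: nat and c :: "nat \<Rightarrow> (nat \<times> 'n \<Rightarrow> complex) \<Rightarrow> complex"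
  have "\<exists>K c. RR i K c" for i
    unfolding RR_def by (rule coordinate_relation[of i]) blast
  then obtain K c where "\<And>i. RR i (K i) (c i)" by metis
  then have c: "\<And>i k. c i k \<in> gen_algebra (coords Y)" "\<And>i. \<exists>y. c i 0 y \<noteq> 0"
    "\<And>i w s z. z \<in> zeros w s \<Longrightarrow> (\<Sum>k\<le>K i. c i k (flatten (smul s w)) * (z $ i) ^ k) = 0"
    unfolding RR_def by blast+
  obtain KJ cJ where cJ: "\<And>k. cJ k \<in> gen_algebra (coords Y)" "\<exists>y. cJ 0 y \<noteq> 0"
    "\<And>w s z. z \<in> zeros w s \<Longrightarrow> (\<Sum>k\<le>KJ. cJ k (flatten (smul s w)) * (jac w s z) ^ k) = 0"
    by (rule jacobian_relation[OF assms]) (rule that)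
  have "AE w in Pi\<^sub>M {..<m} (\<lambda>_. unif_polydisc). \<forall>i\<in>UNIV. c i 0 (flatten w) \<noteq> 0"
    by (rule AE_finite_allI) (auto intro: AE_generic c)
  moreover have "AE w in Pi\<^sub>M {..<m} (\<lambda>_. unif_polydisc). cJ 0 (flatten w) \<noteq> 0"
    by (rule AE_generic[OF cJ(1,2)])
  ultimately have "AE w in Pi\<^sub>M {..<m} (\<lambda>_. unif_polydisc).
    \<exists>S. finite S \<and> (\<forall>s. s \<notin> S \<longrightarrow> good w s \<and> card (zeros w s) \<le> (\<Prod>i\<in>UNIV. K i))"
  proof eventually_elim
    case (elim w)
    then show ?case by (intro generic_line[where K = K and c = c and KJ = KJ and cJ = cJ] c cJ) auto
  qed
  then show ?thesis by (rule that)
qed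

end

section \<open>Averaging over random directions\<close>

lemma unif_polydisc_le:
  assumes "A \<in> sets borel"
  shows "emeasure unif_polydisc A * emeasure lborel (polydisc :: (complex^'n::finite) set) \<le> emeasure lborel (A :: (complex^'n) set)"
proof -
  obtain b where b: "b > 0" "emeasure lborel (polydisc :: (complex^'n) set) = ennreal b" by (rule emeasure_polydisc)
  have "emeasure unif_polydisc A * ennreal b = emeasure lborel (polydisc \<inter> A) / ennreal b * ennreal b"
    using assms b by (simp add: unif_polydisc_def)
  also have "\<dots> = emeasure lborel (polydisc \<inter> A)" using b by (simp add: ennreal_divide_times ennreal_mult_divide_eq)
  also have "\<dots> \<le> emeasure lborel A" using assms by (intro emeasure_mono) auto
  finally show ?thesis by (simp add: b)
qed

text \<open>The set is a translate of the preimage of a scaled polydisc under the diagonal matrix of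
  \<open>d\<close>; normalising by the volume of the polydisc leaves the constant 1.\<close>

lemma unif_polydisc_affine_diagonal:
  fixes d G :: "'n::finite \<Rightarrow> complex"
  assumes d: "\<And>j. d j \<noteq> 0" and c: "c > 0"
  shows "emeasure unif_polydisc {a :: complex^'n. \<forall>j. norm (G j - d j * a $ j) < 1 / c}
    \<le> ennreal (1 / ((\<Prod>j\<in>UNIV. (norm (d j))\<^sup>2) * c ^ (2 * CARD('n))))"
proof -
  define D :: "complex^'n^'n" where "D = (\<chi> i j. if i = j then d i else 0)"
  have Dm: "(D *v x) $ j = d j * x $ j" for x j
    by (simp add: D_def matrix_vector_mult_def if_distrib[of "\<lambda>t. t * y" for y] cong: if_cong)
  have dD: "det D = (\<Prod>j\<in>UNIV. d j)" unfolding D_def by (subst det_diagonal) auto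
  have dnz: "det D \<noteq> 0" using d by (simp add: dD)
  define A where "A = {a :: complex^'n. \<forall>j. norm (G j - d j * a $ j) < 1 / c}"
  have A [measurable]: "A \<in> sets borel" unfolding A_def by measurable
  obtain b where b: "b > 0" "emeasure lborel (polydisc :: (complex^'n) set) = ennreal b" by (rule emeasure_polydisc)
  define a0 :: "complex^'n" where "a0 = (\<chi> j. G j / d j)"
  have "emeasure lborel A = (\<integral>\<^sup>+x. indicator A x \<partial>lborel)" by simp
  also have "\<dots> = (\<integral>\<^sup>+x. indicator A (a0 + x) \<partial>lborel)" by (rule nn_integral_lborel_add[symmetric]) measurable
  also have "\<dots> = (\<integral>\<^sup>+x. indicator {x. \<forall>j. norm ((D *v x) $ j) < 1 / c} x \<partial>lborel)"
    using d by (intro nn_integral_cong) (auto simp: indicator_def A_def a0_def Dm distrib_left)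
  also have "\<dots> = emeasure lborel {x. \<forall>j. norm ((D *v x) $ j) < 1 / c}"
    by (subst nn_integral_indicator) (auto simp: Dm)
  also have "\<dots> = ennreal (1 / ((norm (det D))\<^sup>2 * c ^ (2 * CARD('n)))) * ennreal b"
    using emeasure_scaled_polydisc[OF dnz c] by (simp add: b)
  finally have "emeasure unif_polydisc A * ennreal b \<le> ennreal (1 / ((norm (det D))\<^sup>2 * c ^ (2 * CARD('n)))) * ennreal b"
    using unif_polydisc_le[OF A] by (simp add: b)
  then have "emeasure unif_polydisc A \<le> ennreal (1 / ((norm (det D))\<^sup>2 * c ^ (2 * CARD('n))))"
    using b(1) by (subst (asm) ennreal_mult_le_mult_iff[of "ennreal b", unfolded mult.commute[of "ennreal b"]]) auto
  then show ?thesis by (simp add: A_def dD prod_norm[symmetric] prod_power_distrib)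
qed

context deformation
begin

definition q :: "complex^'n \<Rightarrow> complex" where
  "q z = Q z / (\<Prod>i\<in>UNIV. z $ i)"

text \<open>Closeness within \<open>1 / k\<close> replaces being an exact zero, which for fixed
  \<open>z\<close> and \<open>s \<noteq> 0\<close> is an event of probability 0; the weaker
  condition has a probability that can be estimated and compared with a power of
  \<open>k\<close>.\<close>

definition near :: "(nat \<Rightarrow> complex^'n) \<Rightarrow> complex \<Rightarrow> nat \<Rightarrow> complex^'n \<Rightarrow> bool" where
  "near w s k z \<longleftrightarrow> z \<in> torus \<and> (\<forall>j. norm (F j z - s * (\<Sum>\<nu><m. w \<nu> $ j * P \<nu> j z)) < 1 / real k)"

text \<open>
  Up to a constant this dominates the sum of \<open>|q / jac|\<^sup>2\<close> over the zeros; unlike that sum, it is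
  evidently measurable in \<open>(w, s)\<close>.
\<close>
definition mass :: "(nat \<Rightarrow> complex^'n) \<Rightarrow> complex \<Rightarrow> ennreal" where
  "mass w s = liminf (\<lambda>k. ennreal (real k ^ (2 * CARD('n))) *
     (\<integral>\<^sup>+z. ennreal ((norm (q z))\<^sup>2) * indicator {z. near w s k z} z \<partial>lborel))"

lemma alg_borel [measurable]:
  "F j \<in> borel_measurable borel" "P \<nu> j \<in> borel_measurable borel" "Q \<in> borel_measurable borel"
  by (intro vec_algebra_borel F_alg P_alg Q_alg)+

lemma q_borel [measurable]: "q \<in> borel_measurable borel"
  unfolding q_def by measurable

lemma q_isCont: "z \<in> torus \<Longrightarrow> isCont q z"
  unfolding q_def by (intro continuous_intros vec_algebra_isCont Q_alg) (auto simp: torus_def)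

abbreviation W :: "(nat \<Rightarrow> complex^'n) measure" where
  "W \<equiv> Pi\<^sub>M {..<m} (\<lambda>_. unif_polydisc)"

lemma near_measurable [measurable]:
  "Measurable.pred ((W \<Otimes>\<^sub>M borel) \<Otimes>\<^sub>M borel) (\<lambda>x. near (fst (fst x)) (snd (fst x)) k (snd x))"
proof -
  have [measurable]: "(\<lambda>x. fst (fst x) \<nu> $ j) \<in> borel_measurable ((W \<Otimes>\<^sub>M borel) \<Otimes>\<^sub>M (borel :: (complex^'n) measure))"
    if "\<nu> \<in> {..<m}" for \<nu> j
    using that by measurable
  show ?thesis unfolding near_def by measurable
qed

lemma near_measurable_w [measurable]: "Measurable.pred W (\<lambda>w. near w s k z)"
proof -
  have [measurable]: "(\<lambda>w. w \<nu> $ j) \<in> borel_measurable W" if "\<nu> \<in> {..<m}" for \<nu> j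
    using that by measurable
  show ?thesis unfolding near_def by measurable
qed

lemma near_measurable_wz [measurable]: "Measurable.pred (W \<Otimes>\<^sub>M borel) (\<lambda>x. near (fst x) s k (snd x))"
proof -
  have [measurable]: "(\<lambda>x. fst x \<nu> $ j) \<in> borel_measurable (W \<Otimes>\<^sub>M (borel :: (complex^'n) measure))" if "\<nu> \<in> {..<m}" for \<nu> j
    using that by measurable
  show ?thesis unfolding near_def by measurable
qed

lemma mass_measurable: "(\<lambda>x. mass (fst x) (snd x)) \<in> borel_measurable (W \<Otimes>\<^sub>M lborel)"
proof -
  have "(\<lambda>x. mass (fst x) (snd x)) \<in> borel_measurable (W \<Otimes>\<^sub>M borel)"
    unfolding mass_def
    by (intro borel_measurable_liminf borel_measurable_times_ennreal borel_measurable_const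
        lborel.borel_measurable_nn_integral) (simp add: case_prod_unfold)
  then show ?thesis by (simp cong: measurable_cong_sets)
qed

text \<open>All vectors but \<open>w \<nu>\<close> are frozen; the condition then confines component
  \<open>j\<close> of \<open>w \<nu>\<close> to a disc of radius
  \<open>1 / (k * norm s * norm (P \<nu> j z))\<close>. The index is left free so that the
  dominating one can be taken at each \<open>z\<close>.\<close>

lemma near_prob:
  assumes z: "z \<in> torus" and \<nu>: "\<nu> < m" and s: "s \<noteq> 0" and k: "k > 0"
  shows "(\<integral>\<^sup>+w. indicator {w. near w s k z} w \<partial>W) \<le>
     ennreal (1 / (real k ^ (2 * CARD('n)) * norm s ^ (2 * CARD('n)) * (\<Prod>j\<in>UNIV. (norm (P \<nu> j z))\<^sup>2)))"
    (is "_ \<le> ?b")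
proof -
  define I where "I = {..<m} - {\<nu>}"
  have ins: "{..<m} = insert \<nu> I" using \<nu> by (auto simp: I_def)
  have I: "finite I" "\<nu> \<notin> I" by (auto simp: I_def)
  have "(\<integral>\<^sup>+w. indicator {w. near w s k z} w \<partial>W)
     = (\<integral>\<^sup>+w. (\<integral>\<^sup>+a. indicator {w. near w s k z} (w(\<nu> := a)) \<partial>unif_polydisc) \<partial>Pi\<^sub>M I (\<lambda>_. unif_polydisc))"
    using near_measurable_w[of s k z] unfolding ins
    by (intro unif.product_nn_integral_insert[OF I]) simp
  also have "\<dots> \<le> (\<integral>\<^sup>+w. ?b \<partial>Pi\<^sub>M I (\<lambda>_. unif_polydisc :: (complex^'n) measure))"
  proof (rule nn_integral_mono)
    fix w :: "nat \<Rightarrow> complex^'n"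
    define G where "G j = F j z - s * (\<Sum>\<mu>\<in>I. w \<mu> $ j * P \<mu> j z)" for j
    have sm: "(\<Sum>\<mu><m. (w(\<nu> := a)) \<mu> $ j * P \<mu> j z) = a $ j * P \<nu> j z + (\<Sum>\<mu>\<in>I. w \<mu> $ j * P \<mu> j z)" for a j
    proof -
      have "(\<Sum>\<mu>\<in>I. (w(\<nu> := a)) \<mu> $ j * P \<mu> j z) = (\<Sum>\<mu>\<in>I. w \<mu> $ j * P \<mu> j z)"
        using I by (intro sum.cong) auto
      then show ?thesis unfolding ins using I by simp
    qed
    have ne: "near (w(\<nu> := a)) s k z \<longleftrightarrow> (\<forall>j. norm (G j - (s * P \<nu> j z) * a $ j) < 1 / real k)" for a
      unfolding near_def sm G_def using z by (simp add: algebra_simps)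
    have A: "{a. \<forall>j. norm (G j - (s * P \<nu> j z) * a $ j) < 1 / real k} \<in> sets borel" by measurable
    have "(\<integral>\<^sup>+a. indicator {w. near w s k z} (w(\<nu> := a)) \<partial>unif_polydisc)
       = (\<integral>\<^sup>+a. indicator {a. \<forall>j. norm (G j - (s * P \<nu> j z) * a $ j) < 1 / real k} a \<partial>unif_polydisc)"
      by (intro nn_integral_cong) (simp add: indicator_def ne)
    also have "\<dots> = emeasure unif_polydisc {a. \<forall>j. norm (G j - (s * P \<nu> j z) * a $ j) < 1 / real k}"
      using A by simp
    also have "\<dots> \<le> ennreal (1 / ((\<Prod>j\<in>UNIV. (norm (s * P \<nu> j z))\<^sup>2) * real k ^ (2 * CARD('n))))"
      using s k P_nonzero[OF z] by (intro unif_polydisc_affine_diagonal) auto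
    also have "(\<Prod>j\<in>UNIV. (norm (s * P \<nu> j z))\<^sup>2) = norm s ^ (2 * CARD('n)) * (\<Prod>j\<in>UNIV. (norm (P \<nu> j z))\<^sup>2)"
      by (simp add: norm_mult power_mult_distrib prod.distrib power_mult)
    finally show "(\<integral>\<^sup>+a. indicator {w. near w s k z} (w(\<nu> := a)) \<partial>unif_polydisc) \<le> ?b"
      by (simp only: mult_ac)
  qed
  also have "\<dots> = ?b" using emeasure_unif_PiM[OF I(1), where ?'n = 'n] by simp
  finally show ?thesis .
qed

text \<open>Fatou extracts the limit and Fubini brings the average over \<open>w\<close> inside,
  where \<open>near_prob\<close> is used with the dominating index at \<open>z\<close>; its factor
  k^(-2n) cancels the normalisation of \<open>mass\<close>.\<close>

lemma mass_integral:
  assumes g [measurable]: "g \<in> borel_measurable borel"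
    and dom: "\<And>z. z \<in> torus \<Longrightarrow> \<exists>\<nu><m. ennreal ((norm (q z))\<^sup>2) \<le> g z * ennreal (\<Prod>j\<in>UNIV. (norm (P \<nu> j z))\<^sup>2)"
    and s: "s \<noteq> 0"
  shows "(\<integral>\<^sup>+w. mass w s \<partial>W) \<le> ennreal (1 / norm s ^ (2 * CARD('n))) * (\<integral>\<^sup>+z. g z \<partial>lborel)"
proof -
  let ?N = "2 * CARD('n)"
  interpret Wl: pair_sigma_finite W "lborel :: (complex^'n) measure"
    by (intro pair_sigma_finite.intro unif.sigma_finite lborel.sigma_finite_measure_axioms) simp
  define u where "u k w = ennreal (real k ^ ?N) *
     (\<integral>\<^sup>+z. ennreal ((norm (q z))\<^sup>2) * indicator {z. near w s k z} z \<partial>lborel)" for k w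
  have jm: "(\<lambda>x. ennreal ((norm (q (snd x)))\<^sup>2) * indicator {z. near (fst x) s k z} (snd x)) \<in> borel_measurable (W \<Otimes>\<^sub>M lborel)" for k
  proof -
    have "(\<lambda>x. ennreal ((norm (q (snd x)))\<^sup>2) * indicator {z. near (fst x) s k z} (snd x)) \<in> borel_measurable (W \<Otimes>\<^sub>M borel)"
      by simp
    then show ?thesis by (simp cong: measurable_cong_sets)
  qed
  have um: "u k \<in> borel_measurable W" for k
    unfolding u_def using jm[of k]
    by (intro borel_measurable_times_ennreal borel_measurable_const lborel.borel_measurable_nn_integral)
       (simp add: case_prod_unfold)
  have "(\<integral>\<^sup>+w. mass w s \<partial>W) = (\<integral>\<^sup>+w. liminf (\<lambda>k. u k w) \<partial>W)" by (simp add: mass_def u_def)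
  also have "\<dots> \<le> liminf (\<lambda>k. \<integral>\<^sup>+w. u k w \<partial>W)" by (rule nn_integral_liminf[OF um])
  also have "\<dots> \<le> ennreal (1 / norm s ^ ?N) * (\<integral>\<^sup>+z. g z \<partial>lborel)"
  proof (rule order_trans[OF Liminf_le_Limsup[OF sequentially_bot]], rule Limsup_bounded,
      intro eventually_mono[OF eventually_gt_at_top[of 0]])
    fix k :: nat assume k: "k > 0"
    have "(\<integral>\<^sup>+w. u k w \<partial>W) = ennreal (real k ^ ?N) *
       (\<integral>\<^sup>+w. (\<integral>\<^sup>+z. ennreal ((norm (q z))\<^sup>2) * indicator {z. near w s k z} z \<partial>lborel) \<partial>W)"
      unfolding u_def using jm[of k]
      by (intro nn_integral_cmult lborel.borel_measurable_nn_integral) (simp add: case_prod_unfold)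
    also have "\<dots> = ennreal (real k ^ ?N) *
       (\<integral>\<^sup>+z. (\<integral>\<^sup>+w. ennreal ((norm (q z))\<^sup>2) * indicator {z. near w s k z} z \<partial>W) \<partial>lborel)"
      using jm[of k] by (subst Wl.Fubini') (simp_all add: case_prod_unfold)
    also have "\<dots> \<le> ennreal (real k ^ ?N) *
       (\<integral>\<^sup>+z. ennreal (1 / (real k ^ ?N * norm s ^ ?N)) * g z \<partial>lborel)"
    proof (intro mult_left_mono nn_integral_mono)
      fix z :: "complex^'n"
      show "(\<integral>\<^sup>+w. ennreal ((norm (q z))\<^sup>2) * indicator {z. near w s k z} z \<partial>W)
         \<le> ennreal (1 / (real k ^ ?N * norm s ^ ?N)) * g z"
      proof (cases "z \<in> torus")
        case False
        then show ?thesis by (simp add: near_def)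
      next
        case True
        obtain \<nu> where \<nu>: "\<nu> < m" "ennreal ((norm (q z))\<^sup>2) \<le> g z * ennreal (\<Prod>j\<in>UNIV. (norm (P \<nu> j z))\<^sup>2)"
          using dom[OF True] by blast
        define p where "p = (\<Prod>j\<in>UNIV. (norm (P \<nu> j z))\<^sup>2)"
        have p: "p > 0" unfolding p_def using P_nonzero[OF True] by (intro prod_pos) auto
        have "(\<integral>\<^sup>+w. ennreal ((norm (q z))\<^sup>2) * indicator {z. near w s k z} z \<partial>W)
           = (\<integral>\<^sup>+w. ennreal ((norm (q z))\<^sup>2) * indicator {w. near w s k z} w \<partial>W)"
          by (intro nn_integral_cong) (simp add: indicator_def)
        also have "\<dots> = ennreal ((norm (q z))\<^sup>2) * (\<integral>\<^sup>+w. indicator {w. near w s k z} w \<partial>W)"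
          by (intro nn_integral_cmult) simp
        also have "\<dots> \<le> (g z * ennreal p) * ennreal (1 / (real k ^ ?N * norm s ^ ?N * p))"
          using near_prob[OF True \<nu>(1) s k] \<nu>(2) unfolding p_def by (intro mult_mono) auto
        also have "\<dots> = g z * (ennreal p * ennreal (1 / (real k ^ ?N * norm s ^ ?N * p)))"
          by (simp add: mult.assoc)
        also have "ennreal p * ennreal (1 / (real k ^ ?N * norm s ^ ?N * p)) = ennreal (1 / (real k ^ ?N * norm s ^ ?N))"
          using p by (subst ennreal_mult[symmetric]) auto
        finally show ?thesis by (simp add: mult.commute)
      qed
    qed simp
    also have "\<dots> = (ennreal (real k ^ ?N) * ennreal (1 / (real k ^ ?N * norm s ^ ?N))) * (\<integral>\<^sup>+z. g z \<partial>lborel)"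
      by (subst nn_integral_cmult) (auto simp: mult.assoc)
    also have "ennreal (real k ^ ?N) * ennreal (1 / (real k ^ ?N * norm s ^ ?N)) = ennreal (1 / norm s ^ ?N)"
      using k by (subst ennreal_mult[symmetric]) auto
    finally show "(\<integral>\<^sup>+w. u k w \<partial>W) \<le> ennreal (1 / norm s ^ ?N) * (\<integral>\<^sup>+z. g z \<partial>lborel)" .
  qed
  finally show ?thesis .
qed

lemma pencil_has_derivative:
  "(pencil F (dir w) s has_derivative (*v) (pencil_jac F (dir w) s z)) (at z)"
proof (rule has_derivative_vec_componentwise)
  fix j
  have "((\<lambda>z. F j z - s * dir w j z) has_derivative (\<lambda>h. (\<Sum>k\<in>UNIV. h $ k * partial_deriv k (F j) z) -
      s * (\<Sum>k\<in>UNIV. h $ k * partial_deriv k (dir w j) z))) (at z)"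
    by (intro has_derivative_diff has_derivative_mult_right vec_algebra_partial_deriv F_alg dir_alg)
  then show "((\<lambda>x. pencil F (dir w) s x $ j) has_derivative (\<lambda>d. (pencil_jac F (dir w) s z *v d) $ j)) (at z)"
    by (simp add: pencil_def pencil_jac_def matrix_vector_mult_def algebra_simps sum_subtractf sum_distrib_left)
qed

text \<open>The local masses at the finitely many zeros live on disjoint neighbourhoods and
  therefore add up; for large \<open>k\<close> all the local bounds hold at once.\<close>

lemma mass_lower_bound:
  assumes fin: "finite (zeros w s)" and nd: "\<And>z. z \<in> zeros w s \<Longrightarrow> jac w s z \<noteq> 0"
  shows "ennreal ((\<Sum>z\<in>zeros w s. (norm (q z / jac w s z))\<^sup>2) / (2 * 4 ^ CARD('n))) *
      emeasure lborel (polydisc :: (complex^'n) set) \<le> mass w s"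
proof -
  let ?N = "2 * CARD('n)"
  let ?b = "emeasure lborel (polydisc :: (complex^'n) set)"
  obtain d where d: "\<And>z. d z > 0" "\<And>z x. x \<in> zeros w s \<Longrightarrow> x \<noteq> z \<Longrightarrow> d z \<le> dist z x"
    using finite_set_avoid[OF fin] by metis
  define U where "U z = ball z (d z / 2) \<inter> torus" for z
  have U: "open (U z)" for z using torus_open by (auto simp: U_def)
  have zU: "z \<in> U z" if "z \<in> zeros w s" for z using that d(1) by (auto simp: U_def zeros_def)
  have disj: "z = z'" if "z \<in> zeros w s" "z' \<in> zeros w s" "x \<in> U z" "x \<in> U z'" for z z' x
  proof (rule ccontr)
    assume ne: "z \<noteq> z'"
    have "dist z x < d z / 2" "dist z' x < d z' / 2" using that by (auto simp: U_def)
    moreover have "dist z z' \<le> dist z x + dist z' x" by (metis dist_commute dist_triangle)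
    moreover have "d z \<le> dist z z'" "d z' \<le> dist z z'" using d(2)[of z' z] d(2)[of z z'] ne that by (auto simp: dist_commute)
    ultimately show False by linarith
  qed
  define A where "A k z = {x \<in> U z. \<forall>j. norm (pencil F (dir w) s x $ j) < 1 / real k}" for k z
  have dirm [measurable]: "dir w j \<in> borel_measurable borel" for j by (rule vec_algebra_borel[OF dir_alg])
  have Um [measurable]: "U z \<in> sets borel" for z using U by auto
  have "A k z = {x \<in> U z. \<forall>j. norm (F j x - s * dir w j x) < 1 / real k}" for k z
    by (simp add: A_def pencil_def)
  then have Am [measurable]: "A k z \<in> sets borel" for k z by simp
  define a where "a z = (norm (q z))\<^sup>2 / 2 / (norm (jac w s z))\<^sup>2 / 4 ^ CARD('n)" for z
  have "eventually (\<lambda>k. \<forall>z\<in>zeros w s. ennreal (a z) * ?b \<le> ennreal (real k ^ ?N) *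
      (\<integral>\<^sup>+x. ennreal ((norm (q x))\<^sup>2) * indicator (A k z) x \<partial>lborel)) sequentially"
    unfolding a_def A_def
  proof (rule eventually_ball_finite[OF fin], rule ballI)
    fix z assume z: "z \<in> zeros w s"
    then have "pencil F (dir w) s z = 0" "z \<in> torus" by (auto simp: zeros_def)
    then show "eventually (\<lambda>k. ennreal ((norm (q z))\<^sup>2 / 2 / (norm (jac w s z))\<^sup>2 / 4 ^ CARD('n)) * ?b \<le> ennreal (real k ^ ?N) *
      (\<integral>\<^sup>+x. ennreal ((norm (q x))\<^sup>2) * indicator {x \<in> U z. \<forall>j. norm (pencil F (dir w) s x $ j) < 1 / real k} x \<partial>lborel)) sequentially"
      by (intro simple_zero_local_mass pencil_has_derivative nd z U zU q_isCont)
  qed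
  then have "eventually (\<lambda>k. ennreal (\<Sum>z\<in>zeros w s. a z) * ?b \<le> ennreal (real k ^ ?N) *
     (\<integral>\<^sup>+z. ennreal ((norm (q z))\<^sup>2) * indicator {z. near w s k z} z \<partial>lborel)) sequentially"
  proof eventually_elim
    case (elim k)
    have "ennreal (\<Sum>z\<in>zeros w s. a z) * ?b = (\<Sum>z\<in>zeros w s. ennreal (a z) * ?b)"
      unfolding sum_distrib_right[symmetric] by (subst sum_ennreal) (auto simp: a_def)
    also have "\<dots> \<le> (\<Sum>z\<in>zeros w s. ennreal (real k ^ ?N) * (\<integral>\<^sup>+x. ennreal ((norm (q x))\<^sup>2) * indicator (A k z) x \<partial>lborel))"
      using elim by (intro sum_mono) auto
    also have "\<dots> = ennreal (real k ^ ?N) * (\<integral>\<^sup>+x. (\<Sum>z\<in>zeros w s. ennreal ((norm (q x))\<^sup>2) * indicator (A k z) x) \<partial>lborel)"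
      by (subst nn_integral_sum) (auto simp: sum_distrib_left)
    also have "\<dots> \<le> ennreal (real k ^ ?N) *
     (\<integral>\<^sup>+z. ennreal ((norm (q z))\<^sup>2) * indicator {z. near w s k z} z \<partial>lborel)"
    proof (intro mult_left_mono nn_integral_mono)
      fix x
      show "(\<Sum>z\<in>zeros w s. ennreal ((norm (q x))\<^sup>2) * indicator (A k z) x) \<le> ennreal ((norm (q x))\<^sup>2) * indicator {z. near w s k z} x"
      proof (cases "\<exists>z0\<in>zeros w s. x \<in> A k z0")
        case True
        then obtain z0 where z0: "z0 \<in> zeros w s" "x \<in> A k z0" by blast
        have "x \<notin> A k z" if "z \<in> zeros w s" "z \<noteq> z0" for z
          using disj[of z z0 x] that z0 by (auto simp: A_def)
        then have "(\<Sum>z\<in>zeros w s. ennreal ((norm (q x))\<^sup>2) * indicator (A k z) x) = (\<Sum>z\<in>{z0}. ennreal ((norm (q x))\<^sup>2) * indicator (A k z) x)"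
          using fin z0 by (intro sum.mono_neutral_right) auto
        moreover have "near w s k x"
          using z0(2) by (auto simp: A_def near_def U_def pencil_def dir_def)
        ultimately show ?thesis using z0 by simp
      next
        case False
        then have "(\<Sum>z\<in>zeros w s. ennreal ((norm (q x))\<^sup>2) * indicator (A k z) x) = 0" by (intro sum.neutral) auto
        then show ?thesis by simp
      qed
    qed simp
    finally show ?case .
  qed
  then have "ennreal (\<Sum>z\<in>zeros w s. a z) * ?b \<le> mass w s"
    unfolding mass_def by (rule Liminf_bounded)
  moreover have "(\<Sum>z\<in>zeros w s. a z) = (\<Sum>z\<in>zeros w s. (norm (q z / jac w s z))\<^sup>2) / (2 * 4 ^ CARD('n))"
    by (simp add: a_def sum_divide_distrib norm_divide power_divide mult_ac)
  ultimately show ?thesis by simp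
qed

section \<open>Vanishing of the residue sum\<close>

lemma zeros_at_0: "zeros w 0 = {z \<in> torus. \<forall>j. F j z = 0}"
  by (auto simp: zeros_def pencil_def vec_eq_iff)

lemma jac_at_0: "jac w 0 z = det (\<chi> j k. partial_deriv k (F j) z)"
  by (simp add: pencil_jac_def)

text \<open>For \<open>s\<close> of norm below \<open>e / B\<close> all components of the parameters
  \<open>smul s w\<close> have norm at most \<open>e\<close>, so one compact set confines the zeros
  for every direction.\<close>

lemma good_at_0:
  assumes L: "compact L" "L \<subseteq> torus" and e: "e > 0"
    and inL: "\<And>u z. (\<And>\<nu> j. \<nu> < m \<Longrightarrow> norm (u \<nu> $ j) \<le> e) \<Longrightarrow> z \<in> torus \<Longrightarrow>
          (\<And>j. F j z = (\<Sum>\<nu><m. u \<nu> $ j * P \<nu> j z)) \<Longrightarrow> z \<in> L"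
    and nd: "\<And>z. z \<in> torus \<Longrightarrow> (\<And>j. F j z = 0) \<Longrightarrow> det (\<chi> j k. partial_deriv k (F j) z) \<noteq> 0"
  shows "good w 0"
proof -
  define B where "B = 1 + (\<Sum>\<nu><m. \<Sum>j\<in>UNIV. norm (w \<nu> $ j))"
  have B: "B \<ge> 1" unfolding B_def by (simp add: sum_nonneg)
  have wB: "norm (w \<nu> $ j) \<le> B" if "\<nu> < m" for \<nu> j
  proof -
    have "norm (w \<nu> $ j) \<le> (\<Sum>j\<in>UNIV. norm (w \<nu> $ j))" by (intro member_le_sum) auto
    also have "\<dots> \<le> (\<Sum>\<nu><m. \<Sum>j\<in>UNIV. norm (w \<nu> $ j))"
      using that by (intro member_le_sum[of \<nu> _ "\<lambda>\<nu>. \<Sum>j\<in>UNIV. norm (w \<nu> $ j)"]) (auto intro: sum_nonneg)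
    finally show ?thesis by (simp add: B_def)
  qed
  have "zeros w s \<subseteq> L" if s: "s \<in> ball 0 (e / B)" for s
  proof
    fix z assume z: "z \<in> zeros w s"
    show "z \<in> L"
    proof (rule inL[of "smul s w"])
      show "z \<in> torus" "F j z = (\<Sum>\<nu><m. smul s w \<nu> $ j * P \<nu> j z)" for j
        using z by (auto simp: zeros_iff)
      fix \<nu> j assume "\<nu> < m"
      have "norm s * norm (w \<nu> $ j) \<le> (e / B) * B"
        using s wB[OF \<open>\<nu> < m\<close>] e B by (intro mult_mono) auto
      then show "norm (smul s w \<nu> $ j) \<le> e" using B by (simp add: smul_def norm_mult)
    qed
  qed
  moreover have "e / B > 0" using e B by simp
  moreover have "jac w 0 z \<noteq> 0" if "z \<in> zeros w 0" for z
    unfolding jac_at_0 using that nd by (auto simp: zeros_at_0)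
  ultimately show ?thesis unfolding good_def using L by blast
qed

text \<open>Cauchy-Schwarz with at most \<open>D\<close> summands, followed by
  \<open>mass_lower_bound\<close>; the constant depends neither on \<open>w\<close> nor on
  \<open>s\<close>.\<close>

lemma residue_sum_le_mass:
  assumes "good w s" "card (zeros w s) \<le> D"
    and b: "b > 0" "emeasure lborel (polydisc :: (complex^'n) set) = ennreal b"
  shows "ennreal ((norm (residue_sum w s))\<^sup>2) \<le> ennreal (real D * 2 * 4 ^ CARD('n) / b) * mass w s"
proof -
  have fin: "finite (zeros w s)" by (rule good_holomorphic(1)[OF assms(1)])
  have nd: "\<And>z. z \<in> zeros w s \<Longrightarrow> jac w s z \<noteq> 0" using assms(1) by (simp add: good_def)
  define N where "N = (\<Sum>z\<in>zeros w s. (norm (q z / jac w s z))\<^sup>2)"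
  have N: "N \<ge> 0" unfolding N_def by (intro sum_nonneg) auto
  have "norm (residue_sum w s) \<le> (\<Sum>z\<in>zeros w s. norm (q z / jac w s z))"
    unfolding residue_sum_def q_def by (rule norm_sum)
  then have "(norm (residue_sum w s))\<^sup>2 \<le> (\<Sum>z\<in>zeros w s. norm (q z / jac w s z))\<^sup>2"
    by (intro power_mono) auto
  also have "\<dots> \<le> N * card (zeros w s)"
    unfolding N_def by (rule sum_squared_le_sum_of_squares)
  also have "\<dots> \<le> N * D" using N assms(2) by (intro mult_left_mono) auto
  also have "\<dots> = (real D * 2 * 4 ^ CARD('n) / b) * (N / (2 * 4 ^ CARD('n)) * b)" using b by simp
  finally have "ennreal ((norm (residue_sum w s))\<^sup>2) \<le> ennreal ((real D * 2 * 4 ^ CARD('n) / b) * (N / (2 * 4 ^ CARD('n)) * b))"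
    by (rule ennreal_leI)
  also have "\<dots> = ennreal (real D * 2 * 4 ^ CARD('n) / b) * (ennreal (N / (2 * 4 ^ CARD('n))) * ennreal b)"
    using N b by (subst ennreal_mult, simp, simp, subst ennreal_mult) auto
  also have "\<dots> \<le> ennreal (real D * 2 * 4 ^ CARD('n) / b) * mass w s"
    using mass_lower_bound[OF fin nd] b by (intro mult_left_mono) (auto simp: N_def)
  finally show ?thesis .
qed

lemma mass_indicator_measurable:
  assumes "A \<in> sets borel"
  shows "(\<lambda>(w, s). mass w s * indicator A s) \<in> borel_measurable (W \<Otimes>\<^sub>M lborel)"
    and "(\<lambda>w. \<integral>\<^sup>+s. mass w s * indicator A s \<partial>lborel) \<in> borel_measurable W"
proof -
  note [measurable] = mass_measurable assms
  show 1: "(\<lambda>(w, s). mass w s * indicator A s) \<in> borel_measurable (W \<Otimes>\<^sub>M lborel)"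
    unfolding case_prod_unfold by measurable
  show "(\<lambda>w. \<integral>\<^sup>+s. mass w s * indicator A s \<partial>lborel) \<in> borel_measurable W"
    by (rule lborel.borel_measurable_nn_integral[OF 1])
qed

text \<open>The averaged mass is bounded by a decreasing function of \<open>norm s\<close>, so on
  \<open>A\<close> its value at radius \<open>r\<close> serves as a uniform bound.\<close>

lemma mass_shell_integral:
  assumes g: "g \<in> borel_measurable borel"
    and dom: "\<And>z. z \<in> torus \<Longrightarrow> \<exists>\<nu><m. ennreal ((norm (q z))\<^sup>2) \<le> g z * ennreal (\<Prod>j\<in>UNIV. (norm (P \<nu> j z))\<^sup>2)"
    and A: "A \<in> sets borel" "\<And>s. s \<in> A \<Longrightarrow> r \<le> norm s" and r: "r > 0"
  shows "(\<integral>\<^sup>+w. (\<integral>\<^sup>+s. mass w s * indicator A s \<partial>lborel) \<partial>W) \<le>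
     ennreal (1 / r ^ (2 * CARD('n))) * (\<integral>\<^sup>+z. g z \<partial>lborel) * emeasure lborel A"
proof -
  interpret Wl: pair_sigma_finite W "lborel :: complex measure"
    by (intro pair_sigma_finite.intro unif.sigma_finite lborel.sigma_finite_measure_axioms) simp
  have "(\<integral>\<^sup>+w. (\<integral>\<^sup>+s. mass w s * indicator A s \<partial>lborel) \<partial>W) = (\<integral>\<^sup>+s. (\<integral>\<^sup>+w. mass w s * indicator A s \<partial>W) \<partial>lborel)"
    by (rule Wl.Fubini'[symmetric]) (rule mass_indicator_measurable(1)[OF A(1)])
  also have "\<dots> \<le> (\<integral>\<^sup>+s. ennreal (1 / r ^ (2 * CARD('n))) * (\<integral>\<^sup>+z. g z \<partial>lborel) * indicator A s \<partial>lborel)"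
  proof (rule nn_integral_mono)
    fix s :: complex
    show "(\<integral>\<^sup>+w. mass w s * indicator A s \<partial>W) \<le> ennreal (1 / r ^ (2 * CARD('n))) * (\<integral>\<^sup>+z. g z \<partial>lborel) * indicator A s"
    proof (cases "s \<in> A")
      case True
      then have rs: "r \<le> norm s" using A(2) by blast
      then have s: "s \<noteq> 0" using r by auto
      have "(\<integral>\<^sup>+w. mass w s \<partial>W) \<le> ennreal (1 / norm s ^ (2 * CARD('n))) * (\<integral>\<^sup>+z. g z \<partial>lborel)"
        by (rule mass_integral[OF g dom s])
      also have "\<dots> \<le> ennreal (1 / r ^ (2 * CARD('n))) * (\<integral>\<^sup>+z. g z \<partial>lborel)"
        using r rs by (intro mult_right_mono ennreal_leI divide_left_mono power_mono mult_pos_pos zero_less_power) auto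
      finally show ?thesis using True by simp
    qed simp
  qed
  also have "\<dots> = ennreal (1 / r ^ (2 * CARD('n))) * (\<integral>\<^sup>+z. g z \<partial>lborel) * emeasure lborel A"
    using A(1) by (simp add: nn_integral_cmult_indicator)
  finally show ?thesis .
qed

theorem residue_sum_zero:
  assumes g: "g \<in> borel_measurable borel" "(\<integral>\<^sup>+z. g z \<partial>lborel) < \<infinity>"
    and dom: "\<And>z. z \<in> torus \<Longrightarrow> \<exists>\<nu><m. ennreal ((norm (q z))\<^sup>2) \<le> g z * ennreal (\<Prod>j\<in>UNIV. (norm (P \<nu> j z))\<^sup>2)"
    and L: "compact L" "L \<subseteq> torus" and e: "e > 0"
    and inL: "\<And>u z. (\<And>\<nu> j. \<nu> < m \<Longrightarrow> norm (u \<nu> $ j) \<le> e) \<Longrightarrow> z \<in> torus \<Longrightarrow>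
          (\<And>j. F j z = (\<Sum>\<nu><m. u \<nu> $ j * P \<nu> j z)) \<Longrightarrow> z \<in> L"
    and nd: "\<And>z. z \<in> torus \<Longrightarrow> (\<And>j. F j z = 0) \<Longrightarrow> det (\<chi> j k. partial_deriv k (F j) z) \<noteq> 0"
  shows "finite {z \<in> torus. \<forall>j. F j z = 0}"
    and "(\<Sum>z\<in>{z \<in> torus. \<forall>j. F j z = 0}. Q z / (\<Prod>i\<in>UNIV. z $ i) / det (\<chi> j k. partial_deriv k (F j) z)) = 0"
proof -
  have good0: "good w 0" for w by (rule good_at_0[OF L e inL nd])
  show fin0: "finite {z \<in> torus. \<forall>j. F j z = 0}"
    using good_holomorphic(1)[OF good0] by (simp add: zeros_at_0)
  define \<tau> where "\<tau> = (\<Sum>z\<in>{z \<in> torus. \<forall>j. F j z = 0}. Q z / (\<Prod>i\<in>UNIV. z $ i) / det (\<chi> j k. partial_deriv k (F j) z))"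
  have \<tau>: "residue_sum w 0 = \<tau>" for w
    unfolding residue_sum_def zeros_at_0 jac_at_0 \<tau>_def ..
  have "\<tau> = 0"
  proof (cases "{z \<in> torus. \<forall>j. F j z = 0} = {}")
    case True
    show ?thesis unfolding \<tau>_def True by simp
  next
    case False
    then obtain z0 where z0: "z0 \<in> zeros (\<lambda>_. 0) 0" by (auto simp: zeros_at_0)
    then have "jac (\<lambda>_. 0) 0 z0 \<noteq> 0" using good0 unfolding good_def by blast
    then obtain D :: nat where D: "AE w in W. \<exists>S. finite S \<and> (\<forall>s. s \<notin> S \<longrightarrow> good w s \<and> card (zeros w s) \<le> D)"
      using AE_generic_line[OF z0] by blast
    obtain b where b: "b > 0" "emeasure lborel (polydisc :: (complex^'n) set) = ennreal b" by (rule emeasure_polydisc)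
    define C where "C = real D * 2 * 4 ^ CARD('n) / b"
    have C: "C \<ge> 0" using b by (simp add: C_def)
    obtain G where G: "(\<integral>\<^sup>+z. g z \<partial>lborel) = ennreal G" "G \<ge> 0"
      using g(2) by (cases "\<integral>\<^sup>+z. g z \<partial>lborel") auto
    have mS: "mass w \<in> borel_measurable borel" if "w \<in> space W" for w
      using measurable_compose[OF measurable_Pair1'[OF that, of lborel] mass_measurable] by simp
    \<comment> \<open>Over each annulus the averaged integral is finite, so the integral itself is
      finite for almost every \<open>w\<close>; countably many annuli exhaust the punctured
      plane.\<close>
    have fin: "AE w in W. \<forall>r::nat. (\<integral>\<^sup>+s. mass w s * indicator {s. 1 / Suc r \<le> norm s \<and> norm s \<le> Suc r} s \<partial>lborel) < \<infinity>"
    proof (subst AE_all_countable, rule allI)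
      fix r :: nat
      let ?A = "{s :: complex. 1 / Suc r \<le> norm s \<and> norm s \<le> Suc r}"
      have A: "?A \<in> sets borel" by measurable
      have "?A \<subseteq> cball 0 (Suc r)" by auto
      then have "emeasure lborel ?A < \<infinity>"
        by (intro emeasure_bounded_finite) (use bounded_cball bounded_subset in blast)
      then have "ennreal (1 / (1 / Suc r) ^ (2 * CARD('n))) * (\<integral>\<^sup>+z. g z \<partial>lborel) * emeasure lborel ?A < \<infinity>"
        unfolding G by (simp add: ennreal_mult_less_top)
      then have "(\<integral>\<^sup>+w. (\<integral>\<^sup>+s. mass w s * indicator ?A s \<partial>lborel) \<partial>W) < \<infinity>"
        using mass_shell_integral[OF g(1) dom A, of "1 / Suc r"] by (simp add: order_le_less_trans)
      moreover have "(\<lambda>w. \<integral>\<^sup>+s. mass w s * indicator ?A s \<partial>lborel) \<in> borel_measurable W"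
        by (rule mass_indicator_measurable(2)[OF A])
      ultimately show "AE w in W. (\<integral>\<^sup>+s. mass w s * indicator ?A s \<partial>lborel) < \<infinity>"
        using nn_integral_PInf_AE[of "\<lambda>w. \<integral>\<^sup>+s. mass w s * indicator ?A s \<partial>lborel" W]
        by (auto simp: less_top)
    qed
    have bound: "(norm \<tau>)\<^sup>2 \<le> C * G / R ^ (2 * CARD('n))" if R: "R > 0" for R :: real
    proof -
      let ?A = "{s :: complex. R \<le> norm s \<and> norm s \<le> 2 * R}"
      have A: "?A \<in> sets borel" by measurable
      have "?A \<subseteq> cball 0 (2 * R)" by auto
      then have Afin: "emeasure lborel ?A < \<infinity>"
        by (intro emeasure_bounded_finite) (use bounded_cball bounded_subset in blast)
      \<comment> \<open>A disc inside the shell certifies positive area, so that the area can be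
        cancelled at the end.\<close>
      have "ball (complex_of_real (3 / 2 * R)) (R / 2) \<subseteq> ?A"
      proof
        fix s assume "s \<in> ball (complex_of_real (3 / 2 * R)) (R / 2)"
        then have 1: "norm (complex_of_real (3 / 2 * R) - s) < R / 2" by (simp add: dist_norm)
        have 2: "norm (complex_of_real (3 / 2 * R)) = 3 / 2 * R" using R by (simp only: norm_of_real)
        have "norm (complex_of_real (3 / 2 * R)) \<le> norm (complex_of_real (3 / 2 * R) - s) + norm s"
          "norm s \<le> norm (complex_of_real (3 / 2 * R) - s) + norm (complex_of_real (3 / 2 * R))" by norm+
        then show "s \<in> ?A" using 1 2 by auto
      qed
      then have "emeasure lborel (ball (complex_of_real (3 / 2 * R)) (R / 2)) \<le> emeasure lborel ?A"
        using A by (intro emeasure_mono) auto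
      moreover have "emeasure lborel (ball (complex_of_real (3 / 2 * R)) (R / 2)) > 0"
        using content_ball_pos[of "R / 2" "complex_of_real (3 / 2 * R)"] R
        by (metis emeasure_eq_ennreal_measure emeasure_lborel_ball_finite ennreal_less_zero_iff half_gt_zero_iff less_irrefl infinity_ennreal_def)
      ultimately have "emeasure lborel ?A > 0" by (rule less_le_trans[rotated])
      with Afin obtain a where a: "emeasure lborel ?A = ennreal a" "a > 0"
        by (cases "emeasure lborel ?A") auto
      have "AE w in W. ennreal ((norm \<tau>)\<^sup>2) * ennreal a \<le> ennreal C * (\<integral>\<^sup>+s. mass w s * indicator ?A s \<partial>lborel)"
        using D fin AE_space
      proof eventually_elim
        case (elim w)
        note [measurable] = mS[OF elim(3)]
        obtain S where S: "finite S" "\<And>s. s \<notin> S \<Longrightarrow> good w s \<and> card (zeros w s) \<le> D" using elim(1) by blast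
        have "ennreal ((norm (residue_sum w 0))\<^sup>2) * emeasure lborel ?A
            \<le> (\<integral>\<^sup>+s. (ennreal C * mass w s) * indicator ?A s \<partial>lborel)"
        proof (rule L2_mean_value_with_singularities)
          \<comment> \<open>The exceptional set may contain 0, but \<open>good w 0\<close> holds for
            every \<open>w\<close>, so 0 can be removed from it.\<close>
          show "finite (S - {0})" "0 \<notin> S - {0}" using S by auto
          show "residue_sum w holomorphic_on - (S - {0})"
            unfolding holomorphic_on_def
          proof
            fix s assume "s \<in> - (S - {0})"
            then have "good w s" using S(2) good0 by auto
            then obtain r where "r > 0" "residue_sum w holomorphic_on ball s r" using good_holomorphic(2) by blast
            then have "residue_sum w field_differentiable at s"
              by (intro holomorphic_on_imp_differentiable_at[OF _ open_ball]) auto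
            then show "residue_sum w field_differentiable at s within - (S - {0})"
              by (rule field_differentiable_at_within)
          qed
          show "(\<lambda>s. ennreal C * mass w s) \<in> borel_measurable borel" by measurable
          have "AE s in lborel. s \<notin> S" using S(1) by (intro AE_not_in finite_imp_null_set_lborel)
          then show "AE s in lborel. ennreal ((norm (residue_sum w s))\<^sup>2) \<le> ennreal C * mass w s"
            unfolding C_def by eventually_elim (use S(2) in \<open>auto intro!: residue_sum_le_mass[OF _ _ b]\<close>)
          fix r :: nat
          have "(\<integral>\<^sup>+s. ennreal C * mass w s * indicator {s. 1 / Suc r \<le> norm s \<and> norm s \<le> Suc r} s \<partial>lborel)
             = ennreal C * (\<integral>\<^sup>+s. mass w s * indicator {s. 1 / Suc r \<le> norm s \<and> norm s \<le> Suc r} s \<partial>lborel)"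
            by (subst nn_integral_cmult[symmetric]) (auto simp: mult.assoc)
          also have "\<dots> < \<infinity>" using elim(2) by (simp add: ennreal_mult_less_top)
          finally show "(\<integral>\<^sup>+s. ennreal C * mass w s * indicator {s. 1 / Suc r \<le> norm s \<and> norm s \<le> Suc r} s \<partial>lborel) < \<infinity>" .
        qed
        also have "\<dots> = ennreal C * (\<integral>\<^sup>+s. mass w s * indicator ?A s \<partial>lborel)"
          using A by (subst nn_integral_cmult[symmetric]) (auto simp: mult.assoc)
        finally show ?case by (simp add: \<tau> a)
      qed
      then have "(\<integral>\<^sup>+w. ennreal ((norm \<tau>)\<^sup>2) * ennreal a \<partial>W) \<le> (\<integral>\<^sup>+w. ennreal C * (\<integral>\<^sup>+s. mass w s * indicator ?A s \<partial>lborel) \<partial>W)"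
        by (rule nn_integral_mono_AE)
      also have "\<dots> = ennreal C * (\<integral>\<^sup>+w. (\<integral>\<^sup>+s. mass w s * indicator ?A s \<partial>lborel) \<partial>W)"
        by (intro nn_integral_cmult mass_indicator_measurable(2)[OF A])
      also have "\<dots> \<le> ennreal C * (ennreal (1 / R ^ (2 * CARD('n))) * ennreal G * ennreal a)"
        using mass_shell_integral[OF g(1) dom A, of R] R unfolding G a by (intro mult_left_mono) auto
      also have "\<dots> = ennreal (C * G / R ^ (2 * CARD('n)) * a)"
        using C G(2) a(2) R by (simp add: ennreal_mult[symmetric] mult_ac)
      also have "(\<integral>\<^sup>+w. ennreal ((norm \<tau>)\<^sup>2) * ennreal a \<partial>W) = ennreal ((norm \<tau>)\<^sup>2 * a)"
        using emeasure_unif_PiM[of "{..<m}", where ?'n = 'n] a(2) by (simp add: ennreal_mult)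
      finally have "(norm \<tau>)\<^sup>2 * a \<le> C * G / R ^ (2 * CARD('n)) * a"
        using C G(2) a(2) R by (subst (asm) ennreal_le_iff) auto
      then show ?thesis using a(2) by (rule mult_right_le_imp_le)
    qed
    show "\<tau> = 0"
    proof (rule ccontr)
      assume "\<tau> \<noteq> 0"
      then have t: "(norm \<tau>)\<^sup>2 > 0" by simp
      \<comment> \<open>Chosen so that \<open>R\<close> times the square of
        \<open>norm \<tau>\<close> exceeds \<open>C * G\<close>; since \<open>R \<ge> 1\<close>, the
        power \<open>R ^ (2 * CARD('n))\<close> is at least \<open>R\<close>, against
        \<open>bound\<close>.\<close>
      define R where "R = 1 + C * G / (norm \<tau>)\<^sup>2"
      have R1: "R \<ge> 1" using C G(2) t by (simp add: R_def)
      have "R * (norm \<tau>)\<^sup>2 = (norm \<tau>)\<^sup>2 + C * G" using t by (simp add: R_def field_simps)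
      then have 1: "C * G < R * (norm \<tau>)\<^sup>2" using t by linarith
      have "R ^ 1 \<le> R ^ (2 * CARD('n))" using R1 by (intro power_increasing) (auto simp: Suc_le_eq)
      then have "R * (norm \<tau>)\<^sup>2 \<le> R ^ (2 * CARD('n)) * (norm \<tau>)\<^sup>2" by (intro mult_right_mono) auto
      also have "\<dots> \<le> C * G" using bound[of R] R1 by (simp add: field_simps)
      finally show False using 1 by simp
    qed
  qed
  then show "(\<Sum>z\<in>{z \<in> torus. \<forall>j. F j z = 0}. Q z / (\<Prod>i\<in>UNIV. z $ i) / det (\<chi> j k. partial_deriv k (F j) z)) = 0"
    by (simp add: \<tau>_def)
qed

end

section \<open>An integrable majorant on the torus\<close>

text \<open>The function is a power of \<open>t\<close>, with exponent \<open>\<eta> - 1\<close>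
  below 1 and \<open>- \<eta> - 1\<close> above; neither exponent is positive when
  \<open>\<eta> \<le> 1\<close>.\<close>

lemma log_tent_decreasing:
  fixes t r \<eta> :: real
  assumes "0 < t" "t \<le> r" "0 < \<eta>" "\<eta> \<le> 1"
  shows "exp (- \<eta> * \<bar>ln r\<bar>) / r \<le> exp (- \<eta> * \<bar>ln t\<bar>) / t"
proof -
  have le: "ln t \<le> ln r" using assms by simp
  have "\<bar>ln t\<bar> - \<bar>ln r\<bar> \<le> ln r - ln t" using le by linarith
  then have "\<eta> * (\<bar>ln t\<bar> - \<bar>ln r\<bar>) \<le> \<eta> * (ln r - ln t)" using assms(3) by (intro mult_left_mono) auto
  also have "\<dots> \<le> 1 * (ln r - ln t)" using assms le by (intro mult_right_mono) auto
  finally have "- \<eta> * \<bar>ln r\<bar> - ln r \<le> - \<eta> * \<bar>ln t\<bar> - ln t" by (simp add: algebra_simps)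
  then have "exp (- \<eta> * \<bar>ln r\<bar> - ln r) \<le> exp (- \<eta> * \<bar>ln t\<bar> - ln t)" by simp
  then show ?thesis using assms by (simp add: exp_diff)
qed

text \<open>One power integrable at 0 and one integrable at infinity; both are counted at
  \<open>t = 1\<close>, which is harmless for a majorant.\<close>

definition half_tent :: "real \<Rightarrow> real \<Rightarrow> ennreal" where
  "half_tent \<eta> t = ennreal (indicator {0..1} t * t powr (\<eta> - 1)) + ennreal (indicator {1..} t * t powr (- \<eta> - 1))"

text \<open>The infinite value at 0 makes the later bound trivial for complex numbers on the
  coordinate axes and leaves the integral unchanged.\<close>

definition tent :: "real \<Rightarrow> real \<Rightarrow> ennreal" where
  "tent \<eta> t = half_tent \<eta> t + half_tent \<eta> (0 - t) + top * indicator {0} t"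

lemma tent_borel [measurable]: "half_tent \<eta> \<in> borel_measurable borel" "tent \<eta> \<in> borel_measurable borel"
  unfolding half_tent_def[abs_def] tent_def[abs_def] by measurable

lemma half_tent_integral:
  assumes "0 < \<eta>"
  shows "(\<integral>\<^sup>+t. half_tent \<eta> t \<partial>lborel) < \<infinity>"
proof -
  have "((\<lambda>t. t powr (\<eta> - 1)) has_integral (1 powr (\<eta> - 1 + 1) / (\<eta> - 1 + 1))) {0..1}"
    by (rule has_integral_powr_from_0) (use assms in auto)
  then have 1: "(\<integral>\<^sup>+t. ennreal (indicator {0..1} t * t powr (\<eta> - 1)) \<partial>lborel) = ennreal (1 powr (\<eta> - 1 + 1) / (\<eta> - 1 + 1))"
    by (intro nn_integral_has_integral_lborel, measurable)
       (auto simp: has_integral_restrict_UNIV[symmetric, of _ _ "{0..1}"] indicator_def of_bool_def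
          if_distrib[of "\<lambda>x. x * y" for y] cong: if_cong)
  have "((\<lambda>t. t powr (- \<eta> - 1)) has_integral (- (1 powr (- \<eta> - 1 + 1)) / (- \<eta> - 1 + 1))) {1..}"
    by (rule has_integral_powr_to_inf) (use assms in auto)
  then have 2: "(\<integral>\<^sup>+t. ennreal (indicator {1..} t * t powr (- \<eta> - 1)) \<partial>lborel) = ennreal (- (1 powr (- \<eta> - 1 + 1)) / (- \<eta> - 1 + 1))"
    by (intro nn_integral_has_integral_lborel, measurable)
       (auto simp: has_integral_restrict_UNIV[symmetric, of _ _ "{1..}"] indicator_def of_bool_def
          if_distrib[of "\<lambda>x. x * y" for y] cong: if_cong)
  have "(\<integral>\<^sup>+t. half_tent \<eta> t \<partial>lborel) = ennreal (1 powr (\<eta> - 1 + 1) / (\<eta> - 1 + 1)) + ennreal (- (1 powr (- \<eta> - 1 + 1)) / (- \<eta> - 1 + 1))"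
    unfolding half_tent_def by (subst nn_integral_add) (auto simp only: 1 2, measurable)
  then show ?thesis by simp
qed

lemma tent_integral:
  assumes "0 < \<eta>"
  shows "(\<integral>\<^sup>+t. tent \<eta> t \<partial>lborel) < \<infinity>"
proof -
  have z: "(\<integral>\<^sup>+t. (top::ennreal) * indicator {0::real} t \<partial>lborel) = 0"
  proof -
    have "AE t in lborel. (top::ennreal) * indicator {0::real} t = 0"
      by (rule AE_mp[OF AE_lborel_singleton[of 0]]) (auto simp: indicator_def)
    then show ?thesis by (subst nn_integral_0_iff_AE) auto
  qed
  have "(\<integral>\<^sup>+t. tent \<eta> t \<partial>lborel) = (\<integral>\<^sup>+t. half_tent \<eta> t \<partial>lborel) + (\<integral>\<^sup>+t. half_tent \<eta> (0 - t) \<partial>lborel)"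
    unfolding tent_def by (simp add: nn_integral_add z)
  also have "(\<integral>\<^sup>+t. half_tent \<eta> (0 - t) \<partial>lborel) = (\<integral>\<^sup>+t. half_tent \<eta> t \<partial>lborel)"
    by (rule nn_integral_lborel_reflect) simp
  finally show ?thesis using half_tent_integral[OF assms] by simp
qed

lemma half_tent_ge:
  assumes "t > 0"
  shows "ennreal (exp (- \<eta> * \<bar>ln t\<bar>) / t) \<le> half_tent \<eta> t"
proof (cases "t \<le> 1")
  case True
  have "exp (- \<eta> * \<bar>ln t\<bar>) / t = t powr (\<eta> - 1)"
    using assms True by (simp add: powr_diff) (simp add: powr_def)
  then show ?thesis using assms True by (simp add: half_tent_def)
next
  case False
  have "exp (- \<eta> * \<bar>ln t\<bar>) / t = t powr (- \<eta> - 1)"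
    using assms False by (simp add: powr_diff) (simp add: powr_def)
  then show ?thesis using assms False by (simp add: half_tent_def)
qed

lemma tent_ge:
  assumes "t \<noteq> 0"
  shows "ennreal (exp (- \<eta> * \<bar>ln \<bar>t\<bar>\<bar>) / \<bar>t\<bar>) \<le> tent \<eta> t"
proof (cases "t > 0")
  case True
  then have "ennreal (exp (- \<eta> * \<bar>ln \<bar>t\<bar>\<bar>) / \<bar>t\<bar>) \<le> half_tent \<eta> t" using half_tent_ge by simp
  also have "\<dots> \<le> tent \<eta> t" unfolding tent_def by (simp add: add.assoc add_increasing2)
  finally show ?thesis .
next
  case False
  then have "ennreal (exp (- \<eta> * \<bar>ln \<bar>t\<bar>\<bar>) / \<bar>t\<bar>) \<le> half_tent \<eta> (0 - t)" using half_tent_ge[of "0 - t" \<eta>] assms by simp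
  also have "\<dots> \<le> tent \<eta> t" unfolding tent_def by (simp add: add.commute[of "half_tent \<eta> t"] add.assoc add_increasing2)
  finally show ?thesis .
qed

lemma tent_pos: "tent \<eta> t > 0"
proof (cases "t = 0")
  case True
  then show ?thesis by (simp add: tent_def)
next
  case False
  then have "ennreal (exp (- \<eta> * \<bar>ln \<bar>t\<bar>\<bar>) / \<bar>t\<bar>) > 0" by simp
  then show ?thesis using tent_ge[OF False] by (rule less_le_trans)
qed

text \<open>Real and imaginary part are at most \<open>norm z\<close> in modulus, so monotonicity
  splits the radial weight into a product over the real coordinates, which can be integrated one
  variable at a time. On the axes the right side is infinite, since \<open>tent\<close> is positive
  everywhere.\<close>

lemma complex_tent_bound:
  assumes "z \<noteq> 0" "0 < \<eta>" "\<eta> \<le> 1"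
  shows "ennreal (exp (- 2 * \<eta> * \<bar>ln (norm z)\<bar>) / (norm z)\<^sup>2) \<le> tent \<eta> (Re z) * tent \<eta> (Im z)"
proof (cases "Re z = 0 \<or> Im z = 0")
  case True
  then have "tent \<eta> (Re z) = top \<or> tent \<eta> (Im z) = top" by (auto simp: tent_def)
  then have "tent \<eta> (Re z) * tent \<eta> (Im z) = top"
    using tent_pos[of \<eta> "Re z"] tent_pos[of \<eta> "Im z"] by (auto simp: ennreal_mult_eq_top_iff)
  then show ?thesis by simp
next
  case False
  let ?\<beta> = "\<lambda>t. exp (- \<eta> * \<bar>ln t\<bar>) / t"
  have "exp (- 2 * \<eta> * \<bar>ln (norm z)\<bar>) = exp (- \<eta> * \<bar>ln (norm z)\<bar>) * exp (- \<eta> * \<bar>ln (norm z)\<bar>)"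
    by (simp flip: exp_add)
  then have "exp (- 2 * \<eta> * \<bar>ln (norm z)\<bar>) / (norm z)\<^sup>2 = ?\<beta> (norm z) * ?\<beta> (norm z)"
    by (simp add: power2_eq_square)
  also have "\<dots> \<le> ?\<beta> \<bar>Re z\<bar> * ?\<beta> \<bar>Im z\<bar>"
    using False assms by (intro mult_mono log_tent_decreasing abs_Re_le_cmod abs_Im_le_cmod) auto
  finally have "ennreal (exp (- 2 * \<eta> * \<bar>ln (norm z)\<bar>) / (norm z)\<^sup>2) \<le> ennreal (?\<beta> \<bar>Re z\<bar> * ?\<beta> \<bar>Im z\<bar>)"
    by (rule ennreal_leI)
  also have "\<dots> = ennreal (?\<beta> \<bar>Re z\<bar>) * ennreal (?\<beta> \<bar>Im z\<bar>)" by (rule ennreal_mult) auto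
  also have "\<dots> \<le> tent \<eta> (Re z) * tent \<eta> (Im z)" using False by (intro mult_mono tent_ge) auto
  finally show ?thesis .
qed

lemma vec_tent_integral:
  assumes "0 < \<eta>"
  shows "(\<integral>\<^sup>+z. (\<Prod>i\<in>UNIV. tent \<eta> (Re (z $ i)) * tent \<eta> (Im (z $ i))) \<partial>(lborel :: (complex^'n::finite) measure)) < \<infinity>"
proof -
  have B: "(Basis :: (complex^'n) set) = (\<lambda>(i, b). axis i b) ` (UNIV \<times> {1, \<i>})"
    by (auto simp: Basis_vec_def Basis_complex_def)
  have inj: "inj_on (\<lambda>(i, b). axis i b :: complex^'n) (UNIV \<times> {1, \<i>})"
    by (auto simp: inj_on_def axis_eq_axis)
  have "(\<Prod>i\<in>UNIV. tent \<eta> (Re (z $ i)) * tent \<eta> (Im (z $ i))) = (\<Prod>b\<in>Basis. tent \<eta> (z \<bullet> b))" for z :: "complex^'n"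
  proof -
    have "(\<Prod>b\<in>Basis. tent \<eta> (z \<bullet> b)) = (\<Prod>(i, b)\<in>UNIV \<times> {1, \<i>}. tent \<eta> (z \<bullet> axis i b))"
      unfolding B by (subst prod.reindex[OF inj]) (simp add: case_prod_unfold)
    also have "\<dots> = (\<Prod>i\<in>UNIV. \<Prod>b\<in>{1, \<i>}. tent \<eta> (z \<bullet> axis i b))"
      by (rule prod.cartesian_product[symmetric])
    also have "\<dots> = (\<Prod>i\<in>UNIV. tent \<eta> (Re (z $ i)) * tent \<eta> (Im (z $ i)))"
      by (simp add: inner_axis inner_complex_def)
    finally show ?thesis by simp
  qed
  then have "(\<integral>\<^sup>+z. (\<Prod>i\<in>UNIV. tent \<eta> (Re (z $ i)) * tent \<eta> (Im (z $ i))) \<partial>(lborel :: (complex^'n) measure))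
     = (\<integral>\<^sup>+z. (\<Prod>b\<in>Basis. tent \<eta> (z \<bullet> b)) \<partial>(lborel :: (complex^'n) measure))" by simp
  also have "\<dots> = (\<Prod>b\<in>(Basis :: (complex^'n) set). \<integral>\<^sup>+t. tent \<eta> t \<partial>lborel)"
    by (rule nn_integral_lborel_prod) auto
  also have "\<dots> < \<infinity>" using tent_integral[OF assms] by (simp add: power_less_top_ennreal)
  finally show ?thesis .
qed

section \<open>Newton polyhedra and the torus cover\<close>

lemma prod_ennreal_mono:
  "(\<And>i. i \<in> A \<Longrightarrow> f i \<le> g i) \<Longrightarrow> prod f A \<le> (prod g A :: ennreal)"
  by (induction A rule: infinite_finite_induct) (auto intro!: mult_mono)

definition power_map :: "nat \<Rightarrow> complex^'n::finite \<Rightarrow> complex^'n" where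
  "power_map N u = (\<chi> i. (u $ i) ^ N)"

definition log_norm :: "complex^'n::finite \<Rightarrow> real^'n" where
  "log_norm u = (\<chi> i. ln (norm (u $ i)))"

lemma cpoly_eval_alg: "cpoly_eval p \<in> vec_algebra"
  unfolding cpoly_eval_def[abs_def] by (intro vec_algebra_intros vec_algebra_nth)

lemma vec_algebra_power_map:
  assumes "f \<in> vec_algebra"
  shows "(\<lambda>u. f (power_map N u)) \<in> vec_algebra"
  using assms unfolding vec_algebra_def
  by (rule gen_algebra_compose) (auto simp: power_map_def intro!: gen_algebra_power vec_algebra_nth[unfolded vec_algebra_def])

lemma power_map_torus: "u \<in> torus \<Longrightarrow> power_map N u \<in> torus"
  by (simp add: torus_def power_map_def)

lemma power_map_surj:
  assumes "a \<in> torus" "N > 0"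
  obtains u where "u \<in> torus" "power_map N u = a"
proof (rule that[of "\<chi> i. exp (Ln (a $ i) / of_nat N)"])
  show "(\<chi> i. exp (Ln (a $ i) / of_nat N)) \<in> torus" by (simp add: torus_def)
  have "exp (Ln (a $ i) / of_nat N) ^ N = a $ i" for i
    using assms by (simp add: torus_def flip: exp_of_nat_mult)
  then show "power_map N (\<chi> i. exp (Ln (a $ i) / of_nat N)) = a"
    by (simp add: power_map_def vec_eq_iff)
qed

lemma partial_deriv_power_map:
  assumes f: "f \<in> vec_algebra"
  shows "partial_deriv k (\<lambda>u. f (power_map N u)) u =
    partial_deriv k f (power_map N u) * (of_nat N * (u $ k) ^ (N - 1))"
proof (rule partial_deriv_eq)
  have "(power_map N has_derivative (\<lambda>h. \<chi> i. h $ i * (of_nat N * (u $ i) ^ (N - 1)))) (at u)"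
  proof (rule has_derivative_vec_componentwise)
    fix j
    have "((\<lambda>u. u $ j) has_derivative (\<lambda>h. h $ j)) (at u)"
      by (intro bounded_linear_imp_has_derivative bounded_linear_vec_nth)
    from has_derivative_power[OF this, of N]
    show "((\<lambda>u. power_map N u $ j) has_derivative (\<lambda>h. (\<chi> i. h $ i * (of_nat N * (u $ i) ^ (N - 1))) $ j)) (at u)"
      by (simp add: power_map_def mult_ac)
  qed
  from has_derivative_compose[OF this vec_algebra_partial_deriv(2)[OF f]]
  show "((\<lambda>u. f (power_map N u)) has_derivative (\<lambda>h. \<Sum>k\<in>UNIV. h $ k *
      (partial_deriv k f (power_map N u) * (of_nat N * (u $ k) ^ (N - 1))))) (at u)"
    by (simp add: mult_ac)
qed

lemma det_scale_columns:
  fixes A :: "complex^'n::finite^'n"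
  shows "det (\<chi> j k. A $ j $ k * d k) = det A * (\<Prod>k\<in>UNIV. d k)"
proof -
  have "(\<chi> j k. A $ j $ k * d k) = A ** (\<chi> i j. if i = j then d i else 0)"
    by (simp add: matrix_matrix_mult_def vec_eq_iff if_distrib[of "\<lambda>t. y * t" for y] cong: if_cong)
  moreover have "det (\<chi> i j. if i = j then d i else 0 :: complex^'n^'n) = (\<Prod>k\<in>UNIV. d k)"
    by (subst det_diagonal) auto
  ultimately show ?thesis by (simp add: det_mul)
qed

lemma norm_monomial:
  assumes "u \<in> torus"
  shows "norm (\<Prod>i\<in>UNIV. (u $ i) ^ a i) = exp (\<Sum>i\<in>UNIV. real (a i) * log_norm u $ i)"
proof -
  have "norm ((u $ i) ^ a i) = exp (real (a i) * log_norm u $ i)" for i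
    using assms by (simp add: norm_power log_norm_def torus_def exp_of_nat_mult)
  then show ?thesis by (simp add: exp_sum flip: prod_norm)
qed

text \<open>Logarithms multiplied by \<open>N\<close> give a point above
  \<open>power_map N u\<close>; through it the growth hypothesis, stated for exponentials, becomes a
  statement about the torus cover.\<close>

lemma exp_lift:
  assumes "u \<in> torus"
  obtains \<zeta> where "exp_vec \<zeta> = power_map N u" "Re_vec \<zeta> = real N *\<^sub>R log_norm u"
proof (rule that[of "\<chi> i. of_nat N * Ln (u $ i)"])
  show "exp_vec (\<chi> i. of_nat N * Ln (u $ i)) = power_map N u"
    using assms by (simp add: exp_vec_def power_map_def vec_eq_iff exp_of_nat_mult torus_def)
  show "Re_vec (\<chi> i. of_nat N * Ln (u $ i)) = real N *\<^sub>R log_norm u"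
    using assms by (simp add: Re_vec_def log_norm_def vec_eq_iff torus_def)
qed

lemma common_denominator:
  assumes "finite S" "S \<subseteq> \<rat>"
  shows "\<exists>N::nat. N > 0 \<and> (\<forall>x\<in>S. real N * x \<in> \<int>)"
  using assms
proof (induction S rule: finite_induct)
  case empty
  show ?case by (intro exI[of _ 1]) auto
next
  case (insert x S)
  then obtain N where N: "N > 0" "\<forall>x\<in>S. real N * x \<in> \<int>" by auto
  obtain a b :: int where ab: "b > 0" "x = of_int a / of_int b"
    using insert.prems by (metis Rats_cases' insert_subset)
  have "real (nat b) * x = of_int a" using ab by simp
  then have x: "real (N * nat b) * x \<in> \<int>"
    by (simp add: mult.assoc Ints_mult)
  have "real (N * nat b) * y \<in> \<int>" if "y \<in> S" for y
  proof -
    have "real (N * nat b) * y = real (nat b) * (real N * y)" by simp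
    then show ?thesis using N that by (simp only: Ints_mult Ints_of_nat)
  qed
  then show ?case using N ab x by (intro exI[of _ "N * nat b"]) auto
qed

text \<open>The vertices of each \<open>\<delta> j\<close> inherit this sign, so their monomials on
  the cover are genuine polynomials.\<close>

lemma newton_polyhedron_nonneg: "x \<in> newton_polyhedron p \<Longrightarrow> 0 \<le> x $ i"
proof -
  assume x: "x \<in> newton_polyhedron p"
  let ?H = "{x :: real^'a. 0 \<le> x $ i}"
  have c: "closed ?H" by (intro closed_Collect_le continuous_intros)
  have "convex ?H" by (auto simp: convex_def)
  moreover have "exponent_vector ` Poly_Mapping.keys p \<subseteq> ?H" by (auto simp: exponent_vector_def)
  ultimately have "convex hull (exponent_vector ` Poly_Mapping.keys p) \<subseteq> ?H" by (intro hull_minimal)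
  then have "newton_polyhedron p \<subseteq> ?H" unfolding newton_polyhedron_def using c by (rule closure_minimal)
  then show ?thesis using x by auto
qed

text \<open>The polytope is the convex hull of its finitely many extreme points, and a half-space
  containing these contains the hull.\<close>

lemma maximal_vertex:
  fixes \<delta> :: "(real^'n::finite) set"
  assumes "polytope \<delta>" "\<delta> \<noteq> {}"
  obtains v where "v extreme_point_of \<delta>" "\<And>\<xi>. \<xi> \<in> \<delta> \<Longrightarrow> x \<bullet> \<xi> \<le> x \<bullet> v"
proof -
  define V where "V = {v. v extreme_point_of \<delta>}"
  have fin: "finite V" unfolding V_def using assms(1) by (simp add: finite_polyhedron_extreme_points polytope_imp_polyhedron)
  have hull: "\<delta> = convex hull V"
    unfolding V_def using assms(1) by (intro Krein_Milman_Minkowski polytope_imp_compact polytope_imp_convex)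
  have ne: "V \<noteq> {}" using hull assms(2) by auto
  have "Max ((\<lambda>v. x \<bullet> v) ` V) \<in> (\<lambda>v. x \<bullet> v) ` V" using fin ne by (intro Max_in) auto
  then obtain v where v0: "v \<in> V" "Max ((\<lambda>v. x \<bullet> v) ` V) = x \<bullet> v" by blast
  have v: "v \<in> V" "\<And>v'. v' \<in> V \<Longrightarrow> x \<bullet> v' \<le> x \<bullet> v"
    using fin v0 by (auto intro!: Max_ge simp flip: v0(2))
  have "convex {\<xi>. x \<bullet> \<xi> \<le> x \<bullet> v}" by (rule convex_halfspace_le)
  then have sub: "convex hull V \<subseteq> {\<xi>. x \<bullet> \<xi> \<le> x \<bullet> v}" using v by (intro hull_minimal) auto
  have "\<delta> \<subseteq> {\<xi>. x \<bullet> \<xi> \<le> x \<bullet> v}" by (subst hull) (rule sub)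
  then have "x \<bullet> \<xi> \<le> x \<bullet> v" if "\<xi> \<in> \<delta>" for \<xi> using that by blast
  moreover have "v extreme_point_of \<delta>" using v(1) by (simp add: V_def)
  ultimately show ?thesis using that by blast
qed

lemma support_function_ge:
  assumes "polytope \<delta>" "\<xi> \<in> \<delta>"
  shows "x \<bullet> \<xi> \<le> support_function \<delta> x"
proof -
  have "compact ((\<lambda>\<xi>. x \<bullet> \<xi>) ` \<delta>)"
    using assms(1) by (intro compact_continuous_image continuous_intros polytope_imp_compact)
  then have "bdd_above ((\<lambda>\<xi>. x \<bullet> \<xi>) ` \<delta>)" by (simp add: bounded_imp_bdd_above compact_imp_bounded)
  then show ?thesis unfolding support_function_def using assms(2) by (rule cSUP_upper[rotated])
qed

lemma set_sum_mem:
  "x \<in> (\<Sum>j\<in>(UNIV :: 'n::finite set). \<delta> j) \<longleftrightarrow> (\<exists>\<xi>. (\<forall>j. \<xi> j \<in> \<delta> j) \<and> x = (\<Sum>j\<in>UNIV. \<xi> j))"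
  by (subst set_sum_alt) auto

text \<open>
  Since the Newton polyhedron of \<open>Q\<close> is compactly contained in the interior of the Minkowski sum,
  \<open>Q\<close> is smaller than the product of the dominating monomials by an exponential factor.
\<close>
lemma cpoly_decay:
  fixes \<delta> :: "'n::finite \<Rightarrow> (real^'n) set"
  assumes np: "newton_polyhedron Q \<subseteq> interior (\<Sum>j\<in>UNIV. \<delta> j)"
  obtains \<epsilon> C where "\<epsilon> > 0" "C \<ge> 0"
    "\<And>u N v. u \<in> torus \<Longrightarrow> \<forall>j. \<forall>\<xi>\<in>\<delta> j. log_norm u \<bullet> \<xi> \<le> log_norm u \<bullet> v j \<Longrightarrow>
       norm (cpoly_eval Q (power_map N u)) \<le>
         C * exp (real N * (log_norm u \<bullet> (\<Sum>j\<in>UNIV. v j) - \<epsilon> * norm (log_norm u)))"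
proof -
  let ?K = "Poly_Mapping.keys Q"
  have "\<exists>e>0. cball (exponent_vector m) e \<subseteq> (\<Sum>j\<in>UNIV. \<delta> j)" if "m \<in> ?K" for m
  proof -
    have "exponent_vector m \<in> newton_polyhedron Q"
      unfolding newton_polyhedron_def using that by (intro subsetD[OF closure_subset] hull_inc) auto
    then show ?thesis using np mem_interior_cball by blast
  qed
  then obtain e where e: "\<And>m. m \<in> ?K \<Longrightarrow> e m > 0" "\<And>m. m \<in> ?K \<Longrightarrow> cball (exponent_vector m) (e m) \<subseteq> (\<Sum>j\<in>UNIV. \<delta> j)"
    by metis
  \<comment> \<open>Including 1 keeps the minimum defined when \<open>Q\<close> has no
    monomials.\<close>
  define \<epsilon> where "\<epsilon> = Min (insert 1 (e ` ?K))"
  have \<epsilon>: "\<epsilon> > 0" unfolding \<epsilon>_def using e(1) by auto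
  have \<epsilon>le: "\<epsilon> \<le> e m" if "m \<in> ?K" for m unfolding \<epsilon>_def using that by (intro Min_le) auto
  define C where "C = (\<Sum>m\<in>?K. norm (Poly_Mapping.lookup Q m))"
  show ?thesis
  proof (rule that[of \<epsilon> C])
    show "\<epsilon> > 0" by (rule \<epsilon>)
    show "C \<ge> 0" unfolding C_def by (intro sum_nonneg) auto
    fix u N v assume u: "u \<in> torus" and v: "\<forall>j. \<forall>\<xi>\<in>\<delta> j. log_norm u \<bullet> \<xi> \<le> log_norm u \<bullet> v j"
    define x where "x = log_norm u"
    have key: "x \<bullet> exponent_vector m + \<epsilon> * norm x \<le> x \<bullet> (\<Sum>j\<in>UNIV. v j)" if m: "m \<in> ?K" for m
    proof -
      \<comment> \<open>A move by \<open>\<epsilon>\<close> in the direction of \<open>x\<close>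
        stays in the Minkowski sum and gains \<open>\<epsilon> * norm x\<close> in the pairing with
        \<open>x\<close>; for \<open>x = 0\<close> the quotient is 0 and nothing moves.\<close>
      define y where "y = exponent_vector m + (\<epsilon> / norm x) *\<^sub>R x"
      have "y \<in> cball (exponent_vector m) (e m)"
        using \<epsilon> \<epsilon>le[OF m] e(1)[OF m] by (cases "x = 0") (auto simp: y_def dist_norm)
      then have "y \<in> (\<Sum>j\<in>UNIV. \<delta> j)" using e(2)[OF m] by blast
      then obtain \<xi> where \<xi>: "\<And>j. \<xi> j \<in> \<delta> j" "y = (\<Sum>j\<in>UNIV. \<xi> j)" unfolding set_sum_mem by blast
      have "x \<bullet> exponent_vector m + \<epsilon> * norm x = x \<bullet> y"
        by (cases "x = 0") (auto simp: y_def inner_add_right power2_norm_eq_inner[symmetric] power2_eq_square)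
      also have "\<dots> = (\<Sum>j\<in>UNIV. x \<bullet> \<xi> j)" by (simp add: \<xi> inner_sum_right)
      also have "\<dots> \<le> (\<Sum>j\<in>UNIV. x \<bullet> v j)" using v \<xi> by (intro sum_mono) (auto simp: x_def)
      finally show ?thesis by (simp add: inner_sum_right)
    qed
    have "norm (cpoly_eval Q (power_map N u)) \<le> (\<Sum>m\<in>?K. norm (Poly_Mapping.lookup Q m) *
        exp (real N * (x \<bullet> (\<Sum>j\<in>UNIV. v j) - \<epsilon> * norm x)))"
      unfolding cpoly_eval_def
    proof (rule sum_norm_le)
      fix m assume m: "m \<in> ?K"
      have "(\<Prod>i\<in>UNIV. (power_map N u $ i) ^ Poly_Mapping.lookup m i) = (\<Prod>i\<in>UNIV. (u $ i) ^ (N * Poly_Mapping.lookup m i))"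
        by (simp add: power_map_def power_mult)
      then have "norm (\<Prod>i\<in>UNIV. (power_map N u $ i) ^ Poly_Mapping.lookup m i)
          = exp (\<Sum>i\<in>UNIV. real (N * Poly_Mapping.lookup m i) * log_norm u $ i)"
        using norm_monomial[OF u, of "\<lambda>i. N * Poly_Mapping.lookup m i"] by simp
      also have "(\<Sum>i\<in>UNIV. real (N * Poly_Mapping.lookup m i) * log_norm u $ i) = real N * (x \<bullet> exponent_vector m)"
        by (simp add: x_def inner_vec_def exponent_vector_def sum_distrib_left mult_ac)
      also have "exp \<dots> \<le> exp (real N * (x \<bullet> (\<Sum>j\<in>UNIV. v j) - \<epsilon> * norm x))"
        using key[OF m] by (simp add: mult_left_mono le_diff_eq)
      finally show "norm (Poly_Mapping.lookup Q m * (\<Prod>i\<in>UNIV. (power_map N u $ i) ^ Poly_Mapping.lookup m i))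
          \<le> norm (Poly_Mapping.lookup Q m) * exp (real N * (x \<bullet> (\<Sum>j\<in>UNIV. v j) - \<epsilon> * norm x))"
        unfolding norm_mult by (intro mult_left_mono) auto
    qed
    then show "norm (cpoly_eval Q (power_map N u)) \<le>
         C * exp (real N * (log_norm u \<bullet> (\<Sum>j\<in>UNIV. v j) - \<epsilon> * norm (log_norm u)))"
      by (simp add: C_def x_def sum_distrib_right)
  qed
qed

theorem theorem4p2:
  fixes F :: "'n::finite \<Rightarrow> 'n cpoly"
    and \<delta> :: "'n \<Rightarrow> (real ^ 'n) set"
    and c R :: real
    and Q :: "'n cpoly"
  assumes "\<And>j. rational_polytope (\<delta> j)"
    and "\<And>j. \<delta> j \<subseteq> newton_polyhedron (F j)"
    and "aff_dim (\<Sum>j\<in>UNIV. \<delta> j) = int CARD('n)"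
    and "c > 0" and "R > 0"
    and "\<And>\<zeta> :: complex ^ 'n. norm (Re_vec \<zeta>) \<ge> R \<Longrightarrow>
           (\<Sum>j\<in>UNIV. norm (cpoly_eval (F j) (exp_vec \<zeta>)) / exp (support_function (\<delta> j) (Re_vec \<zeta>))) \<ge> c"
    and "\<And>\<alpha>. \<alpha> \<in> torus_zeros F \<Longrightarrow> jacobian_det F \<alpha> \<noteq> 0"
    and "newton_polyhedron Q \<subseteq> interior (\<Sum>j\<in>UNIV. \<delta> j)"
    and "\<exists>a. torus_zeros F - {a} \<subseteq> hypersurface Q"
  shows "torus_zeros F \<subseteq> hypersurface Q"
proof (rule ccontr)
  assume "\<not> ?thesis"
  then obtain \<alpha> where \<alpha>: "\<alpha> \<in> torus_zeros F" "cpoly_eval Q \<alpha> \<noteq> 0" by (auto simp: hypersurface_def)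
  have others: "cpoly_eval Q z = 0" if "z \<in> torus_zeros F" "z \<noteq> \<alpha>" for z
    using assms(9) \<alpha> that by (auto simp: hypersurface_def)
  \<comment> \<open>A nonzero value of \<open>Q\<close> yields a monomial, hence a point of the
    Minkowski sum, hence nonempty summands.\<close>
  have "Poly_Mapping.keys Q \<noteq> {}" using \<alpha>(2) by (auto simp: cpoly_eval_def)
  then have "newton_polyhedron Q \<noteq> {}" by (simp add: newton_polyhedron_def)
  then have ne: "\<delta> j \<noteq> {}" for j
    using assms(8) interior_subset set_sum_mem by (metis empty_iff subset_empty subset_eq)
  have poly: "polytope (\<delta> j)" for j using assms(1) by (simp add: rational_polytope_def)
  define V where "V j = {v. v extreme_point_of \<delta> j}" for j
  have finV: "finite (V j)" for j
    unfolding V_def using poly by (simp add: finite_polyhedron_extreme_points polytope_imp_polyhedron)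
  have V\<delta>: "v \<in> \<delta> j" if "v \<in> V j" for v j using that by (simp add: V_def extreme_point_of_def)
  have neV: "V j \<noteq> {}" for j
    using maximal_vertex[OF poly ne, of j 0] by (auto simp: V_def)
  have Vnonneg: "0 \<le> v $ i" if "v \<in> V j" for v j i
    using newton_polyhedron_nonneg assms(2) V\<delta>[OF that] by blast
  define S where "S = (\<Union>j. \<Union>v\<in>V j. range (\<lambda>i. v $ i))"
  have "finite S" unfolding S_def using finV by auto
  moreover have "S \<subseteq> \<rat>" using assms(1) by (auto simp: S_def V_def rational_polytope_def)
  ultimately obtain N :: nat where N: "N > 0" "\<And>x. x \<in> S \<Longrightarrow> real N * x \<in> \<int>"
    using common_denominator[of S] by blast
  define ex where "ex v i = nat \<lfloor>real N * v $ i\<rfloor>" for v :: "real^'n" and i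
  have ex: "real (ex v i) = real N * v $ i" if "v \<in> V j" for v j i
  proof -
    have "v $ i \<in> S" unfolding S_def using that by blast
    then have "real N * v $ i \<in> \<int>" by (rule N(2))
    moreover have "0 \<le> real N * v $ i" using Vnonneg[OF that] by simp
    ultimately show ?thesis unfolding ex_def by (simp add: of_nat_nat)
  qed
  \<comment> \<open>All choices of one vertex from each polytope: a single index then realises the
    maxima of a linear form on all polytopes at once, as \<open>dom\<close> demands.\<close>
  define I where "I = PiE UNIV V"
  have "finite I" unfolding I_def using finV by (intro finite_PiE) auto
  then obtain h where h: "bij_betw h {0..<card I} I" using ex_bij_betw_nat_finite by blast
  define m where "m = card I"
  have "I \<noteq> {}" unfolding I_def using neV by (simp add: PiE_eq_empty_iff)
  then have m: "m > 0" using \<open>finite I\<close> by (simp add: m_def card_gt_0_iff)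
  have hV: "h \<nu> j \<in> V j" if "\<nu> < m" for \<nu> j
  proof -
    have "h \<nu> \<in> I" using bij_betwE[OF h] that by (simp add: m_def)
    then show ?thesis by (auto simp: I_def)
  qed
  define F' where "F' j u = cpoly_eval (F j) (power_map N u)" for j u
  define Q' where "Q' u = cpoly_eval Q (power_map N u)" for u
  define P where "P \<nu> j u = (\<Prod>i\<in>UNIV. (u $ i) ^ ex (h \<nu> j) i)" for \<nu> j and u :: "complex^'n"
  interpret deformation F' P Q' m
  proof
    show "F' j \<in> vec_algebra" for j unfolding F'_def[abs_def] by (intro vec_algebra_power_map cpoly_eval_alg)
    show "P \<nu> j \<in> vec_algebra" for \<nu> j unfolding P_def[abs_def] by (intro vec_algebra_intros vec_algebra_nth)
    show "Q' \<in> vec_algebra" unfolding Q'_def[abs_def] by (intro vec_algebra_power_map cpoly_eval_alg)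
    show "m > 0" by (rule m)
    show "P \<nu> j z \<noteq> 0" if "z \<in> torus" for \<nu> j z using that by (simp add: P_def torus_def)
  qed
  have normP: "norm (P \<nu> j u) = exp (real N * (log_norm u \<bullet> h \<nu> j))" if "u \<in> torus" "\<nu> < m" for \<nu> j u
    unfolding P_def norm_monomial[OF that(1)]
    by (simp add: ex[OF hV[OF that(2)]] inner_vec_def sum_distrib_left mult_ac)
  obtain \<epsilon> C where \<epsilon>: "\<epsilon> > 0" "C \<ge> 0"
    "\<And>u N v. u \<in> torus \<Longrightarrow> \<forall>j. \<forall>\<xi>\<in>\<delta> j. log_norm u \<bullet> \<xi> \<le> log_norm u \<bullet> v j \<Longrightarrow>
       norm (cpoly_eval Q (power_map N u)) \<le>
         C * exp (real N * (log_norm u \<bullet> (\<Sum>j\<in>UNIV. v j) - \<epsilon> * norm (log_norm u)))"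
    by (rule cpoly_decay[OF assms(8)]) (rule that)
  \<comment> \<open>Converts decay in \<open>norm x\<close> into decay in every coordinate, since
    the moduli of the coordinates sum to at most \<open>CARD('n) * norm x\<close>. The cap 1 is what
    \<open>complex_tent_bound\<close> requires.\<close>
  define \<eta> where "\<eta> = min 1 (real N * \<epsilon> / CARD('n))"
  have \<eta>: "\<eta> > 0" "\<eta> \<le> 1" "\<eta> \<le> real N * \<epsilon> / CARD('n)" using \<epsilon>(1) N(1) by (auto simp: \<eta>_def)
  define g where "g z = ennreal (C\<^sup>2) * (\<Prod>i\<in>UNIV. tent \<eta> (Re (z $ i)) * tent \<eta> (Im (z $ i)))" for z :: "complex^'n"
  have gm: "g \<in> borel_measurable borel" unfolding g_def[abs_def] by measurable
  have gfin: "(\<integral>\<^sup>+z. g z \<partial>lborel) < \<infinity>"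
  proof -
    have "(\<integral>\<^sup>+z. g z \<partial>lborel) = ennreal (C\<^sup>2) * (\<integral>\<^sup>+z. (\<Prod>i\<in>UNIV. tent \<eta> (Re (z $ i)) * tent \<eta> (Im (z $ i))) \<partial>(lborel :: (complex^'n) measure))"
      unfolding g_def by (rule nn_integral_cmult) measurable
    then show ?thesis using vec_tent_integral[OF \<eta>(1), where ?'n = 'n] by (simp add: ennreal_mult_less_top)
  qed
  have dom: "\<exists>\<nu><m. ennreal ((norm (q u))\<^sup>2) \<le> g u * ennreal (\<Prod>j\<in>UNIV. (norm (P \<nu> j u))\<^sup>2)" if u: "u \<in> torus" for u
  proof -
    define x where "x = log_norm u"
    have "\<exists>v. v \<in> V j \<and> (\<forall>\<xi>\<in>\<delta> j. x \<bullet> \<xi> \<le> x \<bullet> v)" for j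
      unfolding V_def by (rule maximal_vertex[OF poly ne, of j x]) blast
    then obtain v where v: "\<And>j. v j \<in> V j" "\<And>j \<xi>. \<xi> \<in> \<delta> j \<Longrightarrow> x \<bullet> \<xi> \<le> x \<bullet> v j" by metis
    have "v \<in> I" using v by (auto simp: I_def)
    then have "v \<in> h ` {0..<m}" unfolding m_def bij_betw_imp_surj_on[OF h] .
    then obtain \<nu> where \<nu>: "\<nu> < m" "h \<nu> = v" by auto
    have pP: "(\<Prod>j\<in>UNIV. norm (P \<nu> j u)) = exp (real N * (x \<bullet> (\<Sum>j\<in>UNIV. v j)))"
      by (simp add: normP[OF u \<nu>(1)] \<nu>(2) x_def inner_sum_right sum_distrib_left flip: exp_sum)
    have "(\<Sum>i\<in>UNIV. \<bar>x $ i\<bar>) \<le> (\<Sum>i\<in>(UNIV::'n set). norm x)"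
      by (intro sum_mono) (metis Finite_Cartesian_Product.norm_nth_le real_norm_def)
    then have "(\<Sum>i\<in>UNIV. \<bar>x $ i\<bar>) \<le> CARD('n) * norm x" by simp
    then have "\<eta> * (\<Sum>i\<in>UNIV. \<bar>x $ i\<bar>) \<le> (real N * \<epsilon> / CARD('n)) * (CARD('n) * norm x)"
      using \<eta> by (intro mult_mono) (auto intro: sum_nonneg)
    then have xx: "\<eta> * (\<Sum>i\<in>UNIV. \<bar>x $ i\<bar>) \<le> real N * (\<epsilon> * norm x)" by simp
    have "norm (Q' u) \<le> C * exp (real N * (x \<bullet> (\<Sum>j\<in>UNIV. v j) - \<epsilon> * norm x))"
      unfolding Q'_def x_def by (rule \<epsilon>(3)[OF u]) (use v in \<open>simp add: x_def\<close>)
    also have "\<dots> = C * exp (- (real N * (\<epsilon> * norm x))) * (\<Prod>j\<in>UNIV. norm (P \<nu> j u))"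
      unfolding pP by (simp add: right_diff_distrib exp_diff exp_minus field_simps)
    also have "\<dots> \<le> C * exp (- \<eta> * (\<Sum>i\<in>UNIV. \<bar>x $ i\<bar>)) * (\<Prod>j\<in>UNIV. norm (P \<nu> j u))"
      using xx \<epsilon>(2) by (intro mult_right_mono mult_left_mono) (auto intro: prod_nonneg)
    finally have Qle: "norm (Q' u) \<le> C * exp (- \<eta> * (\<Sum>i\<in>UNIV. \<bar>x $ i\<bar>)) * (\<Prod>j\<in>UNIV. norm (P \<nu> j u))" .
    have "norm (q u) = norm (Q' u) / (\<Prod>i\<in>UNIV. norm (u $ i))"
      by (simp add: q_def norm_divide prod_norm)
    also have "\<dots> \<le> C * exp (- \<eta> * (\<Sum>i\<in>UNIV. \<bar>x $ i\<bar>)) * (\<Prod>j\<in>UNIV. norm (P \<nu> j u)) / (\<Prod>i\<in>UNIV. norm (u $ i))"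
      by (intro divide_right_mono Qle prod_nonneg) auto
    finally have "(norm (q u))\<^sup>2 \<le> (C * exp (- \<eta> * (\<Sum>i\<in>UNIV. \<bar>x $ i\<bar>)) * (\<Prod>j\<in>UNIV. norm (P \<nu> j u)) / (\<Prod>i\<in>UNIV. norm (u $ i)))\<^sup>2"
      by (intro power_mono) auto
    also have "\<dots> = C\<^sup>2 * (\<Prod>i\<in>UNIV. exp (- 2 * \<eta> * \<bar>ln (norm (u $ i))\<bar>) / (norm (u $ i))\<^sup>2) * (\<Prod>j\<in>UNIV. (norm (P \<nu> j u))\<^sup>2)"
    proof -
      have "(exp (- \<eta> * (\<Sum>i\<in>UNIV. \<bar>x $ i\<bar>)))\<^sup>2 = exp (\<Sum>i\<in>UNIV. - 2 * \<eta> * \<bar>ln (norm (u $ i))\<bar>)"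
        by (simp add: x_def log_norm_def power2_eq_square sum_distrib_left mult.assoc flip: exp_add)
      then show ?thesis
        by (simp add: power_mult_distrib power_divide exp_sum prod_power_distrib prod_dividef)
    qed
    finally have "ennreal ((norm (q u))\<^sup>2) \<le> ennreal (C\<^sup>2 * (\<Prod>i\<in>UNIV. exp (- 2 * \<eta> * \<bar>ln (norm (u $ i))\<bar>) / (norm (u $ i))\<^sup>2) * (\<Prod>j\<in>UNIV. (norm (P \<nu> j u))\<^sup>2))"
      by (rule ennreal_leI)
    also have "\<dots> = ennreal (C\<^sup>2) * (\<Prod>i\<in>UNIV. ennreal (exp (- 2 * \<eta> * \<bar>ln (norm (u $ i))\<bar>) / (norm (u $ i))\<^sup>2)) * ennreal (\<Prod>j\<in>UNIV. (norm (P \<nu> j u))\<^sup>2)"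
      by (subst prod_ennreal) (auto simp: ennreal_mult prod_nonneg)
    also have "\<dots> \<le> g u * ennreal (\<Prod>j\<in>UNIV. (norm (P \<nu> j u))\<^sup>2)"
      unfolding g_def using u \<eta>
      by (intro mult_right_mono mult_left_mono prod_ennreal_mono complex_tent_bound) (auto simp: torus_def)
    finally show ?thesis using \<nu>(1) by blast
  qed
  \<comment> \<open>Perturbations of this size contribute at most \<open>m * e\<close> to each of
    the \<open>CARD('n)\<close> quotients, altogether \<open>c / 2\<close>, which the growth
    hypothesis forbids once \<open>norm (Re_vec \<zeta>) \<ge> R\<close>.\<close>
  define e where "e = c / (2 * real CARD('n) * real m)"
  have e: "e > 0" using assms(4) m by (simp add: e_def)
  let ?L = "{z :: complex^'n. \<forall>i. norm (z $ i) \<le> exp R \<and> 1 / exp R \<le> norm (z $ i)}"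
  have L: "compact ?L" "?L \<subseteq> torus" by (rule compact_torus_box[of "exp R"], simp)+
  have inL: "u \<in> ?L" if w: "\<And>\<nu> j. \<nu> < m \<Longrightarrow> norm (w \<nu> $ j) \<le> e" and u: "u \<in> torus"
    and eq: "\<And>j. F' j u = (\<Sum>\<nu><m. w \<nu> $ j * P \<nu> j u)" for w u
  proof -
    define x where "x = log_norm u"
    have "norm (real N *\<^sub>R x) < R"
    proof (rule ccontr)
      assume "\<not> ?thesis"
      then have big: "norm (real N *\<^sub>R x) \<ge> R" by simp
      obtain \<zeta> where \<zeta>: "exp_vec \<zeta> = power_map N u" "Re_vec \<zeta> = real N *\<^sub>R x"
        using exp_lift[OF u] unfolding x_def by blast
      have "c \<le> (\<Sum>j\<in>UNIV. norm (F' j u) / exp (support_function (\<delta> j) (real N *\<^sub>R x)))"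
        using assms(6)[of \<zeta>] big by (simp add: \<zeta> F'_def)
      also have "\<dots> \<le> (\<Sum>j\<in>(UNIV::'n set). real m * e)"
      proof (rule sum_mono)
        fix j
        have "norm (F' j u) \<le> (\<Sum>\<nu><m. e * exp (support_function (\<delta> j) (real N *\<^sub>R x)))"
          unfolding eq
        proof (rule sum_norm_le)
          fix \<nu> assume "\<nu> \<in> {..<m}"
          then have \<nu>: "\<nu> < m" by simp
          have "norm (P \<nu> j u) = exp ((real N *\<^sub>R x) \<bullet> h \<nu> j)" by (simp add: normP[OF u \<nu>] x_def)
          also have "\<dots> \<le> exp (support_function (\<delta> j) (real N *\<^sub>R x))"
            unfolding exp_le_cancel_iff by (rule support_function_ge[OF poly V\<delta>[OF hV[OF \<nu>]]])
          finally show "norm (w \<nu> $ j * P \<nu> j u) \<le> e * exp (support_function (\<delta> j) (real N *\<^sub>R x))"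
            unfolding norm_mult using w[OF \<nu>] e by (intro mult_mono) auto
        qed
        then show "norm (F' j u) / exp (support_function (\<delta> j) (real N *\<^sub>R x)) \<le> real m * e"
          by (simp add: divide_le_eq mult.assoc)
      qed
      also have "\<dots> = c / 2" using m by (simp add: e_def)
      finally show False using assms(4) by simp
    qed
    then have "real N * norm x < R" by simp
    moreover have "norm x \<le> real N * norm x" using N(1) by (simp add: mult_le_cancel_right1)
    ultimately have "norm x < R" by linarith
    have lnR: "\<bar>ln (norm (u $ i))\<bar> < R" for i
      using Finite_Cartesian_Product.norm_nth_le[of x i] \<open>norm x < R\<close> by (simp add: x_def log_norm_def)
    have "ln (norm (u $ i)) \<le> R" "- R \<le> ln (norm (u $ i))" for i using lnR[of i] by linarith+
    moreover have "norm (u $ i) = exp (ln (norm (u $ i)))" for i using u by (simp add: torus_def)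
    ultimately have "norm (u $ i) \<le> exp R" "exp (- R) \<le> norm (u $ i)" for i
      by (metis exp_le_cancel_iff)+
    then show ?thesis by (simp add: exp_minus inverse_eq_divide)
  qed
  \<comment> \<open>By the chain rule column \<open>k\<close> acquires the derivative of the power
    map in that coordinate, which has no zero on the torus; hence simple zeros stay simple.\<close>
  have jacF': "det (\<chi> j k. partial_deriv k (F' j) u) = jacobian_det F (power_map N u) * (\<Prod>k\<in>UNIV. of_nat N * (u $ k) ^ (N - 1))" for u
    unfolding jacobian_det_def det_scale_columns[symmetric] F'_def
    by (simp add: partial_deriv_power_map[OF cpoly_eval_alg])
  have zF: "power_map N u \<in> torus_zeros F" if "u \<in> torus" "\<And>j. F' j u = 0" for u
    using that power_map_torus[OF that(1)] by (auto simp: torus_zeros_def hypersurface_def F'_def)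
  have nd: "det (\<chi> j k. partial_deriv k (F' j) u) \<noteq> 0" if "u \<in> torus" "\<And>j. F' j u = 0" for u
    unfolding jacF' using assms(7)[OF zF[OF that]] N(1) that(1) by (simp add: torus_def)
  define Z where "Z = {u \<in> torus. \<forall>j. F' j u = 0}"
  have finZ: "finite Z"
    unfolding Z_def by (rule residue_sum_zero(1)[OF gm gfin dom L e inL nd])
  have sum0: "(\<Sum>u\<in>Z. Q' u / (\<Prod>i\<in>UNIV. u $ i) / det (\<chi> j k. partial_deriv k (F' j) u)) = 0"
    unfolding Z_def by (rule residue_sum_zero(2)[OF gm gfin dom L e inL nd])
  \<comment> \<open>The common value of the summand at all preimages of \<alpha>: the factors
    \<open>u $ i\<close> and \<open>N * (u $ i) ^ (N - 1)\<close> combine to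
    \<open>N * \<alpha> $ i\<close>, independently of the root chosen.\<close>
  define t where "t = cpoly_eval Q \<alpha> / (jacobian_det F \<alpha> * (of_nat N ^ CARD('n) * (\<Prod>i\<in>UNIV. \<alpha> $ i)))"
  have \<alpha>t: "\<alpha> \<in> torus" using \<alpha>(1) by (simp add: torus_zeros_def)
  have t: "t \<noteq> 0" using \<alpha> assms(7)[OF \<alpha>(1)] N(1) \<alpha>t by (simp add: t_def torus_def)
  have summand: "Q' u / (\<Prod>i\<in>UNIV. u $ i) / det (\<chi> j k. partial_deriv k (F' j) u) = (if power_map N u = \<alpha> then t else 0)"
    if u: "u \<in> Z" for u
  proof (cases "power_map N u = \<alpha>")
    case True
    have "(\<Prod>i\<in>UNIV. u $ i) * (\<Prod>k\<in>UNIV. of_nat N * (u $ k) ^ (N - 1)) = (\<Prod>i\<in>UNIV. of_nat N * (u $ i * (u $ i) ^ (N - 1)))"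
      by (simp add: mult_ac flip: prod.distrib)
    also have "\<dots> = (\<Prod>i\<in>UNIV. of_nat N * power_map N u $ i)"
      using N(1) by (simp add: power_map_def flip: power_Suc)
    also have "\<dots> = of_nat N ^ CARD('n) * (\<Prod>i\<in>UNIV. \<alpha> $ i)" using True by (simp add: prod.distrib)
    finally have "(\<Prod>i\<in>UNIV. u $ i) * (\<Prod>k\<in>UNIV. of_nat N * (u $ k) ^ (N - 1)) = of_nat N ^ CARD('n) * (\<Prod>i\<in>UNIV. \<alpha> $ i)" .
    then show ?thesis using True by (simp add: jacF' Q'_def t_def mult_ac)
  next
    case False
    have "power_map N u \<in> torus_zeros F" using u by (intro zF) (auto simp: Z_def)
    then show ?thesis using others[of "power_map N u"] False by (simp add: Q'_def)
  qed
  obtain u0 where u0: "u0 \<in> torus" "power_map N u0 = \<alpha>" using power_map_surj[OF \<alpha>t N(1)] by blast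
  have "u0 \<in> Z" using u0 \<alpha>(1) by (auto simp: Z_def F'_def torus_zeros_def hypersurface_def)
  \<comment> \<open>Zeros above other points contribute 0, so the vanishing sum counts the preimages
    of \<alpha> with the nonzero weight \<open>t\<close>; yet \<open>u0\<close> is one of
    them.\<close>
  have "0 = (\<Sum>u\<in>Z. if power_map N u = \<alpha> then t else 0)" using sum0 summand by simp
  also have "\<dots> = of_nat (card {u \<in> Z. power_map N u = \<alpha>}) * t"
    using finZ by (simp add: sum.If_cases Int_def)
  finally have "card {u \<in> Z. power_map N u = \<alpha>} = 0" using t by simp
  then show False using finZ \<open>u0 \<in> Z\<close> u0(2) by auto
qed

end
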